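(* There exists an absolute constant $c>0$ such that the following holds. Consider a sequence of regression problems indexed by the sample size $n$: for each $n$, let $p=p_n\le n$ and $k=k_n$ be integers, let $P=P_n$ be a probability distribution on $\mathbb{R}^{p+1}$ satisfying Model 1, with generic sample $(\boldsymbol{x},y)$ and covariance $\Sigma=\mathbb{E}[\boldsymbol{x}\boldsymbol{x}^\top]$, and let $(\boldsymbol{x}_1,y_1),\ldots,(\boldsymbol{x}_n,y_n)$ be i.i.d. samples from $P$. Assume that as $n\to\infty$ the quantities $\|\Sigma^{-1/2}\|$, $\|\Sigma^{-1/2}\boldsymbol{x}\|_{\psi_2}$ and $\|y\|_{\psi_2}$ are bounded. If $\limsup_{n\to\infty}\|\Sigma^{-1/2}\boldsymbol{x}\|_{\psi_2}^2\sqrt{p/n}<c$ and $k/n\to 0$, then $$\max_{\mathcal{S}\subseteq[n],\,|\mathcal{S}|\ge n-k}\big\|\widehat{\boldsymbol\beta}-\widehat{\boldsymbol\beta}_{\mathcal{S}}\big\|\xrightarrow{\;p\;}0\qquad\text{as } n\to\infty .$$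
   Context: Model 1: $P(\boldsymbol{x},y)$ is a probability distribution over $\mathbb{R}^{p+1}$ ($\boldsymbol{x}\in\mathbb{R}^p$, $y\in\mathbb{R}$) such that (i) $\boldsymbol{x}$ is sub-Gaussian, has zero mean, and has positive-definite covariance $\Sigma=\mathbb{E}[\boldsymbol{x}\boldsymbol{x}^\top]$; (ii) $y$ is sub-Gaussian. (No linear relation between $y$ and $\boldsymbol{x}$ is assumed.) Norms: for a real random variable $z$, $\|z\|_{\psi_2}=\inf\{t>0:\mathbb{E}[\exp(z^2/t^2)]\le e\}$; for a random vector $\boldsymbol{z}\in\mathbb{R}^p$, $\|\boldsymbol{z}\|_{\psi_2}=\sup_{\boldsymbol{v}\in\mathbb{S}^{p-1}}\|\boldsymbol{v}^\top\boldsymbol{z}\|_{\psi_2}$. A random variable or vector is sub-Gaussian if its $\psi_2$ norm is finite. For vectors $\|\cdot\|$ is the Euclidean norm; for matrices it is the spectral norm. OLS: $X\in\mathbb{R}^{n\times p}$ has rows $\boldsymbol{x}_1,\ldots,\boldsymbol{x}_n$ and $\boldsymbol{y}=(y_1,\ldots,y_n)^\top$. For $\mathcal{S}\subseteq[n]=\{1,\ldots,n\}$, $X_{\mathcal{S}}$ and $\boldsymbol{y}_{\mathcal{S}}$ are the restrictions to the rows/entries indexed by $\mathcal{S}$. $\widehat{\boldsymbol\beta}=(X^\top X)^{-1}X^\top\boldsymbol{y}$ and $\widehat{\boldsymbol\beta}_{\mathcal{S}}=(X_{\mathcal{S}}^\top X_{\mathcal{S}})^{-1}X_{\mathcal{S}}^\top\boldsymbol{y}_{\mathcal{S}}$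 whenever $X$, respectively $X_{\mathcal{S}}$, has full column rank; otherwise the estimator may be assigned an arbitrary value. $\xrightarrow{p}$ denotes convergence in probability. *)

theory Defs
  imports
    "HOL-Probability.Probability"
    "Jordan_Normal_Form.Gauss_Jordan_Elimination"
    "Jordan_Normal_Form.DL_Rank"
    "Jordan_Normal_Form.DL_Submatrix"
begin

no_notation inner (infix "\<bullet>" 70)
no_notation Finite_Cartesian_Product.vec_nth (infixl "$" 90)

(* The dimension p varies with the sample size, so vectors and matrices are those of
   Jordan_Normal_Form. Indices start at 0 throughout. *)

type_synonym rvec = "real Matrix.vec"
type_synonym rmat = "real Matrix.mat"

definition vnorm :: "rvec \<Rightarrow> real" where
  "vnorm v = sqrt (v \<bullet> v)"

(* The closed unit ball instead of the unit sphere only matters for matrices with no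
   columns, whose norm is then 0 and not the unspecified real number Sup {}. *)
definition spectral_norm :: "rmat \<Rightarrow> real" where
  "spectral_norm A = (SUP v\<in>{v \<in> carrier_vec (dim_col A). vnorm v \<le> 1}. vnorm (A *\<^sub>v v))"

definition pos_def_mat :: "rmat \<Rightarrow> bool" where
  "pos_def_mat A \<longleftrightarrow> square_mat A \<and> A\<^sup>T = A \<and>
     (\<forall>v \<in> carrier_vec (dim_row A). v \<noteq> 0\<^sub>v (dim_row A) \<longrightarrow> 0 < v \<bullet> (A *\<^sub>v v))"

definition mat_inv :: "rmat \<Rightarrow> rmat" where
  "mat_inv A = the (mat_inverse A)"

definition mat_inv_sqrt :: "rmat \<Rightarrow> rmat" where
  "mat_inv_sqrt A = (THE R. pos_def_mat R \<and> R * R = mat_inv A)"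

(* Values in ennreal: the infimum of the empty set is infinity, and a variable is
   sub-Gaussian iff its norm is finite. *)
definition psi2_norm :: "'a measure \<Rightarrow> ('a \<Rightarrow> real) \<Rightarrow> ennreal" where
  "psi2_norm M Z =
     Inf {ennreal t | t. t > 0 \<and> (\<integral>\<^sup>+ \<omega>. ennreal (exp ((Z \<omega>)\<^sup>2 / t\<^sup>2)) \<partial>M) \<le> ennreal (exp 1)}"

definition psi2_norm_vec :: "nat \<Rightarrow> 'a measure \<Rightarrow> ('a \<Rightarrow> rvec) \<Rightarrow> ennreal" where
  "psi2_norm_vec p M Z =
     (SUP v\<in>{v \<in> carrier_vec p. vnorm v = 1}. psi2_norm M (\<lambda>\<omega>. v \<bullet> Z \<omega>))"

(* An observation (x, y) in R^p x R. The measurable structure on R^p is that of the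
   product of p copies of the Borel space; covar turns x into a vector of dimension p. *)
type_synonym obs = "(nat \<Rightarrow> real) \<times> real"

definition obs_space :: "nat \<Rightarrow> obs measure" where
  "obs_space p = (\<Pi>\<^sub>M j\<in>{..<p}. borel) \<Otimes>\<^sub>M borel"

definition covar :: "nat \<Rightarrow> obs \<Rightarrow> rvec" where
  "covar p z = Matrix.vec p (fst z)"

definition cov_mat :: "nat \<Rightarrow> obs measure \<Rightarrow> rmat" where
  "cov_mat p P = Matrix.mat p p (\<lambda>(i, j). \<integral>z. covar p z $ i * covar p z $ j \<partial>P)"

definition model1 :: "nat \<Rightarrow> obs measure \<Rightarrow> bool" where
  "model1 p P \<longleftrightarrow> prob_space P \<and> sets P = sets (obs_space p) \<and>
     psi2_norm_vec p P (covar p) < \<infinity> \<and>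
     (\<forall>j<p. (\<integral>z. covar p z $ j \<partial>P) = 0) \<and>
     pos_def_mat (cov_mat p P) \<and>
     psi2_norm P snd < \<infinity>"

(* The law of n i.i.d. observations with law P. *)
definition sample_space :: "nat \<Rightarrow> obs measure \<Rightarrow> (nat \<Rightarrow> obs) measure" where
  "sample_space n P = (\<Pi>\<^sub>M i\<in>{..<n}. P)"

definition design :: "nat \<Rightarrow> nat \<Rightarrow> (nat \<Rightarrow> obs) \<Rightarrow> rmat" where
  "design n p d = Matrix.mat n p (\<lambda>(i, j). covar p (d i) $ j)"

definition response :: "nat \<Rightarrow> (nat \<Rightarrow> obs) \<Rightarrow> rvec" where
  "response n d = Matrix.vec n (\<lambda>i. snd (d i))"

definition restrict_rows :: "rmat \<Rightarrow> nat set \<Rightarrow> rmat" where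
  "restrict_rows X S = submatrix X S UNIV"

(* Same row enumeration as in submatrix. *)
definition restrict_vec :: "rvec \<Rightarrow> nat set \<Rightarrow> rvec" where
  "restrict_vec y S = Matrix.vec (card {i. i < dim_vec y \<and> i \<in> S}) (\<lambda>i. y $ pick S i)"

definition full_column_rank :: "rmat \<Rightarrow> bool" where
  "full_column_rank X \<longleftrightarrow> vec_space.rank (dim_row X) X = dim_col X"

definition ols :: "rmat \<Rightarrow> rvec \<Rightarrow> rvec" where
  "ols X y = mat_inv (X\<^sup>T * X) *\<^sub>v (X\<^sup>T *\<^sub>v y)"

(* b is the OLS estimator in R^p, as a random vector on the space M of data sets d, for
   the regression with design X d and response y d. Its value is arbitrary at those d
   where X d does not have full column rank. *)
definition is_ols_estimator ::
  "'d measure \<Rightarrow> nat \<Rightarrow> ('d \<Rightarrow> rmat) \<Rightarrow> ('d \<Rightarrow> rvec) \<Rightarrow> ('d \<Rightarrow> rvec) \<Rightarrow> bool" where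
  "is_ols_estimator M p X y b \<longleftrightarrow>
     (\<forall>d \<in> space M. b d \<in> carrier_vec p) \<and>
     (\<forall>j<p. (\<lambda>d. b d $ j) \<in> borel_measurable M) \<and>
     (\<forall>d \<in> space M. full_column_rank (X d) \<longrightarrow> b d = ols (X d) (y d))"

(* The n-th variable lives on its own probability space M n. *)
definition converges_in_probability ::
  "(nat \<Rightarrow> 'a measure) \<Rightarrow> (nat \<Rightarrow> 'a \<Rightarrow> real) \<Rightarrow> real \<Rightarrow> bool" where
  "converges_in_probability M Z z \<longleftrightarrow>
     (\<forall>\<epsilon>>0. (\<lambda>n. measure (M n) {\<omega> \<in> space (M n). \<bar>Z n \<omega> - z\<bar> > \<epsilon>}) \<longlonglongrightarrow> 0)"

end

theory Submission
  imports Defs "Jordan_Normal_Form.Spectral_Radius"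
begin

text \<open>Let \<open>\<Sigma>\<close> be the covariance of \<open>x\<close> and \<open>K\<close> the \<open>\<psi>\<^sub>2\<close> norm of the whitened, isotropic covariates
  \<open>z = \<Sigma>\<^sup>-\<^sup>1\<^sup>/\<^sup>2 x\<close>. Fix a set \<open>S\<close> of retained observations, with complement \<open>T\<close>. Subtracting the
  normal equations for \<open>S\<close> from those for the full sample shows that \<open>X (\<beta> - \<beta>\<^sub>S)\<close> is the orthogonal
  projection, onto the column space of \<open>X\<close>, of the vector that equals the prediction error \<open>y\<^sub>i - x\<^sub>i \<bullet> \<beta>\<^sub>S\<close>
  for \<open>i \<in> T\<close> and 0 elsewhere. Hence \<open>|X (\<beta> - \<beta>\<^sub>S)|\<close> is at most the length of the prediction error on the
  removed points (\<open>ols_difference_bound\<close>), and it suffices to prove two facts, each uniformly in \<open>S\<close>.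

  First, \<open>\<Sum>\<^sub>i\<^sub>\<in>\<^sub>S (z\<^sub>i \<bullet> v)\<^sup>2 \<ge> (|S| / 2) |v|\<^sup>2\<close> for all \<open>v\<close>. In one direction this is
  Bernstein's inequality for squares of sub-Gaussian variables, with failure probability \<open>exp (- c n / K ^ 4)\<close>
  (\<open>bernstein_square\<close>). All directions are reached through a \<open>1/4\<close>-net with \<open>exp (18 p)\<close> points
  (\<open>unit_ball_net_exists\<close>, \<open>quad_dev_net\<close>). An upper bound on \<open>K\<^sup>2 sqrt (p / n)\<close> by a small absolute constant says
  exactly that \<open>p\<close> is a small multiple of \<open>n / K ^ 4\<close>, so the net is affordable. The deviation is controlled from
  both sides: with only the crude bound \<open>O (K sqrt n)\<close> on the largest singular value, the mesh of the net would have
  to shrink with \<open>K\<close>, at the price of a factor \<open>log K\<close>.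

  Secondly, the squared prediction error on \<open>T\<close> exceeds \<open>\<delta> n\<close> only with probability \<open>exp (|T| - c' \<delta> n)\<close>,
  because \<open>\<beta>\<^sub>S\<close> is independent of the observations in \<open>T\<close> and its whitened coefficients are bounded by the first fact
  (\<open>held_out_residual_tail\<close>). A bound by the operator norm of \<open>X\<^sub>T\<close> times the length of \<open>\<beta>\<close> would give only
  \<open>O (sqrt n)\<close>, since \<open>p\<close> may be proportional to \<open>n\<close>; independence is what yields \<open>o (sqrt n)\<close>.

  Both probabilities are exponentially small in \<open>n\<close>, whereas \<open>k / n \<rightarrow> 0\<close> makes the number of sets \<open>S\<close>
  subexponential (\<open>card_large_subsets_subexponential\<close>), and a union bound over \<open>S\<close> concludes the proof.\<close>

section \<open>Positive definite square roots\<close>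

lemma symmetric_form_commute:
  fixes A :: rmat
  assumes A: "A \<in> carrier_mat n n" and sym: "A\<^sup>T = A"
    and x: "x \<in> carrier_vec n" and y: "y \<in> carrier_vec n"
  shows "(A *\<^sub>v x) \<bullet> y = x \<bullet> (A *\<^sub>v y)"
  using transpose_vec_mult_scalar[OF A y x] sym by simp

lemma scalar_prod_self_pos_iff:
  fixes v :: rvec
  assumes "v \<in> carrier_vec n"
  shows "0 < v \<bullet> v \<longleftrightarrow> v \<noteq> 0\<^sub>v n"
proof
  assume "0 < v \<bullet> v" then show "v \<noteq> 0\<^sub>v n" by auto
next
  assume "v \<noteq> 0\<^sub>v n"
  then obtain i where i: "i < n" "v $ i \<noteq> 0" using assms by (metis eq_vecI index_zero_vec carrier_vecD)
  have "0 < (v $ i)\<^sup>2" using i by simp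
  also have "\<dots> \<le> (\<Sum>j\<in>{0..<n}. (v $ j)\<^sup>2)"
    using i by (intro member_le_sum) auto
  finally show "0 < v \<bullet> v" using assms by (simp add: scalar_prod_def power2_eq_square)
qed

text \<open>Over the complex numbers every square matrix has an eigenvector \<open>x + i y\<close>. Symmetry gives
  \<open>A x \<bullet> y = x \<bullet> A y\<close>, which forces the imaginary part of the eigenvalue to vanish; then \<open>x\<close> and \<open>y\<close>
  are both eigenvectors for the same real eigenvalue, unless zero.\<close>

lemma symmetric_eigenvector_exists:
  fixes A :: rmat
  assumes A: "A \<in> carrier_mat n n" and sym: "A\<^sup>T = A" and n: "0 < n"
  shows "\<exists>e v. v \<in> carrier_vec n \<and> v \<noteq> 0\<^sub>v n \<and> A *\<^sub>v v = e \<cdot>\<^sub>v v"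
proof -
  let ?C = "map_mat complex_of_real A"
  have C: "?C \<in> carrier_mat n n" using A by simp
  from spectrum_non_empty[OF C n] obtain e where "eigenvalue ?C e"
    unfolding spectrum_def by auto
  then obtain z where z: "z \<in> carrier_vec n" "z \<noteq> 0\<^sub>v n" "?C *\<^sub>v z = e \<cdot>\<^sub>v z"
    unfolding eigenvalue_def eigenvector_def using C by auto
  define x y where "x = map_vec Re z" and "y = map_vec Im z"
  have x: "x \<in> carrier_vec n" and y: "y \<in> carrier_vec n" using z by (auto simp: x_def y_def)
  have comp: "(\<Sum>j\<in>{0..<n}. complex_of_real (A $$ (i,j)) * z $ j) = e * z $ i" if "i < n" for i
  proof -
    have "(?C *\<^sub>v z) $ i = (\<Sum>j\<in>{0..<n}. complex_of_real (A $$ (i,j)) * z $ j)"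
      using that A z(1) by (simp add: scalar_prod_def)
    then show ?thesis using z that by simp
  qed
  have Ax: "A *\<^sub>v x = Re e \<cdot>\<^sub>v x + (- Im e) \<cdot>\<^sub>v y"
  proof (rule eq_vecI)
    fix i assume "i < dim_vec (Re e \<cdot>\<^sub>v x + (- Im e) \<cdot>\<^sub>v y)"
    then have i: "i < n" using y by simp
    have "(A *\<^sub>v x) $ i = Re (\<Sum>j\<in>{0..<n}. complex_of_real (A $$ (i,j)) * z $ j)"
      using i A z(1) by (simp add: scalar_prod_def x_def)
    also have "\<dots> = Re e * Re (z $ i) - Im e * Im (z $ i)" by (simp add: comp[OF i])
    finally show "(A *\<^sub>v x) $ i = (Re e \<cdot>\<^sub>v x + (- Im e) \<cdot>\<^sub>v y) $ i"
      using i z(1) by (simp add: x_def y_def)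
  qed (use A y in auto)
  have Ay: "A *\<^sub>v y = Im e \<cdot>\<^sub>v x + Re e \<cdot>\<^sub>v y"
  proof (rule eq_vecI)
    fix i assume "i < dim_vec (Im e \<cdot>\<^sub>v x + Re e \<cdot>\<^sub>v y)"
    then have i: "i < n" using y by simp
    have "(A *\<^sub>v y) $ i = Im (\<Sum>j\<in>{0..<n}. complex_of_real (A $$ (i,j)) * z $ j)"
      using i A z(1) by (simp add: scalar_prod_def y_def)
    also have "\<dots> = Re e * Im (z $ i) + Im e * Re (z $ i)" by (simp add: comp[OF i])
    finally show "(A *\<^sub>v y) $ i = (Im e \<cdot>\<^sub>v x + Re e \<cdot>\<^sub>v y) $ i"
      using i z(1) by (simp add: x_def y_def)
  qed (use A y in auto)
  have xy0: "x \<noteq> 0\<^sub>v n \<or> y \<noteq> 0\<^sub>v n"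
  proof (rule ccontr)
    assume "\<not> ?thesis"
    then have "z $ i = 0" if "i < n" for i
      using that z(1) by (metis complex_eqI carrier_vecD index_map_vec(1) index_zero_vec(1)
          x_def y_def zero_complex.sel)
    then show False using z by auto
  qed
  have "(A *\<^sub>v x) \<bullet> y = x \<bullet> (A *\<^sub>v y)" by (rule symmetric_form_commute[OF A sym x y])
  then have "Im e * (x \<bullet> x + y \<bullet> y) = 0"
    unfolding Ax Ay using x y
    by (simp add: add_scalar_prod_distrib[of _ n] scalar_prod_add_distrib[of _ n]
        comm_scalar_prod[of y n x] algebra_simps)
  moreover have "0 < x \<bullet> x + y \<bullet> y"
    using xy0 scalar_prod_self_pos_iff[OF x] scalar_prod_self_pos_iff[OF y] 
    by (metis add_pos_nonneg add_nonneg_pos order_less_imp_le scalar_prod_left_zero x y order_refl)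
  ultimately have im: "Im e = 0" by simp
  have "A *\<^sub>v x = Re e \<cdot>\<^sub>v x" "A *\<^sub>v y = Re e \<cdot>\<^sub>v y"
    unfolding Ax Ay im using x y by auto
  then show ?thesis using xy0 x y by blast
qed

text \<open>The reflection in the hyperplane orthogonal to \<open>u = v - e\<^sub>0\<close> exchanges the unit vectors \<open>e\<^sub>0\<close> and \<open>v\<close>.
  It is used to split off an eigenvector \<open>v\<close> by a symmetric change of basis that is its own inverse.\<close>

lemma householder_exists:
  fixes v :: rvec
  assumes v: "v \<in> carrier_vec (Suc m)" and unit: "v \<bullet> v = 1"
  shows "\<exists>H. H \<in> carrier_mat (Suc m) (Suc m) \<and> H\<^sup>T = H \<and> H * H = 1\<^sub>m (Suc m) \<and>
             H *\<^sub>v unit_vec (Suc m) 0 = v"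
proof -
  let ?n = "Suc m"
  define u where "u = v - unit_vec ?n 0"
  have u: "u \<in> carrier_vec ?n" using v by (simp add: u_def)
  \<comment> \<open>The value 0 covers \<open>v = e\<^sub>0\<close>, where the identity takes the place of the reflection.\<close>
  define c where "c = (if u \<bullet> u = 0 then 0 else 2 / (u \<bullet> u))"
  have uu: "u \<bullet> u = 2 - 2 * v $ 0"
  proof -
    have "(\<Sum>i\<in>{0..<?n}. v $ i * (if i = 0 then 1 else 0)) = v $ 0" by (simp add: sum.remove[of _ 0])
    then show ?thesis unfolding u_def using v unit
      by (simp add: minus_scalar_prod_distrib[of _ ?n] scalar_prod_minus_distrib[of _ ?n])
  qed
  have u0: "u $ 0 = v $ 0 - 1" using v by (simp add: u_def)
  have cuu: "c * c * (u \<bullet> u) = 2 * c" by (simp add: c_def)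
  define H where "H = Matrix.mat ?n ?n (\<lambda>(i,j). (if i = j then 1 else 0) - c * u $ i * u $ j)"
  have H: "H \<in> carrier_mat ?n ?n" by (simp add: H_def)
  have "H\<^sup>T = H" by (rule eq_matI) (auto simp: H_def)
  moreover have "H * H = 1\<^sub>m ?n"
  proof (rule eq_matI)
    fix i j assume "i < dim_row (1\<^sub>m ?n :: rmat)" "j < dim_col (1\<^sub>m ?n :: rmat)"
    then have i: "i < ?n" and j: "j < ?n" by auto
    have "(H * H) $$ (i,j) = (\<Sum>k\<in>{0..<?n}. ((if i = k then 1 else 0) - c * u $ i * u $ k)
            * ((if k = j then 1 else 0) - c * u $ k * u $ j))"
      using i j by (simp add: H_def scalar_prod_def)
    also have "\<dots> = (\<Sum>k\<in>{0..<?n}. (if i = k then (if k = j then 1 else 0) else 0)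
        - (if i = k then c * u $ k * u $ j else 0) - (if k = j then c * u $ i * u $ k else 0)
        + c * c * u $ i * u $ j * (u $ k * u $ k))"
      by (rule sum.cong) (auto simp: algebra_simps)
    also have "\<dots> = (if i = j then 1 else 0) - 2 * (c * u $ i * u $ j)
        + u $ i * u $ j * (c * c * (u \<bullet> u))"
      using i j u by (simp add: sum.distrib sum_subtractf sum.delta sum.delta' scalar_prod_def
          flip: sum_distrib_left del: sum.op_ivl_Suc)
    also have "\<dots> = (1\<^sub>m ?n) $$ (i,j)" using i j unfolding cuu by simp
    finally show "(H * H) $$ (i,j) = (1\<^sub>m ?n) $$ (i,j)" .
  qed (auto simp: H_def)
  moreover have "H *\<^sub>v unit_vec ?n 0 = v"
  proof (rule eq_vecI)
    fix i assume "i < dim_vec v" then have i: "i < ?n" using v by simp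
    have "(H *\<^sub>v unit_vec ?n 0) $ i = H $$ (i,0)" using i H by simp
    also have "\<dots> = (if i = 0 then 1 else 0) - c * u $ 0 * u $ i" using i by (simp add: H_def)
    also have "\<dots> = v $ i"
    proof (cases "u \<bullet> u = 0")
      case True
      then have "u = 0\<^sub>v ?n" using scalar_prod_self_pos_iff[OF u] by auto
      then have "u $ i = 0" using i by simp
      then show ?thesis using i v by (auto simp: u_def split: if_splits)
    next
      case False
      then have "c * u $ 0 = -1" unfolding c_def u0 using uu by (simp add: field_simps)
      then show ?thesis using i v by (auto simp: u_def)
    qed
    finally show "(H *\<^sub>v unit_vec ?n 0) $ i = v $ i" .
  qed (use v H in auto)
  ultimately show ?thesis using H by blast
qed

lemma quadratic_form_double_sum:
  fixes A :: rmat
  assumes "A \<in> carrier_mat n n" "v \<in> carrier_vec n"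
  shows "v \<bullet> (A *\<^sub>v v) = (\<Sum>i<n. \<Sum>j<n. v $ i * A $$ (i,j) * v $ j)"
  using assms by (simp add: scalar_prod_def sum_distrib_left atLeast0LessThan mult.assoc)

lemma pos_def_mat_congruence:
  assumes A: "A \<in> carrier_mat n n" "pos_def_mat A"
    and H: "H \<in> carrier_mat n n" "H\<^sup>T = H" and inv: "H * H = 1\<^sub>m n"
  shows "pos_def_mat (H * A * H)"
proof -
  have "(H * A * H)\<^sup>T = H * A * H"
    using A H by (simp add: pos_def_mat_def transpose_mult[of _ n n _ n])
  moreover have "0 < v \<bullet> ((H * A * H) *\<^sub>v v)" if v: "v \<in> carrier_vec n" "v \<noteq> 0\<^sub>v n" for v
  proof -
    have Hv: "H *\<^sub>v v \<in> carrier_vec n" using H v by simp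
    have "H *\<^sub>v (H *\<^sub>v v) = v" using H v inv by (simp flip: assoc_mult_mat_vec)
    then have "H *\<^sub>v v \<noteq> 0\<^sub>v n" using v H by fastforce
    then have "0 < (H *\<^sub>v v) \<bullet> (A *\<^sub>v (H *\<^sub>v v))" using A Hv by (simp add: pos_def_mat_def)
    also have "\<dots> = v \<bullet> (H *\<^sub>v (A *\<^sub>v (H *\<^sub>v v)))"
      using A Hv by (intro symmetric_form_commute[OF H v(1)]) auto
    also have "H *\<^sub>v (A *\<^sub>v (H *\<^sub>v v)) = (H * A * H) *\<^sub>v v"
      using A H v by (simp add: assoc_mult_mat_vec[of _ n n _ n])
    finally show ?thesis .
  qed
  ultimately show ?thesis using A H by (auto simp: pos_def_mat_def)
qed

text \<open>Induction on the dimension. A Householder reflection moves an eigenvector to the first coordinate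
  axis and makes the matrix block diagonal with blocks \<open>e\<close> and \<open>A3\<close>; the root is assembled from \<open>sqrt e\<close>
  and the root of \<open>A3\<close> and then reflected back.\<close>

theorem pos_def_sqrt_exists:
  assumes "A \<in> carrier_mat n n" "pos_def_mat A"
  shows "\<exists>R. R \<in> carrier_mat n n \<and> pos_def_mat R \<and> R * R = A"
  using assms
proof (induction n arbitrary: A)
  case 0
  then show ?case by (intro exI[of _ A]) (auto intro!: eq_matI)
next
  case (Suc m)
  let ?n = "Suc m"
  note A = Suc.prems(1) and pd = Suc.prems(2)
  have sym: "A\<^sup>T = A" using pd by (simp add: pos_def_mat_def)
  obtain e w where w: "w \<in> carrier_vec ?n" "w \<noteq> 0\<^sub>v ?n" "A *\<^sub>v w = e \<cdot>\<^sub>v w"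
    using symmetric_eigenvector_exists[OF A sym] by auto
  define v where "v = (1 / sqrt (w \<bullet> w)) \<cdot>\<^sub>v w"
  have v: "v \<in> carrier_vec ?n" using w by (simp add: v_def)
  have ww: "0 < w \<bullet> w" using scalar_prod_self_pos_iff[OF w(1)] w by simp
  have vv: "v \<bullet> v = 1" unfolding v_def using w ww by (simp flip: power2_eq_square)
  have Av: "A *\<^sub>v v = e \<cdot>\<^sub>v v"
    unfolding v_def using A w by (simp add: mult_mat_vec[OF A] smult_smult_assoc mult.commute)
  obtain H where H: "H \<in> carrier_mat ?n ?n" "H\<^sup>T = H" "H * H = 1\<^sub>m ?n"
    "H *\<^sub>v unit_vec ?n 0 = v" using householder_exists[OF v vv] by blast
  define A' where "A' = H * A * H"
  have A': "A' \<in> carrier_mat ?n ?n" using A H by (simp add: A'_def)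
  have pd': "pos_def_mat A'" unfolding A'_def by (rule pos_def_mat_congruence[OF A pd H(1-3)])
  have "A' *\<^sub>v unit_vec ?n 0 = H *\<^sub>v (A *\<^sub>v v)"
    unfolding A'_def using A H by (simp add: assoc_mult_mat_vec[of _ ?n ?n _ ?n])
  also have "\<dots> = e \<cdot>\<^sub>v (H *\<^sub>v (H *\<^sub>v unit_vec ?n 0))"
    unfolding Av using H v by (simp add: mult_mat_vec[of _ ?n ?n])
  also have "\<dots> = e \<cdot>\<^sub>v unit_vec ?n 0"
    using H(1,3) by (simp flip: assoc_mult_mat_vec[of _ ?n ?n _ ?n])
  finally have col0: "A' *\<^sub>v unit_vec ?n 0 = e \<cdot>\<^sub>v unit_vec ?n 0" .
  have c0: "A' $$ (i, 0) = (if i = 0 then e else 0)" if "i < ?n" for i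
    using arg_cong[OF col0, of "\<lambda>x. x $ i"] that A' by (simp split: if_splits)
  have symA': "A' $$ (i, j) = A' $$ (j, i)" if "i < ?n" "j < ?n" for i j
    using that A' pd' unfolding pos_def_mat_def by (metis carrier_matD index_transpose_mat(1))
  have r0: "A' $$ (0, j) = (if j = 0 then e else 0)" if "j < ?n" for j
    using c0[OF that] symA'[of 0 j] that by simp
  have quadA': "x \<bullet> (A' *\<^sub>v x) = e * (x $ 0)\<^sup>2 + (\<Sum>i<m. \<Sum>j<m. x $ Suc i * A' $$ (Suc i, Suc j) * x $ Suc j)"
    if "x \<in> carrier_vec ?n" for x
    unfolding quadratic_form_double_sum[OF A' that]
    by (simp add: sum.lessThan_Suc_shift c0 r0 power2_eq_square mult.commute del: sum.lessThan_Suc)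
  have e: "0 < e"
  proof -
    have "(unit_vec ?n 0 :: rvec) \<noteq> 0\<^sub>v ?n"
      by (metis index_unit_vec(1) index_zero_vec(1) zero_less_Suc zero_neq_one)
    then have "0 < unit_vec ?n 0 \<bullet> (A' *\<^sub>v unit_vec ?n 0)"
      using pd' A' unfolding pos_def_mat_def by (metis carrier_matD(1) unit_vec_carrier)
    also have "\<dots> = e" by (subst quadA') auto
    finally show ?thesis .
  qed
  define A3 where "A3 = Matrix.mat m m (\<lambda>(i,j). A' $$ (Suc i, Suc j))"
  have A3: "A3 \<in> carrier_mat m m" by (simp add: A3_def)
  have "pos_def_mat A3"
    unfolding pos_def_mat_def
  proof (intro conjI ballI impI)
    show "square_mat A3" by (simp add: A3_def)
    show "A3\<^sup>T = A3" by (rule eq_matI) (auto simp: A3_def symA')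
    fix x :: rvec assume "x \<in> carrier_vec (dim_row A3)" "x \<noteq> 0\<^sub>v (dim_row A3)"
    then have x: "x \<in> carrier_vec m" "x \<noteq> 0\<^sub>v m" by (auto simp: A3_def)
    define x' where "x' = Matrix.vec ?n (\<lambda>i. if i = 0 then 0 else x $ (i - 1))"
    have x': "x' \<in> carrier_vec ?n" by (simp add: x'_def)
    obtain i where "i < m" "x $ i \<noteq> 0" using x by (metis eq_vecI index_zero_vec carrier_vecD)
    then have "x' $ Suc i \<noteq> 0" "Suc i < ?n" by (auto simp: x'_def)
    then have "x' \<noteq> 0\<^sub>v ?n" by auto
    then have "0 < x' \<bullet> (A' *\<^sub>v x')" using pd' A' x' by (auto simp: pos_def_mat_def)
    also have "\<dots> = x \<bullet> (A3 *\<^sub>v x)"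
      unfolding quadA'[OF x'] quadratic_form_double_sum[OF A3 x(1)]
      by (simp add: x'_def A3_def)
    finally show "0 < x \<bullet> (A3 *\<^sub>v x)" .
  qed
  then obtain R3 where R3: "R3 \<in> carrier_mat m m" "pos_def_mat R3" "R3 * R3 = A3"
    using Suc.IH[OF A3] by blast
  have symR3: "R3 $$ (i, j) = R3 $$ (j, i)" if "i < m" "j < m" for i j
    using that R3 unfolding pos_def_mat_def by (metis carrier_matD index_transpose_mat(1))
  define R' where "R' = Matrix.mat ?n ?n (\<lambda>(i,j). if i = 0 then (if j = 0 then sqrt e else 0)
     else if j = 0 then 0 else R3 $$ (i - 1, j - 1))"
  have R': "R' \<in> carrier_mat ?n ?n" by (simp add: R'_def)
  have "R' * R' = A'"
  proof (rule eq_matI)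
    fix i j assume "i < dim_row A'" "j < dim_col A'"
    then have i: "i < ?n" and j: "j < ?n" using A' by auto
    have "(R' * R') $$ (i,j) = (\<Sum>k<?n. R' $$ (i,k) * R' $$ (k,j))"
      using i j R' by (simp add: scalar_prod_def atLeast0LessThan del: sum.lessThan_Suc)
    also have "\<dots> = R' $$ (i,0) * R' $$ (0,j) + (\<Sum>k<m. R' $$ (i,Suc k) * R' $$ (Suc k,j))"
      by (simp add: sum.lessThan_Suc_shift del: sum.lessThan_Suc)
    also have "\<dots> = A' $$ (i,j)"
    proof (cases "i = 0 \<or> j = 0")
      case True
      then show ?thesis using i j e c0 r0 by (auto simp: R'_def)
    next
      case False
      then obtain i' j' where ij: "i = Suc i'" "j = Suc j'" by (metis not0_implies_Suc)
      then have lt: "i' < m" "j' < m" using i j by auto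
      have "(\<Sum>k<m. R3 $$ (i',k) * R3 $$ (k,j')) = (R3 * R3) $$ (i',j')"
        using lt R3(1) by (simp add: scalar_prod_def atLeast0LessThan)
      also have "\<dots> = A' $$ (i,j)" unfolding R3(3) using lt ij by (simp add: A3_def)
      finally show ?thesis using lt ij by (simp add: R'_def)
    qed
    finally show "(R' * R') $$ (i,j) = A' $$ (i,j)" .
  qed (use R' A' in auto)
  moreover have "pos_def_mat R'"
    unfolding pos_def_mat_def
  proof (intro conjI ballI impI)
    show "square_mat R'" by (simp add: R'_def)
    show "R'\<^sup>T = R'" by (rule eq_matI) (auto simp: R'_def intro!: symR3)
    fix x :: rvec assume "x \<in> carrier_vec (dim_row R')" "x \<noteq> 0\<^sub>v (dim_row R')"
    then have x: "x \<in> carrier_vec ?n" "x \<noteq> 0\<^sub>v ?n" by (auto simp: R'_def)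
    define y where "y = Matrix.vec m (\<lambda>i. x $ Suc i)"
    have y: "y \<in> carrier_vec m" by (simp add: y_def)
    have eq: "x \<bullet> (R' *\<^sub>v x) = sqrt e * (x $ 0)\<^sup>2 + y \<bullet> (R3 *\<^sub>v y)"
      unfolding quadratic_form_double_sum[OF R' x(1)] quadratic_form_double_sum[OF R3(1) y]
      by (simp add: sum.lessThan_Suc_shift R'_def y_def power2_eq_square mult.commute del: sum.lessThan_Suc)
    have nonneg: "0 \<le> y \<bullet> (R3 *\<^sub>v y)"
      using R3(1,2) y by (cases "y = 0\<^sub>v m") (auto simp: pos_def_mat_def intro!: less_imp_le)
    show "0 < x \<bullet> (R' *\<^sub>v x)"
    proof (cases "x $ 0 = 0")
      case False
      then have "0 < sqrt e * (x $ 0)\<^sup>2" using e by simp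
      then show ?thesis using eq nonneg by linarith
    next
      case True
      obtain i where i: "i < ?n" "x $ i \<noteq> 0" using x by (metis eq_vecI index_zero_vec carrier_vecD)
      then obtain i' where "i = Suc i'" using True by (cases i) auto
      then have "y $ i' \<noteq> 0" "i' < m" using i by (auto simp: y_def)
      then have "y \<noteq> 0\<^sub>v m" by auto
      then have "0 < y \<bullet> (R3 *\<^sub>v y)" using R3(1,2) y by (auto simp: pos_def_mat_def)
      then show ?thesis using eq True by simp
    qed
  qed
  ultimately have R'': "R' * R' = A'" "pos_def_mat R'" by auto
  define R where "R = H * R' * H"
  have R: "R \<in> carrier_mat ?n ?n" using R' H by (simp add: R_def)
  have pdR: "pos_def_mat R" unfolding R_def by (rule pos_def_mat_congruence[OF R' R''(2) H(1-3)])
  have "R * R = H * R' * (H * H) * R' * H"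
    unfolding R_def using R' H(1) by (simp add: assoc_mult_mat[of _ ?n ?n _ ?n _ ?n])
  also have "\<dots> = H * (R' * R') * H"
    unfolding H(3) using R' H(1) by (simp add: assoc_mult_mat[of _ ?n ?n _ ?n _ ?n])
  also have "\<dots> = (H * H) * A * (H * H)"
    unfolding R''(1) A'_def using A H(1) by (simp add: assoc_mult_mat[of _ ?n ?n _ ?n _ ?n])
  also have "\<dots> = A" unfolding H(3) using A by simp
  finally show ?case using R pdR by blast
qed

text \<open>For \<open>D = R - S\<close> the equation \<open>R R = S S\<close> reads \<open>R D = - D S\<close>. Multiplying by \<open>D\<close> and taking
  traces gives \<open>tr (D R D) = - tr (D S D)\<close>. Both traces are sums of nonnegative quadratic forms in the columns
  of \<open>D\<close>, so they vanish, and definiteness of \<open>R\<close> kills every column.\<close>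

theorem pos_def_sqrt_unique:
  assumes R: "R \<in> carrier_mat n n" "pos_def_mat R" and S: "S \<in> carrier_mat n n" "pos_def_mat S"
    and eq: "R * R = S * S"
  shows "R = S"
proof -
  define D where "D = R - S"
  have D: "D \<in> carrier_mat n n" unfolding D_def using R(1) S(1) by (metis minus_carrier_mat)
  have symR: "R\<^sup>T = R" "S\<^sup>T = S" using R S by (auto simp: pos_def_mat_def)
  have sym: "D $$ (i,j) = D $$ (j,i)" if "i < n" "j < n" for i j
    using that R(1) S(1) symR unfolding D_def 
    by (metis carrier_matD index_minus_mat(1) index_transpose_mat(1))
  have RD: "(\<Sum>k<n. R $$ (i,k) * D $$ (k,j)) = - (\<Sum>k<n. D $$ (i,k) * S $$ (k,j))"
    if "i < n" "j < n" for i j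
  proof -
    have "(\<Sum>k<n. R $$ (i,k) * R $$ (k,j)) = (\<Sum>k<n. S $$ (i,k) * S $$ (k,j))"
      using arg_cong[OF eq, of "\<lambda>M. M $$ (i,j)"] R(1) S(1) that
      by (simp add: scalar_prod_def atLeast0LessThan)
    then show ?thesis using that R(1) S(1)
      by (simp add: D_def algebra_simps sum_subtractf flip: sum_negf)
  qed
  have colD: "col D i \<in> carrier_vec n" for i using D by (metis carrier_vecI col_dim carrier_matD(1))
  have form: "(\<Sum>i<n. col D i \<bullet> (A *\<^sub>v col D i)) = (\<Sum>i<n. \<Sum>j<n. \<Sum>k<n. D $$ (j,i) * A $$ (j,k) * D $$ (k,i))"
    if "A \<in> carrier_mat n n" for A
    using D by (intro sum.cong refl) (simp add: quadratic_form_double_sum[OF that colD])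
  have "(\<Sum>i<n. col D i \<bullet> (R *\<^sub>v col D i)) = (\<Sum>i<n. \<Sum>j<n. D $$ (j,i) * (\<Sum>k<n. R $$ (j,k) * D $$ (k,i)))"
    unfolding form[OF R(1)] by (simp add: sum_distrib_left mult.assoc)
  also have "\<dots> = - (\<Sum>i<n. \<Sum>j<n. \<Sum>k<n. D $$ (j,i) * D $$ (j,k) * S $$ (k,i))"
    by (simp add: RD sum_distrib_left mult.assoc sum_negf)
  also have "(\<Sum>i<n. \<Sum>j<n. \<Sum>k<n. D $$ (j,i) * D $$ (j,k) * S $$ (k,i))
      = (\<Sum>j<n. \<Sum>i<n. \<Sum>k<n. D $$ (i,j) * S $$ (i,k) * D $$ (k,j))"
  proof -
    have "(\<Sum>i<n. \<Sum>j<n. \<Sum>k<n. D $$ (j,i) * D $$ (j,k) * S $$ (k,i))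
        = (\<Sum>j<n. \<Sum>i<n. \<Sum>k<n. D $$ (j,i) * D $$ (j,k) * S $$ (k,i))" by (rule sum.swap)
    also have "\<dots> = (\<Sum>j<n. \<Sum>k<n. \<Sum>i<n. D $$ (j,i) * D $$ (j,k) * S $$ (k,i))"
      by (intro sum.cong refl sum.swap)
    also have "\<dots> = (\<Sum>j<n. \<Sum>i<n. \<Sum>k<n. D $$ (i,j) * S $$ (i,k) * D $$ (k,j))"
      by (intro sum.cong refl) (simp add: sym mult_ac)
    finally show ?thesis .
  qed
  also have "\<dots> = (\<Sum>i<n. col D i \<bullet> (S *\<^sub>v col D i))" unfolding form[OF S(1)] ..
  finally have sum0: "(\<Sum>i<n. col D i \<bullet> (R *\<^sub>v col D i)) = - (\<Sum>i<n. col D i \<bullet> (S *\<^sub>v col D i))" .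
  have nn: "0 \<le> v \<bullet> (A *\<^sub>v v)" if "A \<in> carrier_mat n n" "pos_def_mat A" "v \<in> carrier_vec n" for A v
    using that by (cases "v = 0\<^sub>v n") (auto simp: pos_def_mat_def intro!: less_imp_le)
  have "0 \<le> (\<Sum>i<n. col D i \<bullet> (R *\<^sub>v col D i))" "0 \<le> (\<Sum>i<n. col D i \<bullet> (S *\<^sub>v col D i))"
    by (auto intro!: sum_nonneg nn R S colD)
  then have "(\<Sum>i<n. col D i \<bullet> (R *\<^sub>v col D i)) = 0" using sum0 by linarith
  then have z: "col D i \<bullet> (R *\<^sub>v col D i) = 0" if "i < n" for i
    using that by (subst (asm) sum_nonneg_eq_0_iff) (auto intro!: nn R colD)
  have "col D i = 0\<^sub>v n" if "i < n" for i
    using z[OF that] R colD[of i] unfolding pos_def_mat_def by (metis carrier_matD(1) less_irrefl)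
  then have "D $$ (i,j) = 0" if "i < n" "j < n" for i j
    using that D by (metis carrier_matD index_col index_zero_vec(1))
  then show ?thesis
    using R(1) S(1) by (intro eq_matI) (auto simp: D_def)
qed

lemma pos_def_mat_inv:
  assumes A: "A \<in> carrier_mat n n" "pos_def_mat A"
  shows "mat_inv A \<in> carrier_mat n n" "A * mat_inv A = 1\<^sub>m n" "mat_inv A * A = 1\<^sub>m n"
    "pos_def_mat (mat_inv A)"
proof -
  have "v = 0\<^sub>v n" if "v \<in> carrier_vec n" "A *\<^sub>v v = 0\<^sub>v n" for v
    using that A unfolding pos_def_mat_def
    by (metis carrier_matD(1) less_irrefl scalar_prod_right_zero)
  then have "Determinant.det A \<noteq> 0" using det_0_iff_vec_prod_zero_field[OF A(1)] by auto
  then have "A \<in> Units (ring_mat TYPE(real) n ())" 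
    by (rule det_non_zero_imp_unit[OF A(1)])
  then obtain B where "mat_inverse A = Some B" using mat_inverse(1)[OF A(1)] by fastforce
  then have B: "mat_inv A \<in> carrier_mat n n" "A * mat_inv A = 1\<^sub>m n" "mat_inv A * A = 1\<^sub>m n"
    using mat_inverse(2)[OF A(1)] by (auto simp: mat_inv_def)
  show "mat_inv A \<in> carrier_mat n n" "A * mat_inv A = 1\<^sub>m n" "mat_inv A * A = 1\<^sub>m n" using B by auto
  have sA: "A\<^sup>T = A" using A by (simp add: pos_def_mat_def)
  \<comment> \<open>The transpose is a left inverse of \<open>A\<close> as well.\<close>
  have "(mat_inv A)\<^sup>T = (mat_inv A)\<^sup>T * (A * mat_inv A)" using B by simp
  also have "\<dots> = ((mat_inv A)\<^sup>T * A\<^sup>T) * mat_inv A" unfolding sA using A B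
    by (simp add: assoc_mult_mat[of _ n n _ n _ n])
  also have "(mat_inv A)\<^sup>T * A\<^sup>T = 1\<^sub>m n"
    using transpose_mult[OF A(1) B(1)] B(2) by simp
  finally have sB: "(mat_inv A)\<^sup>T = mat_inv A" using B by simp
  have "0 < v \<bullet> (mat_inv A *\<^sub>v v)" if v: "v \<in> carrier_vec n" "v \<noteq> 0\<^sub>v n" for v
  proof -
    define u where "u = mat_inv A *\<^sub>v v"
    have u: "u \<in> carrier_vec n" using B v by (simp add: u_def)
    have Au: "A *\<^sub>v u = v" unfolding u_def using A B v by (simp flip: assoc_mult_mat_vec)
    then have "u \<noteq> 0\<^sub>v n" using v A by fastforce
    then have "0 < u \<bullet> (A *\<^sub>v u)" using A u by (auto simp: pos_def_mat_def)
    also have "\<dots> = v \<bullet> u" unfolding Au using u v(1) by (intro comm_scalar_prod)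
    finally show ?thesis unfolding u_def .
  qed
  then show "pos_def_mat (mat_inv A)" using B sB by (auto simp: pos_def_mat_def)
qed

lemma mat_inv_sqrt:
  assumes A: "A \<in> carrier_mat n n" "pos_def_mat A"
  shows "mat_inv_sqrt A \<in> carrier_mat n n" "(mat_inv_sqrt A)\<^sup>T = mat_inv_sqrt A"
    "mat_inv_sqrt A * A * mat_inv_sqrt A = 1\<^sub>m n"
proof -
  note inv = pos_def_mat_inv[OF A]
  have dim: "R \<in> carrier_mat n n" if "pos_def_mat R" "R * R = mat_inv A" for R
    using that inv(1) unfolding pos_def_mat_def by (metis carrier_matD carrier_matI index_mult_mat(2) square_mat.simps)
  obtain R where R: "R \<in> carrier_mat n n" "pos_def_mat R" "R * R = mat_inv A"
    using pos_def_sqrt_exists[OF inv(1,4)] by blast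
  have "mat_inv_sqrt A = R"
    unfolding mat_inv_sqrt_def
    by (rule the_equality) (use R dim in \<open>auto intro: pos_def_sqrt_unique[of _ n]\<close>)
  note W = R[folded this]
  show W1: "mat_inv_sqrt A \<in> carrier_mat n n" "(mat_inv_sqrt A)\<^sup>T = mat_inv_sqrt A"
    using W by (auto simp: pos_def_mat_def)
  have "mat_inv_sqrt A * (mat_inv_sqrt A * A) = 1\<^sub>m n"
    using W1 A inv(3) W(3) by (metis assoc_mult_mat)
  then have "(mat_inv_sqrt A * A) * mat_inv_sqrt A = 1\<^sub>m n"
    using mat_mult_left_right_inverse[of "mat_inv_sqrt A" n "mat_inv_sqrt A * A"] W1 A by auto
  then show "mat_inv_sqrt A * A * mat_inv_sqrt A = 1\<^sub>m n" .
qed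

section \<open>A net of the Euclidean ball\<close>

text \<open>Together with the next lemma this bounds the theta series \<open>\<Sum> exp (- a\<^sup>2)\<close> over the integers,
  the only numerical input to the size of the net below.\<close>

lemma sum_half_power_int: "(\<Sum>a\<in>{- int m..int m}. (1/2::real) ^ nat \<bar>a\<bar>) \<le> 3"
proof -
  have "(\<Sum>a\<in>{- int m..int m}. (1/2::real) ^ nat \<bar>a\<bar>) = 3 - 2 * (1/2) ^ m"
  proof (induction m)
    case (Suc m)
    have "{- int (Suc m)..int (Suc m)} = insert (- int (Suc m)) (insert (int (Suc m)) {- int m..int m})"
      by auto
    then have "(\<Sum>a\<in>{- int (Suc m)..int (Suc m)}. (1/2::real) ^ nat \<bar>a\<bar>)
       = 2 * (1/2) ^ Suc m + (\<Sum>a\<in>{- int m..int m}. (1/2::real) ^ nat \<bar>a\<bar>)"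
      by (simp add: nat_add_distrib)
    then show ?case using Suc by simp
  qed simp
  then show ?thesis by simp
qed

lemma exp_neg_square_le_half_power: "exp (- (real_of_int a)\<^sup>2) \<le> (1/2) ^ nat \<bar>a\<bar>"
proof -
  have "exp (- (real_of_int a)\<^sup>2) \<le> exp (- real (nat \<bar>a\<bar>))"
  proof -
    have "\<bar>a\<bar> \<le> a\<^sup>2"
    proof (cases "a = 0")
      case False
      then have "\<bar>a\<bar> * 1 \<le> \<bar>a\<bar> * \<bar>a\<bar>" by (intro mult_left_mono) auto
      then show ?thesis by (simp add: power2_eq_square)
    qed simp
    then have "real_of_int \<bar>a\<bar> \<le> (real_of_int a)\<^sup>2" by (metis of_int_le_iff of_int_power)
    then show ?thesis by simp
  qed
  also have "\<dots> = exp (-1) ^ nat \<bar>a\<bar>" by (simp flip: exp_of_nat_mult)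
  also have "\<dots> \<le> (1/2) ^ nat \<bar>a\<bar>"
  proof (rule power_mono)
    have "(2::real) \<le> exp 1" using exp_ge_add_one_self[of "1::real"] by simp
    then show "exp (-1::real) \<le> 1/2" by (simp add: exp_minus field_simps)
  qed simp
  finally show ?thesis .
qed

text \<open>The net is the set of points of the lattice with spacing \<open>1 / (4 sqrt p)\<close> in the unit ball. Rounding
  every coordinate towards zero stays in the ball and moves a point by at most \<open>sqrt (p / (16 p)) = 1/4\<close>. To
  count the integer points with \<open>\<Sum> a\<^sub>j\<^sup>2 \<le> 16 p\<close>, each of them is weighted by
  \<open>exp (16 p - \<Sum> a\<^sub>j\<^sup>2) \<ge> 1\<close>; the total weight factorises over the coordinates.\<close>

theorem unit_ball_net_exists:
  "\<exists>N :: (nat \<Rightarrow> real) set. finite N \<and> real (card N) \<le> exp (18 * real p) \<and>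
     (\<forall>u\<in>N. (\<Sum>j<p. (u j)\<^sup>2) \<le> 1) \<and>
     (\<forall>v. (\<Sum>j<p. (v j)\<^sup>2) \<le> 1 \<longrightarrow> (\<exists>u\<in>N. (\<Sum>j<p. (v j - u j)\<^sup>2) \<le> 1/16))"
proof -
  define s where "s = 4 * sqrt (real p)"
  have s0: "0 \<le> s" and s2: "s\<^sup>2 = 16 * real p" by (auto simp: s_def power_mult_distrib)
  define F where "F = (\<Pi>\<^sub>E j\<in>{..<p}. {- int (4 * p)..int (4 * p)})"
  define G where "G = {a \<in> F. (\<Sum>j<p. (real_of_int (a j))\<^sup>2) \<le> 16 * real p}"
  have finF: "finite F" unfolding F_def by (intro finite_PiE) auto
  then have finG: "finite G" by (simp add: G_def)
  define N where "N = (\<lambda>a j. real_of_int (a j) / s) ` G"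
  have "real (card G) = (\<Sum>a\<in>G. 1)" by simp
  also have "\<dots> \<le> (\<Sum>a\<in>G. exp (16 * real p - (\<Sum>j<p. (real_of_int (a j))\<^sup>2)))"
    by (intro sum_mono) (auto simp: G_def)
  also have "\<dots> \<le> (\<Sum>a\<in>F. exp (16 * real p - (\<Sum>j<p. (real_of_int (a j))\<^sup>2)))"
    using finF by (intro sum_mono2) (auto simp: G_def)
  also have "\<dots> = exp (16 * real p) * (\<Sum>a\<in>F. \<Prod>j<p. exp (- (real_of_int (a j))\<^sup>2))"
    unfolding diff_conv_add_uminus exp_add sum_negf[symmetric] exp_sum[OF finite_lessThan] sum_distrib_left ..
  also have "(\<Sum>a\<in>F. \<Prod>j<p. exp (- (real_of_int (a j))\<^sup>2))
     = (\<Prod>j<p. \<Sum>b\<in>{- int (4 * p)..int (4 * p)}. exp (- (real_of_int b)\<^sup>2))"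
    unfolding F_def by (subst prod_sum_PiE) auto
  also have "\<dots> \<le> (\<Prod>j<p. exp 2)"
  proof (intro prod_mono conjI sum_nonneg)
    have "(\<Sum>b\<in>{- int (4 * p)..int (4 * p)}. exp (- (real_of_int b)\<^sup>2))
       \<le> (\<Sum>b\<in>{- int (4 * p)..int (4 * p)}. (1/2) ^ nat \<bar>b\<bar>)"
      by (intro sum_mono exp_neg_square_le_half_power)
    also have "\<dots> \<le> 3" by (rule sum_half_power_int)
    also have "\<dots> \<le> exp (2::real)" using exp_ge_add_one_self[of "2::real"] by simp
    finally show "(\<Sum>b\<in>{- int (4 * p)..int (4 * p)}. exp (- (real_of_int b)\<^sup>2)) \<le> exp 2" .
  qed auto
  also have "exp (16 * real p) * (\<Prod>j<p. exp 2) = exp (18 * real p)"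
    by (simp flip: exp_of_nat_mult exp_add)
  finally have "real (card G) \<le> exp (18 * real p)" by simp
  then have "real (card N) \<le> exp (18 * real p)"
    unfolding N_def using card_image_le[OF finG] by (meson le_trans of_nat_mono order_trans)
  moreover have "(\<Sum>j<p. (u j)\<^sup>2) \<le> 1" if u: "u \<in> N" for u
  proof -
    obtain a where a: "a \<in> G" "u = (\<lambda>j. real_of_int (a j) / s)" using u unfolding N_def by (elim imageE) blast
    have "(\<Sum>j<p. (u j)\<^sup>2) = (\<Sum>j<p. (real_of_int (a j))\<^sup>2) / s\<^sup>2"
      by (simp add: a power_divide sum_divide_distrib)
    also have "\<dots> \<le> 1" using a(1) unfolding s2 G_def
      by (cases "p = 0") (auto simp: field_simps)
    finally show ?thesis .
  qed
  moreover have "\<exists>u\<in>N. (\<Sum>j<p. (v j - u j)\<^sup>2) \<le> 1/16" if v: "(\<Sum>j<p. (v j)\<^sup>2) \<le> 1" for v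
  proof (cases "p = 0")
    case True
    then have "restrict (\<lambda>_. 0) {..<p} \<in> G" by (simp add: G_def F_def)
    then show ?thesis using True by (auto simp: N_def)
  next
    case False
    then have s: "0 < s" by (simp add: s_def)
    define r where "r x = (if 0 \<le> x then \<lfloor>x\<rfloor> else \<lceil>x\<rceil>)" for x :: real
    have r1: "\<bar>real_of_int (r x)\<bar> \<le> \<bar>x\<bar>" for x
    proof (cases "0 \<le> x")
      case False
      then have "\<lceil>x\<rceil> \<le> 0" by (simp add: ceiling_le_iff)
      then show ?thesis using False le_of_int_ceiling[of x] by (simp add: r_def)
    qed (simp add: r_def)
    have r2: "\<bar>x - real_of_int (r x)\<bar> \<le> 1" for x
    proof (cases "0 \<le> x")
      case True
      then have "real_of_int (r x) = real_of_int \<lfloor>x\<rfloor>" by (simp add: r_def)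
      then show ?thesis by linarith
    next
      case False
      then have "real_of_int (r x) = real_of_int \<lceil>x\<rceil>" by (simp add: r_def)
      then show ?thesis by linarith
    qed
    define a where "a = restrict (\<lambda>j. r (s * v j)) {..<p}"
    have sq: "(real_of_int (a j))\<^sup>2 \<le> s\<^sup>2 * (v j)\<^sup>2" if "j < p" for j
    proof -
      have "\<bar>real_of_int (a j)\<bar> \<le> \<bar>s * v j\<bar>" using r1 that by (simp add: a_def)
      then have "(real_of_int (a j))\<^sup>2 \<le> (s * v j)\<^sup>2" by (simp add: abs_le_square_iff)
      then show ?thesis by (simp add: power_mult_distrib)
    qed
    have "(\<Sum>j<p. (real_of_int (a j))\<^sup>2) \<le> (\<Sum>j<p. s\<^sup>2 * (v j)\<^sup>2)" by (intro sum_mono sq) auto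
    also have "\<dots> \<le> s\<^sup>2" using v by (simp flip: sum_distrib_left) (metis mult_left_le zero_le_power2)
    finally have sum: "(\<Sum>j<p. (real_of_int (a j))\<^sup>2) \<le> 16 * real p" by (simp add: s2)
    have "\<bar>a j\<bar> \<le> int (4 * p)" if "j < p" for j
    proof -
      have "(real_of_int (a j))\<^sup>2 \<le> (\<Sum>j<p. (real_of_int (a j))\<^sup>2)"
        using that by (intro member_le_sum) auto
      also have "\<dots> \<le> 16 * real p" by (rule sum)
      also have "\<dots> \<le> (real (4 * p))\<^sup>2"
        using False by (simp add: power2_eq_square)
      finally have "\<bar>real_of_int (a j)\<bar> \<le> real (4 * p)" by (metis abs_le_square_iff abs_of_nat)
      then show ?thesis by linarith
    qed
    then have "a j \<in> {- int (4 * p)..int (4 * p)}" if "j < p" for j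
      using that abs_le_iff[of "a j" "int (4 * p)"] by (simp add: minus_le_iff)
    moreover have "a \<in> extensional {..<p}" by (simp add: a_def)
    ultimately have "a \<in> F" unfolding F_def PiE_iff by simp
    then have "a \<in> G" using sum by (simp add: G_def)
    then have u: "(\<lambda>j. real_of_int (a j) / s) \<in> N" by (auto simp: N_def)
    have "(\<Sum>j<p. (v j - real_of_int (a j) / s)\<^sup>2) \<le> (\<Sum>j<p. 1 / s\<^sup>2)"
    proof (intro sum_mono)
      fix j assume "j \<in> {..<p}"
      then have "\<bar>s * v j - real_of_int (a j)\<bar> \<le> 1" using r2 by (simp add: a_def)
      then have "(s * v j - real_of_int (a j))\<^sup>2 \<le> 1" by (simp add: abs_square_le_1)
      moreover have "v j - real_of_int (a j) / s = (s * v j - real_of_int (a j)) / s"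
        using s by (simp add: field_simps)
      ultimately show "(v j - real_of_int (a j) / s)\<^sup>2 \<le> 1 / s\<^sup>2"
        by (simp add: power_divide divide_right_mono)
    qed
    also have "\<dots> = 1/16" using False by (simp add: s2)
    finally show ?thesis by (intro bexI[OF _ u])
  qed
  moreover have "finite N" using finG by (simp add: N_def)
  ultimately show ?thesis by blast
qed

text \<open>The quadratic form of the matrix \<open>\<Sum> a\<^sub>i a\<^sub>i\<^sup>T - m I\<close>: how far the vectors \<open>a\<^sub>i\<close> are from being
  isotropic.\<close>

definition quad_dev :: "nat \<Rightarrow> 'i set \<Rightarrow> ('i \<Rightarrow> nat \<Rightarrow> real) \<Rightarrow> real \<Rightarrow> (nat \<Rightarrow> real) \<Rightarrow> real" where
  "quad_dev p I a m v = (\<Sum>i\<in>I. (\<Sum>j<p. a i j * v j)\<^sup>2) - m * (\<Sum>j<p. (v j)\<^sup>2)"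

lemma quad_dev_scale: "quad_dev p I a m (\<lambda>j. c * v j) = c\<^sup>2 * quad_dev p I a m v"
proof -
  have "(\<Sum>j<p. a i j * (c * v j)) = c * (\<Sum>j<p. a i j * v j)" for i
    by (simp add: sum_distrib_left mult_ac)
  then show ?thesis
    by (simp add: quad_dev_def power_mult_distrib algebra_simps flip: sum_distrib_left)
qed

text \<open>Polarization of the symmetric bilinear form at \<open>v - u\<close> and \<open>v + u\<close>. The factors \<open>4\<close> and \<open>1/2\<close>
  balance the two arguments: in the application \<open>v - u\<close> has length at most \<open>1/4\<close> and \<open>v + u\<close> length at most
  \<open>2\<close>.\<close>

lemma quad_dev_polarization:
  "quad_dev p I a m v - quad_dev p I a m u =
     (quad_dev p I a m (\<lambda>j. 4 * (v j - u j) + (v j + u j) / 2)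
      - quad_dev p I a m (\<lambda>j. 4 * (v j - u j) - (v j + u j) / 2)) / 8"
proof -
  let ?l = "\<lambda>i v. \<Sum>j<p. a i j * v j"
  have comb: "?l i (\<lambda>j. \<alpha> * v j + \<gamma> * u j) = \<alpha> * ?l i v + \<gamma> * ?l i u" for i \<alpha> \<gamma>
    unfolding sum_distrib_left sum.distrib[symmetric] by (intro sum.cong refl) (simp add: algebra_simps)
  have "(\<lambda>j. 4 * (v j - u j) + (v j + u j) / 2) = (\<lambda>j. 9/2 * v j + (-7/2) * u j)"
    "(\<lambda>j. 4 * (v j - u j) - (v j + u j) / 2) = (\<lambda>j. 7/2 * v j + (-9/2) * u j)"
    by (intro ext; simp add: field_simps)+
  then have lin: "?l i (\<lambda>j. 4 * (v j - u j) + (v j + u j) / 2) = 4 * (?l i v - ?l i u) + (?l i v + ?l i u) / 2"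
    "?l i (\<lambda>j. 4 * (v j - u j) - (v j + u j) / 2) = 4 * (?l i v - ?l i u) - (?l i v + ?l i u) / 2" for i
    using comb[of i "9/2" "-7/2"] comb[of i "7/2" "-9/2"] by (simp_all add: fun_eq_iff field_simps)
  have id: "(4 * (x - y) + (x + y) / 2)\<^sup>2 - (4 * (x - y) - (x + y) / 2)\<^sup>2 = 8 * (x\<^sup>2 - y\<^sup>2)" for x y :: real
    by (simp add: power2_eq_square field_simps)
  have A: "(\<Sum>i\<in>I. (?l i (\<lambda>j. 4 * (v j - u j) + (v j + u j) / 2))\<^sup>2)
     - (\<Sum>i\<in>I. (?l i (\<lambda>j. 4 * (v j - u j) - (v j + u j) / 2))\<^sup>2)
     = 8 * ((\<Sum>i\<in>I. (?l i v)\<^sup>2) - (\<Sum>i\<in>I. (?l i u)\<^sup>2))"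
  proof -
    define x y where "x i = ?l i v" and "y i = ?l i u" for i
    show ?thesis unfolding lin x_def[symmetric] y_def[symmetric]
        sum_subtractf[symmetric] id sum_distrib_left[symmetric] ..
  qed
  have B: "(\<Sum>j<p. (4 * (v j - u j) + (v j + u j) / 2)\<^sup>2) - (\<Sum>j<p. (4 * (v j - u j) - (v j + u j) / 2)\<^sup>2)
    = 8 * ((\<Sum>j<p. (v j)\<^sup>2) - (\<Sum>j<p. (u j)\<^sup>2))"
    unfolding sum_subtractf[symmetric] id sum_distrib_left[symmetric] ..
  let ?A1 = "\<Sum>i\<in>I. (?l i (\<lambda>j. 4 * (v j - u j) + (v j + u j) / 2))\<^sup>2"
  let ?A2 = "\<Sum>i\<in>I. (?l i (\<lambda>j. 4 * (v j - u j) - (v j + u j) / 2))\<^sup>2"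
  let ?B1 = "\<Sum>j<p. (4 * (v j - u j) + (v j + u j) / 2)\<^sup>2"
  let ?B2 = "\<Sum>j<p. (4 * (v j - u j) - (v j + u j) / 2)\<^sup>2"
  have "?A1 - m * ?B1 - (?A2 - m * ?B2) = (?A1 - ?A2) - m * (?B1 - ?B2)" by (simp add: algebra_simps)
  also have "\<dots> = 8 * ((\<Sum>i\<in>I. (?l i v)\<^sup>2) - m * (\<Sum>j<p. (v j)\<^sup>2) - ((\<Sum>i\<in>I. (?l i u)\<^sup>2) - m * (\<Sum>j<p. (u j)\<^sup>2)))"
    unfolding A B by (simp add: algebra_simps)
  finally show ?thesis unfolding quad_dev_def by simp
qed

text \<open>The standard net argument for symmetric matrices. If \<open>M\<close> is the supremum of the form over the ball and
  \<open>u\<close> is a net point near \<open>v\<close>, polarization bounds the difference of the values at \<open>v\<close> and \<open>u\<close> by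
  \<open>M / 2\<close>; hence \<open>M \<le> \<delta> + M / 2\<close>.\<close>

theorem quad_dev_net:
  assumes N1: "\<And>u. u \<in> N \<Longrightarrow> (\<Sum>j<p. (u j)\<^sup>2) \<le> 1"
    and N2: "\<And>v. (\<Sum>j<p. (v j)\<^sup>2) \<le> 1 \<Longrightarrow> \<exists>u\<in>N. (\<Sum>j<p. (v j - u j)\<^sup>2) \<le> 1/16"
    and dev: "\<And>u. u \<in> N \<Longrightarrow> \<bar>quad_dev p I a m u\<bar> \<le> \<delta>"
  shows "\<bar>quad_dev p I a m v\<bar> \<le> 2 * \<delta> * (\<Sum>j<p. (v j)\<^sup>2)"
proof -
  define U where "U = {v. (\<Sum>j<p. (v j :: real)\<^sup>2) \<le> 1}"
  define M where "M = (SUP v\<in>U. \<bar>quad_dev p I a m v\<bar>)"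
  have U0: "(\<lambda>_. 0) \<in> U" by (simp add: U_def)
  have bdd: "bdd_above ((\<lambda>v. \<bar>quad_dev p I a m v\<bar>) ` U)"
  proof (rule bdd_aboveI2)
    fix v assume "v \<in> U"
    then have v: "(\<Sum>j<p. (v j)\<^sup>2) \<le> 1" by (simp add: U_def)
    have "\<bar>quad_dev p I a m v\<bar> \<le> \<bar>\<Sum>i\<in>I. (\<Sum>j<p. a i j * v j)\<^sup>2\<bar> + \<bar>m * (\<Sum>j<p. (v j)\<^sup>2)\<bar>"
      unfolding quad_dev_def by (rule abs_triangle_ineq4)
    also have "\<bar>\<Sum>i\<in>I. (\<Sum>j<p. a i j * v j)\<^sup>2\<bar> = (\<Sum>i\<in>I. (\<Sum>j<p. a i j * v j)\<^sup>2)"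
      by (intro abs_of_nonneg sum_nonneg) simp
    also have "\<dots> \<le> (\<Sum>i\<in>I. (\<Sum>j<p. (a i j)\<^sup>2))"
    proof (intro sum_mono)
      fix i
      have "(\<Sum>j<p. a i j * v j)\<^sup>2 \<le> (\<Sum>j<p. (a i j)\<^sup>2) * (\<Sum>j<p. (v j)\<^sup>2)"
        by (rule Cauchy_Schwarz_ineq_sum)
      also have "\<dots> \<le> (\<Sum>j<p. (a i j)\<^sup>2)" using v by (simp add: mult_left_le sum_nonneg)
      finally show "(\<Sum>j<p. a i j * v j)\<^sup>2 \<le> (\<Sum>j<p. (a i j)\<^sup>2)" .
    qed
    also have "\<bar>m * (\<Sum>j<p. (v j)\<^sup>2)\<bar> \<le> \<bar>m\<bar>"
      using v by (simp add: abs_mult mult_left_le sum_nonneg)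
    finally show "\<bar>quad_dev p I a m v\<bar> \<le> (\<Sum>i\<in>I. (\<Sum>j<p. (a i j)\<^sup>2)) + \<bar>m\<bar>" by simp
  qed
  have M0: "0 \<le> M" unfolding M_def by (rule cSUP_upper2[OF bdd U0]) simp
  have hom: "\<bar>quad_dev p I a m v\<bar> \<le> M * (\<Sum>j<p. (v j)\<^sup>2)" for v
  proof (cases "(\<Sum>j<p. (v j)\<^sup>2) = 0")
    case True
    then have "v j = 0" if "j < p" for j using that by (simp add: sum_nonneg_eq_0_iff)
    then have "(\<Sum>j<p. a i j * v j) = 0" for i by simp
    then show ?thesis using True by (simp add: quad_dev_def)
  next
    case False
    define c where "c = sqrt (\<Sum>j<p. (v j)\<^sup>2)"
    have c2: "c\<^sup>2 = (\<Sum>j<p. (v j)\<^sup>2)" unfolding c_def by (simp add: sum_nonneg)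
    then have c: "c \<noteq> 0" using False by auto
    have "(\<Sum>j<p. (1/c * v j)\<^sup>2) = 1"
      using c by (simp add: power_mult_distrib power_divide c2 False flip: sum_divide_distrib)
    then have "(\<lambda>j. 1/c * v j) \<in> U" by (simp add: U_def)
    then have "\<bar>quad_dev p I a m (\<lambda>j. 1/c * v j)\<bar> \<le> M" unfolding M_def using bdd by (rule cSUP_upper)
    then have "\<bar>quad_dev p I a m v\<bar> / c\<^sup>2 \<le> M"
      unfolding quad_dev_scale by (simp add: abs_mult power_divide)
    then show ?thesis using c by (simp add: field_simps flip: c2)
  qed
  \<comment> \<open>By the parallelogram law the two polarization arguments have square lengths summing to at most 4.\<close>
  have "M \<le> \<delta> + M / 2" unfolding M_def
  proof (rule cSUP_least)
    show "U \<noteq> {}" using U0 by auto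
    fix v assume "v \<in> U"
    then have v: "(\<Sum>j<p. (v j)\<^sup>2) \<le> 1" by (simp add: U_def)
    obtain u where u: "u \<in> N" "(\<Sum>j<p. (v j - u j)\<^sup>2) \<le> 1/16" using N2[OF v] by blast
    define q where "q \<sigma> = (\<Sum>j<p. (4 * (v j - u j) + \<sigma> * ((v j + u j) / 2))\<^sup>2)" for \<sigma> :: real
    let ?f = "\<lambda>\<sigma> j. 4 * (v j - u j) + \<sigma> * ((v j + u j) / 2)"
    have "q 1 + q (-1) = 32 * (\<Sum>j<p. (v j - u j)\<^sup>2) + (1/2) * (\<Sum>j<p. (v j + u j)\<^sup>2)"
      unfolding q_def sum_distrib_left sum.distrib[symmetric]
      by (intro sum.cong refl) (simp add: power2_eq_square field_simps)
    also have "(\<Sum>j<p. (v j + u j)\<^sup>2) \<le> (\<Sum>j<p. 2 * (v j)\<^sup>2 + 2 * (u j)\<^sup>2)"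
    proof (intro sum_mono)
      fix j show "(v j + u j)\<^sup>2 \<le> 2 * (v j)\<^sup>2 + 2 * (u j)\<^sup>2"
        using zero_le_power2[of "v j - u j"] by (simp add: power2_eq_square algebra_simps)
    qed
    also have "\<dots> \<le> 4" using v N1[OF u(1)] by (simp add: sum.distrib flip: sum_distrib_left)
    finally have q: "q 1 + q (-1) \<le> 4" using u(2) by simp
    have "\<bar>quad_dev p I a m v - quad_dev p I a m u\<bar>
        \<le> (\<bar>quad_dev p I a m (?f 1)\<bar> + \<bar>quad_dev p I a m (?f (-1))\<bar>) / 8"
    proof -
      have "?f (-1) = (\<lambda>j. 4 * (v j - u j) - (v j + u j) / 2)" by (intro ext) linarith
      then show ?thesis unfolding quad_dev_polarization[of p I a m v u] by simp
    qed
    also have "\<dots> \<le> (M * q 1 + M * q (-1)) / 8"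
      unfolding q_def by (intro divide_right_mono add_mono hom) simp
    also have "\<dots> \<le> M / 2" using mult_left_mono[OF q M0] by (simp add: algebra_simps)
    finally have "\<bar>quad_dev p I a m v\<bar> \<le> \<delta> + M / 2" using dev[OF u(1)] by linarith
    then show "\<bar>quad_dev p I a m v\<bar> \<le> \<delta> + (SUP v\<in>U. \<bar>quad_dev p I a m v\<bar>) / 2"
      by (simp add: M_def)
  qed
  then have "M \<le> 2 * \<delta>" by simp
  then have "M * (\<Sum>j<p. (v j)\<^sup>2) \<le> 2 * \<delta> * (\<Sum>j<p. (v j)\<^sup>2)"
    by (intro mult_right_mono sum_nonneg) auto
  then show ?thesis using hom[of v] by linarith
qed

section \<open>Normal equations and the effect of removing observations\<close>

definition linear_fit :: "nat \<Rightarrow> (nat \<Rightarrow> real) \<Rightarrow> obs \<Rightarrow> real" where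
  "linear_fit p v z = (\<Sum>j<p. fst z j * v j)"

text \<open>Lets the arbitrary value of an estimator be ignored: as soon as the design is injective, the estimator
  is the least squares formula.\<close>

lemma injective_full_column_rank:
  assumes X: "X \<in> carrier_mat m p"
    and inj: "\<And>v. v \<in> carrier_vec p \<Longrightarrow> X *\<^sub>v v = 0\<^sub>v m \<Longrightarrow> v = 0\<^sub>v p"
  shows "full_column_rank X"
proof -
  have dist: "distinct (cols X)"
  proof (rule ccontr)
    assume "\<not> distinct (cols X)"
    then obtain i j where ij: "i < p" "j < p" "i \<noteq> j" "col X i = col X j"
      using X unfolding distinct_conv_nth by auto
    define v :: rvec where "v = unit_vec p i - unit_vec p j"
    have v: "v \<in> carrier_vec p" by (simp add: v_def)
    have "X *\<^sub>v v = X *\<^sub>v unit_vec p i - X *\<^sub>v unit_vec p j"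
      unfolding v_def using X by (intro mult_minus_distrib_mat_vec) auto
    also have "X *\<^sub>v unit_vec p k = col X k" if "k < p" for k
      using X that by (intro eq_vecI) auto
    then have "X *\<^sub>v unit_vec p i - X *\<^sub>v unit_vec p j = 0\<^sub>v m"
      using ij X by (metis carrier_matD(1) col_dim carrier_vecI minus_cancel_vec)
    finally have "v = 0\<^sub>v p" by (rule inj[OF v])
    then have "v $ i = 0" using ij by simp
    then show False using ij by (simp add: v_def)
  qed
  have "vec_space.rank m X = p"
  proof (rule vec_space.lin_indpt_full_rank[OF X dist])
    show "\<not> module.lin_dep class_ring (module_vec TYPE(real) m) (set (cols X))"
      using vec_space.lin_depE[OF X _ dist] inj by blast
  qed
  then show ?thesis using X by (simp add: full_column_rank_def)
qed

lemma scalar_prod_gram: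
  fixes X :: rmat
  assumes X: "X \<in> carrier_mat m p" and u: "u \<in> carrier_vec p" and v: "v \<in> carrier_vec p"
  shows "u \<bullet> ((X\<^sup>T * X) *\<^sub>v v) = (X *\<^sub>v u) \<bullet> (X *\<^sub>v v)"
proof -
  have "u \<bullet> ((X\<^sup>T * X) *\<^sub>v v) = u \<bullet> (X\<^sup>T *\<^sub>v (X *\<^sub>v v))" using X v by (simp add: assoc_mult_mat_vec)
  also have "\<dots> = (X\<^sup>T *\<^sub>v (X *\<^sub>v v)) \<bullet> u" using X u v by (intro comm_scalar_prod[of _ p]) auto
  also have "\<dots> = (X *\<^sub>v v) \<bullet> (X *\<^sub>v u)" using X u v by (intro transpose_vec_mult_scalar) auto
  also have "\<dots> = (X *\<^sub>v u) \<bullet> (X *\<^sub>v v)" using X u v by (intro comm_scalar_prod[of _ m]) auto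
  finally show ?thesis .
qed

lemma ols_normal_equations:
  fixes X :: rmat
  assumes X: "X \<in> carrier_mat m p" and y: "y \<in> carrier_vec m"
    and inj: "\<And>v. v \<in> carrier_vec p \<Longrightarrow> X *\<^sub>v v = 0\<^sub>v m \<Longrightarrow> v = 0\<^sub>v p"
    and u: "u \<in> carrier_vec p"
  shows "ols X y \<in> carrier_vec p" "(X *\<^sub>v u) \<bullet> (X *\<^sub>v ols X y) = (X *\<^sub>v u) \<bullet> y"
proof -
  let ?G = "X\<^sup>T * X"
  have G: "?G \<in> carrier_mat p p" using X by simp
  have pd: "pos_def_mat ?G" unfolding pos_def_mat_def
  proof (intro conjI ballI impI)
    show "square_mat ?G" using G by simp
    show "?G\<^sup>T = ?G" using X by (simp add: transpose_mult[of _ p m _ p])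
    fix v :: rvec assume "v \<in> carrier_vec (dim_row ?G)" "v \<noteq> 0\<^sub>v (dim_row ?G)"
    then have v: "v \<in> carrier_vec p" "v \<noteq> 0\<^sub>v p" using G by auto
    then have "X *\<^sub>v v \<noteq> 0\<^sub>v m" using inj by blast
    moreover have "X *\<^sub>v v \<in> carrier_vec m" using X v by simp
    ultimately show "0 < v \<bullet> (?G *\<^sub>v v)"
      unfolding scalar_prod_gram[OF X v(1) v(1)] by (simp add: scalar_prod_self_pos_iff)
  qed
  note inv = pos_def_mat_inv[OF G pd]
  have Xy: "X\<^sup>T *\<^sub>v y \<in> carrier_vec p" using X y by simp
  show o: "ols X y \<in> carrier_vec p" unfolding ols_def using inv(1) Xy by simp
  have "(X *\<^sub>v u) \<bullet> (X *\<^sub>v ols X y) = u \<bullet> (?G *\<^sub>v ols X y)"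
    by (rule scalar_prod_gram[OF X u o, symmetric])
  also have "?G *\<^sub>v ols X y = (?G * mat_inv ?G) *\<^sub>v (X\<^sup>T *\<^sub>v y)"
    unfolding ols_def using G inv(1) Xy by (simp add: assoc_mult_mat_vec del: assoc_mult_mat)
  also have "\<dots> = X\<^sup>T *\<^sub>v y" unfolding inv(2) using Xy by simp
  also have "u \<bullet> (X\<^sup>T *\<^sub>v y) = (X\<^sup>T *\<^sub>v y) \<bullet> u" using X u y by (intro comm_scalar_prod[of _ p]) auto
  also have "\<dots> = y \<bullet> (X *\<^sub>v u)" using X u y by (intro transpose_vec_mult_scalar) auto
  also have "\<dots> = (X *\<^sub>v u) \<bullet> y" using X u y by (intro comm_scalar_prod[of _ m]) auto
  finally show "(X *\<^sub>v u) \<bullet> (X *\<^sub>v ols X y) = (X *\<^sub>v u) \<bullet> y" .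
qed

lemma bij_betw_pick:
  assumes "finite S"
  shows "bij_betw (pick S) {..<card S} S"
proof (rule bij_betw_byWitness[where f' = "\<lambda>i. card {a \<in> S. a < i}"])
  show "\<forall>k\<in>{..<card S}. card {a \<in> S. a < pick S k} = k" using card_pick by auto
  show "\<forall>i\<in>S. pick S (card {a \<in> S. a < i}) = i" using pick_card_in_set by auto
  show "pick S ` {..<card S} \<subseteq> S" using pick_in_set by auto
  show "(\<lambda>i. card {a \<in> S. a < i}) ` S \<subseteq> {..<card S}"
    using assms by (auto intro!: psubset_card_mono)
qed

text \<open>The normal equations as sums over observations, for a design whose rows are enumerated by an arbitrary
  bijection. Both the full design and its row restrictions are instances.\<close>

lemma ols_rows_orthogonality:
  fixes X :: rmat and r :: "'i \<Rightarrow> obs"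
  assumes X: "X \<in> carrier_mat m p" and y: "y \<in> carrier_vec m" and bij: "bij_betw f {..<m} I"
    and Xr: "\<And>i j. i < m \<Longrightarrow> j < p \<Longrightarrow> X $$ (i,j) = fst (r (f i)) j"
    and yr: "\<And>i. i < m \<Longrightarrow> y $ i = snd (r (f i))"
    and inj: "\<And>v. (\<And>i. i \<in> I \<Longrightarrow> linear_fit p v (r i) = 0) \<Longrightarrow> \<forall>j<p. v j = 0"
  shows "full_column_rank X" 
    "(\<Sum>i\<in>I. linear_fit p u (r i) * linear_fit p (($) (ols X y)) (r i)) = (\<Sum>i\<in>I. linear_fit p u (r i) * snd (r i))"
proof -
  have Xv: "(X *\<^sub>v v) $ i = linear_fit p (($) v) (r (f i))" if "v \<in> carrier_vec p" "i < m" for v i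
    using that X by (simp add: scalar_prod_def linear_fit_def Xr atLeast0LessThan)
  have inj': "v = 0\<^sub>v p" if v: "v \<in> carrier_vec p" "X *\<^sub>v v = 0\<^sub>v m" for v
  proof -
    have "linear_fit p (($) v) (r i) = 0" if i: "i \<in> I" for i
    proof -
      obtain k where "k < m" "i = f k" using bij i unfolding bij_betw_def by auto
      then show ?thesis using Xv[OF v(1), of k] v(2) by simp
    qed
    then have "\<forall>j<p. v $ j = 0" by (rule inj)
    then show ?thesis using v(1) by (intro eq_vecI) auto
  qed
  show "full_column_rank X" by (rule injective_full_column_rank[OF X inj'])
  define w where "w = Matrix.vec p u"
  have w: "w \<in> carrier_vec p" by (simp add: w_def)
  have uw: "linear_fit p u = linear_fit p (($) w)" by (intro ext) (simp add: linear_fit_def w_def)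
  note ne = ols_normal_equations[OF X y inj' w]
  have sp: "(X *\<^sub>v w) \<bullet> z = (\<Sum>i<m. linear_fit p u (r (f i)) * z $ i)" if "z \<in> carrier_vec m" for z
    using that by (simp add: scalar_prod_def Xv[OF w] uw atLeast0LessThan del: index_mult_mat_vec)
  have "X *\<^sub>v ols X y \<in> carrier_vec m" using X ne(1) by simp
  from ne(2)[unfolded sp[OF y] sp[OF this]]
  have "(\<Sum>i<m. linear_fit p u (r (f i)) * linear_fit p (($) (ols X y)) (r (f i)))
     = (\<Sum>i<m. linear_fit p u (r (f i)) * snd (r (f i)))"
    by (simp add: Xv[OF ne(1)] yr del: index_mult_mat_vec)
  then show "(\<Sum>i\<in>I. linear_fit p u (r i) * linear_fit p (($) (ols X y)) (r i)) = (\<Sum>i\<in>I. linear_fit p u (r i) * snd (r i))"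
    by (simp add: sum.reindex_bij_betw[OF bij, of "\<lambda>i. linear_fit p u (r i) * linear_fit p (($) (ols X y)) (r i)"]
      sum.reindex_bij_betw[OF bij, of "\<lambda>i. linear_fit p u (r i) * snd (r i)"])
qed

lemma ols_design:
  assumes inj: "\<And>v. (\<And>i. i < n \<Longrightarrow> linear_fit p v (d i) = 0) \<Longrightarrow> \<forall>j<p. v j = 0"
  shows "full_column_rank (design n p d)"
    "(\<Sum>i<n. linear_fit p u (d i) * linear_fit p (($) (ols (design n p d) (response n d))) (d i))
      = (\<Sum>i<n. linear_fit p u (d i) * snd (d i))"
proof -
  show "full_column_rank (design n p d)"
    by (rule ols_rows_orthogonality(1)[where f = id and m = n and I = "{..<n}" and r = d and y = "response n d"])
      (use inj in \<open>auto simp: design_def response_def covar_def\<close>)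
  show "(\<Sum>i<n. linear_fit p u (d i) * linear_fit p (($) (ols (design n p d) (response n d))) (d i))
      = (\<Sum>i<n. linear_fit p u (d i) * snd (d i))"
    by (rule ols_rows_orthogonality(2)[where f = id and m = n])
      (use inj in \<open>auto simp: design_def response_def covar_def\<close>)
qed

lemma ols_restrict:
  assumes S: "S \<subseteq> {..<n}"
    and inj: "\<And>v. (\<And>i. i \<in> S \<Longrightarrow> linear_fit p v (d i) = 0) \<Longrightarrow> \<forall>j<p. v j = 0"
  shows "full_column_rank (restrict_rows (design n p d) S)"
    "(\<Sum>i\<in>S. linear_fit p u (d i) *
        linear_fit p (($) (ols (restrict_rows (design n p d) S) (restrict_vec (response n d) S))) (d i))
      = (\<Sum>i\<in>S. linear_fit p u (d i) * snd (d i))"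
proof -
  let ?X = "restrict_rows (design n p d) S" and ?y = "restrict_vec (response n d) S"
  have fin: "finite S" using S finite_subset by blast
  have S': "{i. i < n \<and> i \<in> S} = S" using S by auto
  have pk: "pick S i < n" if "i < card S" for i using pick_in_set[of i S] that S by auto
  have X: "?X \<in> carrier_mat (card S) p" and y: "?y \<in> carrier_vec (card S)"
    by (auto simp: restrict_rows_def restrict_vec_def dim_submatrix design_def response_def S')
  have Xr: "?X $$ (i,j) = fst (d (pick S i)) j" if "i < card S" "j < p" for i j
    using that pk by (simp add: restrict_rows_def submatrix_index design_def S' pick_UNIV covar_def)
  have yr: "?y $ i = snd (d (pick S i))" if "i < card S" for i
    using that pk by (simp add: restrict_vec_def response_def S')
  show "full_column_rank ?X" 
    by (rule ols_rows_orthogonality(1)[OF X y bij_betw_pick[OF fin] Xr yr inj])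
  show "(\<Sum>i\<in>S. linear_fit p u (d i) * linear_fit p (($) (ols ?X ?y)) (d i))
      = (\<Sum>i\<in>S. linear_fit p u (d i) * snd (d i))"
    by (rule ols_rows_orthogonality(2)[OF X y bij_betw_pick[OF fin] Xr yr inj])
qed

text \<open>Subtracting the two systems of normal equations shows that the vector of fitted differences \<open>X (b - bS)\<close>
  has the same inner product with the column space of \<open>X\<close> as the residuals of \<open>bS\<close> on the removed
  observations, extended by zero. So it is an orthogonal projection of that residual vector, and not longer than
  it.\<close>

theorem ols_difference_bound:
  assumes fin: "finite I" and SI: "S \<subseteq> I"
    and full: "\<And>u. (\<Sum>i\<in>I. linear_fit p u (d i) * linear_fit p b (d i)) = (\<Sum>i\<in>I. linear_fit p u (d i) * snd (d i))"
    and sub: "\<And>u. (\<Sum>i\<in>S. linear_fit p u (d i) * linear_fit p bS (d i)) = (\<Sum>i\<in>S. linear_fit p u (d i) * snd (d i))"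
  shows "(\<Sum>i\<in>I. (linear_fit p (\<lambda>j. b j - bS j) (d i))\<^sup>2) \<le> (\<Sum>i\<in>I - S. (snd (d i) - linear_fit p bS (d i))\<^sup>2)"
proof -
  define D where "D = (\<lambda>j. b j - bS j)"
  let ?L = "\<lambda>v i. linear_fit p v (d i)"
  have LD: "?L D i = ?L b i - ?L bS i" for i
    by (simp add: linear_fit_def D_def algebra_simps sum_subtractf)
  have "(\<Sum>i\<in>I. (?L D i)\<^sup>2) = (\<Sum>i\<in>I. ?L D i * ?L b i) - (\<Sum>i\<in>I. ?L D i * ?L bS i)"
    by (simp add: LD power2_eq_square algebra_simps flip: sum_subtractf)
  also have "\<dots> = (\<Sum>i\<in>I. ?L D i * (snd (d i) - ?L bS i))"
    by (simp add: full algebra_simps flip: sum_subtractf)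
  also have "\<dots> = (\<Sum>i\<in>I - S. ?L D i * (snd (d i) - ?L bS i)) + (\<Sum>i\<in>S. ?L D i * (snd (d i) - ?L bS i))"
    by (rule sum.subset_diff[OF SI fin])
  also have "(\<Sum>i\<in>S. ?L D i * (snd (d i) - ?L bS i)) = 0"
    using sub[of D] by (simp add: algebra_simps sum_subtractf)
  finally have e: "(\<Sum>i\<in>I. (?L D i)\<^sup>2) = (\<Sum>i\<in>I - S. ?L D i * (snd (d i) - ?L bS i))" by simp
  have "(\<Sum>i\<in>I. (?L D i)\<^sup>2) \<le> (\<Sum>i\<in>I - S. ((?L D i)\<^sup>2 + (snd (d i) - ?L bS i)\<^sup>2) / 2)"
    unfolding e
  proof (rule sum_mono)
    have amgm: "x * y \<le> (x\<^sup>2 + y\<^sup>2) / 2" for x y :: real using sum_squares_bound[of x y] by simp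
    show "?L D i * (snd (d i) - ?L bS i) \<le> ((?L D i)\<^sup>2 + (snd (d i) - ?L bS i)\<^sup>2) / 2" for i
      by (rule amgm)
  qed
  also have "\<dots> = ((\<Sum>i\<in>I - S. (?L D i)\<^sup>2) + (\<Sum>i\<in>I - S. (snd (d i) - ?L bS i)\<^sup>2)) / 2"
    by (simp add: sum.distrib flip: sum_divide_distrib)
  finally have "2 * (\<Sum>i\<in>I. (?L D i)\<^sup>2) \<le> (\<Sum>i\<in>I - S. (?L D i)\<^sup>2) + (\<Sum>i\<in>I - S. (snd (d i) - ?L bS i)\<^sup>2)"
    by simp
  moreover have "(\<Sum>i\<in>I - S. (?L D i)\<^sup>2) \<le> (\<Sum>i\<in>I. (?L D i)\<^sup>2)" using fin by (intro sum_mono2) auto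
  ultimately show ?thesis unfolding D_def by linarith
qed

text \<open>The fitted values are the orthogonal projection of the responses.\<close>

lemma ols_fit_bound:
  assumes sub: "\<And>u. (\<Sum>i\<in>S. linear_fit p u (d i) * linear_fit p b (d i)) = (\<Sum>i\<in>S. linear_fit p u (d i) * snd (d i))"
  shows "(\<Sum>i\<in>S. (linear_fit p b (d i))\<^sup>2) \<le> (\<Sum>i\<in>S. (snd (d i))\<^sup>2)"
proof -
  let ?L = "\<lambda>i. linear_fit p b (d i)"
  have "0 \<le> (\<Sum>i\<in>S. (snd (d i) - ?L i)\<^sup>2)" by (intro sum_nonneg) simp
  also have "\<dots> = (\<Sum>i\<in>S. (snd (d i))\<^sup>2) - 2 * (\<Sum>i\<in>S. ?L i * snd (d i)) + (\<Sum>i\<in>S. (?L i)\<^sup>2)"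
    by (simp add: power2_diff sum.distrib sum_subtractf sum_distrib_left mult_ac)
  also have "(\<Sum>i\<in>S. ?L i * snd (d i)) = (\<Sum>i\<in>S. (?L i)\<^sup>2)"
    by (simp add: sub[symmetric] power2_eq_square)
  finally show ?thesis by simp
qed

lemma vnorm_nonneg: "0 \<le> vnorm x"
  by (simp add: vnorm_def scalar_prod_def sum_nonneg)

lemma vnorm_power2:
  assumes "x \<in> carrier_vec p"
  shows "(vnorm x)\<^sup>2 = (\<Sum>j<p. (x $ j)\<^sup>2)"
  using assms by (simp add: vnorm_def scalar_prod_def power2_eq_square sum_nonneg atLeast0LessThan)

text \<open>The supremum defining the spectral norm is taken in the reals, so it is an upper bound only because the
  set is bounded, here by the Frobenius norm.\<close>

lemma spectral_norm_bound:
  assumes W: "W \<in> carrier_mat p p" and v: "v \<in> carrier_vec p"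
  shows "vnorm (W *\<^sub>v v) \<le> spectral_norm W * vnorm v"
proof -
  note sq = vnorm_power2 and nn = vnorm_nonneg
  let ?U = "{v \<in> carrier_vec (dim_col W). vnorm v \<le> 1}"
  have bdd: "bdd_above ((\<lambda>v. vnorm (W *\<^sub>v v)) ` ?U)"
  proof (rule bdd_aboveI2)
    fix v :: rvec assume "v \<in> ?U"
    then have v: "v \<in> carrier_vec p" "vnorm v \<le> 1" using W by auto
    have Wv: "W *\<^sub>v v \<in> carrier_vec p" using W v by simp
    have "(vnorm (W *\<^sub>v v))\<^sup>2 = (\<Sum>i<p. (\<Sum>j<p. W $$ (i,j) * v $ j)\<^sup>2)"
      unfolding sq[OF Wv] using W v by (simp add: scalar_prod_def atLeast0LessThan)
    also have "\<dots> \<le> (\<Sum>i<p. \<Sum>j<p. (W $$ (i,j))\<^sup>2)"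
    proof (intro sum_mono)
      fix i
      have "(\<Sum>j<p. W $$ (i,j) * v $ j)\<^sup>2 \<le> (\<Sum>j<p. (W $$ (i,j))\<^sup>2) * (\<Sum>j<p. (v $ j)\<^sup>2)"
        by (rule Cauchy_Schwarz_ineq_sum)
      also have "\<dots> \<le> (\<Sum>j<p. (W $$ (i,j))\<^sup>2)"
        using v(2) nn[of v] unfolding sq[OF v(1), symmetric]
        by (intro mult_left_le) (auto simp: sum_nonneg abs_square_le_1)
      finally show "(\<Sum>j<p. W $$ (i,j) * v $ j)\<^sup>2 \<le> (\<Sum>j<p. (W $$ (i,j))\<^sup>2)" .
    qed
    finally show "vnorm (W *\<^sub>v v) \<le> sqrt (\<Sum>i<p. \<Sum>j<p. (W $$ (i,j))\<^sup>2)"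
      using nn by (simp add: real_le_rsqrt)
  qed
  show ?thesis
  proof (cases "vnorm v = 0")
    case True
    then have "v \<bullet> v = 0" by (simp add: vnorm_def)
    then have "v = 0\<^sub>v p" using scalar_prod_self_pos_iff[OF v] by auto
    then have "W *\<^sub>v v = 0\<^sub>v p" using W by auto
    then show ?thesis by (simp add: True) (simp add: vnorm_def)
  next
    case False
    have scale: "vnorm (c \<cdot>\<^sub>v x) = c * vnorm x" if "0 \<le> c" for c x
      using that by (simp add: vnorm_def real_sqrt_mult)
    let ?c = "1 / vnorm v"
    have c: "0 \<le> ?c" using nn by simp
    have "?c \<cdot>\<^sub>v v \<in> ?U" using W v False by (simp add: scale[OF c])
    then have "vnorm (W *\<^sub>v (?c \<cdot>\<^sub>v v)) \<le> spectral_norm W"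
      unfolding spectral_norm_def using bdd by (intro cSUP_upper)
    also have "W *\<^sub>v (?c \<cdot>\<^sub>v v) = ?c \<cdot>\<^sub>v (W *\<^sub>v v)" using W v by (rule mult_mat_vec)
    finally show ?thesis using False nn[of v] by (simp add: scale[OF c] field_simps)
  qed
qed

section \<open>Concentration on product spaces\<close>

text \<open>Taylor expansion to second order; the remainder \<open>(\<mu> q)\<^sup>2 exp (q / 2) / 2\<close> is absorbed by \<open>exp q\<close>
  because \<open>q\<^sup>2 \<le> 8 exp (q / 2)\<close>.\<close>

lemma exp_mgf_pointwise:
  fixes q \<mu> :: real
  assumes q: "0 \<le> q" and \<mu>: "\<bar>\<mu>\<bar> \<le> 1/2"
  shows "exp (\<mu> * q) \<le> 1 + \<mu> * q + 4 * \<mu>\<^sup>2 * exp q"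
proof -
  obtain \<xi> where \<xi>: "\<bar>\<xi>\<bar> \<le> \<bar>\<mu> * q\<bar>"
    "exp (\<mu> * q) = (\<Sum>i<2. (\<mu> * q) ^ i / fact i) + exp \<xi> / fact 2 * (\<mu> * q) ^ 2"
    using Maclaurin_exp_le by blast
  have "\<bar>\<mu> * q\<bar> \<le> q / 2" using mult_right_mono[OF \<mu> q] q by (simp add: abs_mult)
  then have "\<xi> \<le> q / 2" using \<xi>(1) by linarith
  then have "exp \<xi> \<le> exp (q / 2)" by simp
  moreover have "q\<^sup>2 \<le> 8 * exp (q / 2)"
    using exp_lower_Taylor_quadratic[of "q / 2"] q by (simp add: power2_eq_square)
  ultimately have "exp \<xi> * q\<^sup>2 \<le> exp (q / 2) * (8 * exp (q / 2))" by (intro mult_mono) auto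
  also have "\<dots> = 8 * exp q" by (simp flip: exp_add)
  finally have "\<mu>\<^sup>2 * (exp \<xi> * q\<^sup>2) \<le> \<mu>\<^sup>2 * (8 * exp q)" by (intro mult_left_mono) auto
  then show ?thesis unfolding \<xi>(2) by (simp add: numeral_2_eq_2 power_mult_distrib mult_ac)
qed

lemma subgaussian_integrable:
  assumes w[measurable]: "w \<in> borel_measurable P" and t: "0 < t"
    and sg: "(\<integral>\<^sup>+z. ennreal (exp ((w z)\<^sup>2 / t\<^sup>2)) \<partial>P) \<le> ennreal (exp 1)"
  shows "integrable P (\<lambda>z. exp ((w z)\<^sup>2 / t\<^sup>2))" "(\<integral>z. exp ((w z)\<^sup>2 / t\<^sup>2) \<partial>P) \<le> exp 1"
    "integrable P (\<lambda>z. (w z)\<^sup>2)"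
proof -
  show int: "integrable P (\<lambda>z. exp ((w z)\<^sup>2 / t\<^sup>2))"
    using sg by (intro integrableI_nonneg) (auto intro: le_less_trans)
  show "(\<integral>z. exp ((w z)\<^sup>2 / t\<^sup>2) \<partial>P) \<le> exp 1"
    using sg by (subst (asm) nn_integral_eq_integral[OF int]) auto
  show "integrable P (\<lambda>z. (w z)\<^sup>2)"
  proof (rule Bochner_Integration.integrable_bound[where g = "\<lambda>z. (w z)\<^sup>2" and f = "\<lambda>z. t\<^sup>2 * exp ((w z)\<^sup>2 / t\<^sup>2)"])
    show "integrable P (\<lambda>z. t\<^sup>2 * exp ((w z)\<^sup>2 / t\<^sup>2))" using int by simp
    have "(w z)\<^sup>2 \<le> t\<^sup>2 * exp ((w z)\<^sup>2 / t\<^sup>2)" for z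
    proof -
      have "(w z)\<^sup>2 / t\<^sup>2 \<le> exp ((w z)\<^sup>2 / t\<^sup>2)"
        using exp_ge_add_one_self[of "(w z)\<^sup>2 / t\<^sup>2"] by linarith
      then show ?thesis using t by (simp add: pos_divide_le_eq mult.commute)
    qed
    then show "AE z in P. norm ((w z)\<^sup>2) \<le> norm (t\<^sup>2 * exp ((w z)\<^sup>2 / t\<^sup>2))" by simp
  qed simp
qed

text \<open>The square of a sub-Gaussian variable is sub-exponential. The bound has the exact mean in the linear term
  and \<open>t ^ 4\<close> in the quadratic term; the latter is the source of the dependence on the fourth power of the
  \<open>\<psi>\<^sub>2\<close> norm.\<close>

lemma square_mgf_bound:
  assumes P: "prob_space P" and w[measurable]: "w \<in> borel_measurable P" and t: "0 < t"
    and sg: "(\<integral>\<^sup>+z. ennreal (exp ((w z)\<^sup>2 / t\<^sup>2)) \<partial>P) \<le> ennreal (exp 1)"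
    and s: "(\<integral>z. (w z)\<^sup>2 \<partial>P) = s" and l: "\<bar>l\<bar> \<le> 1 / (2 * t\<^sup>2)"
  shows "(\<integral>\<^sup>+z. ennreal (exp (l * (w z)\<^sup>2)) \<partial>P) \<le> ennreal (exp (l * s + 4 * exp 1 * l\<^sup>2 * t ^ 4))"
proof -
  interpret prob_space P by (rule P)
  note si = subgaussian_integrable[OF w t sg]
  let ?h = "\<lambda>z. 1 + l * (w z)\<^sup>2 + 4 * l\<^sup>2 * t ^ 4 * exp ((w z)\<^sup>2 / t\<^sup>2)"
  have le: "exp (l * (w z)\<^sup>2) \<le> ?h z" for z
  proof -
    have "\<bar>l * t\<^sup>2\<bar> \<le> 1/2" using l t by (simp add: abs_mult field_simps)
    from exp_mgf_pointwise[OF _ this, of "(w z)\<^sup>2 / t\<^sup>2"] show ?thesis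
      using t by (simp add: power_mult_distrib flip: power_mult)
  qed
  have int: "integrable P ?h" using si(1,3) by auto
  have nn: "0 \<le> ?h z" for z using le[of z] exp_gt_zero[of "l * (w z)\<^sup>2"] by linarith
  have "(\<integral>\<^sup>+z. ennreal (exp (l * (w z)\<^sup>2)) \<partial>P) \<le> (\<integral>\<^sup>+z. ennreal (?h z) \<partial>P)"
    by (intro nn_integral_mono ennreal_leI le)
  also have "\<dots> = ennreal (\<integral>z. ?h z \<partial>P)" by (intro nn_integral_eq_integral int) (simp add: nn)
  also have "(\<integral>z. ?h z \<partial>P) = 1 + l * s + 4 * l\<^sup>2 * t ^ 4 * (\<integral>z. exp ((w z)\<^sup>2 / t\<^sup>2) \<partial>P)"
    using si(1,3) s by (simp add: prob_space)
  also have "ennreal \<dots> \<le> ennreal (exp (l * s + 4 * exp 1 * l\<^sup>2 * t ^ 4))"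
  proof (rule ennreal_leI)
    have "4 * l\<^sup>2 * t ^ 4 * (\<integral>z. exp ((w z)\<^sup>2 / t\<^sup>2) \<partial>P) \<le> 4 * l\<^sup>2 * t ^ 4 * exp 1"
      using si(2) by (intro mult_left_mono) auto
    then show "1 + l * s + 4 * l\<^sup>2 * t ^ 4 * (\<integral>z. exp ((w z)\<^sup>2 / t\<^sup>2) \<partial>P) \<le> exp (l * s + 4 * exp 1 * l\<^sup>2 * t ^ 4)"
      using exp_ge_add_one_self[of "l * s + 4 * exp 1 * l\<^sup>2 * t ^ 4"] by (simp only: mult_ac)
  qed
  finally show ?thesis .
qed

lemma measurable_at_coordinate:
  assumes f: "f \<in> borel_measurable P" and i: "i \<in> I"
  shows "(\<lambda>d. f (d i)) \<in> borel_measurable (\<Pi>\<^sub>M i\<in>I. P)"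
  using measurable_component_singleton[OF i, of "\<lambda>_. P"] f by (rule measurable_compose)

lemma nn_integral_prod_coordinates:
  assumes P: "prob_space P" and I: "finite I" and J: "J \<subseteq> I" and f: "f \<in> borel_measurable P"
  shows "(\<integral>\<^sup>+d. (\<Prod>i\<in>J. f (d i)) \<partial>(\<Pi>\<^sub>M i\<in>I. P)) = (\<integral>\<^sup>+z. f z \<partial>P) ^ card J"
proof -
  interpret prob_space P by (rule P)
  interpret product_sigma_finite "\<lambda>_. P" by standard
  define g where "g i = (if i \<in> J then f else (\<lambda>_. 1))" for i
  have fin: "finite J" using I J finite_subset by blast
  have "(\<integral>\<^sup>+d. (\<Prod>i\<in>J. f (d i)) \<partial>(\<Pi>\<^sub>M i\<in>I. P)) = (\<integral>\<^sup>+d. (\<Prod>i\<in>I. g i (d i)) \<partial>(\<Pi>\<^sub>M i\<in>I. P))"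
    using I J by (intro nn_integral_cong prod.mono_neutral_cong_left) (auto simp: g_def)
  also have "\<dots> = (\<Prod>i\<in>I. \<integral>\<^sup>+z. g i z \<partial>P)"
    using I f by (intro product_nn_integral_prod) (auto simp: g_def)
  also have "\<dots> = (\<Prod>i\<in>J. \<integral>\<^sup>+z. f z \<partial>P)"
    using I J by (intro prod.mono_neutral_cong_right) (auto simp: g_def emeasure_space_1)
  finally show ?thesis by simp
qed

lemma chernoff_bound:
  assumes P: "prob_space P" and I: "finite I" and J: "J \<subseteq> I" and f[measurable]: "f \<in> borel_measurable P"
    and mgf: "(\<integral>\<^sup>+z. ennreal (exp (f z)) \<partial>P) \<le> ennreal (exp a)"
  shows "emeasure (\<Pi>\<^sub>M i\<in>I. P) {d \<in> space (\<Pi>\<^sub>M i\<in>I. P). \<tau> \<le> (\<Sum>i\<in>J. f (d i))}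
     \<le> ennreal (exp (real (card J) * a - \<tau>))"
proof -
  let ?M = "\<Pi>\<^sub>M i\<in>I. P"
  have fi[measurable]: "(\<lambda>d. f (d i)) \<in> borel_measurable ?M" if "i \<in> J" for i
    using J that by (intro measurable_at_coordinate[OF f]) auto
  have A[measurable]: "{d \<in> space ?M. \<tau> \<le> (\<Sum>i\<in>J. f (d i))} \<in> sets ?M" by measurable
  have "emeasure ?M {d \<in> space ?M. \<tau> \<le> (\<Sum>i\<in>J. f (d i))}
      = (\<integral>\<^sup>+d. indicator {d \<in> space ?M. \<tau> \<le> (\<Sum>i\<in>J. f (d i))} d \<partial>?M)" by simp
  also have "\<dots> \<le> (\<integral>\<^sup>+d. ennreal (exp (- \<tau>)) * (\<Prod>i\<in>J. ennreal (exp (f (d i)))) \<partial>?M)"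
  proof (intro nn_integral_mono)
    fix d
    have "ennreal (exp (- \<tau>)) * (\<Prod>i\<in>J. ennreal (exp (f (d i)))) = ennreal (exp ((\<Sum>i\<in>J. f (d i)) - \<tau>))"
      by (simp add: prod_ennreal exp_sum[OF finite_subset[OF J I]] exp_diff exp_minus divide_inverse
          mult.commute prod_nonneg flip: ennreal_mult)
    moreover have "1 \<le> ennreal (exp ((\<Sum>i\<in>J. f (d i)) - \<tau>))" if "\<tau> \<le> (\<Sum>i\<in>J. f (d i))"
      using that ennreal_leI[of 1 "exp ((\<Sum>i\<in>J. f (d i)) - \<tau>)"] by simp
    ultimately show "indicator {d \<in> space ?M. \<tau> \<le> (\<Sum>i\<in>J. f (d i))} d
       \<le> ennreal (exp (- \<tau>)) * (\<Prod>i\<in>J. ennreal (exp (f (d i))))"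
      by (auto split: split_indicator)
  qed
  also have "\<dots> = ennreal (exp (- \<tau>)) * (\<integral>\<^sup>+d. (\<Prod>i\<in>J. ennreal (exp (f (d i)))) \<partial>?M)"
    by (rule nn_integral_cmult) measurable
  also have "(\<integral>\<^sup>+d. (\<Prod>i\<in>J. ennreal (exp (f (d i)))) \<partial>?M) = (\<integral>\<^sup>+z. ennreal (exp (f z)) \<partial>P) ^ card J"
    by (rule nn_integral_prod_coordinates[OF P I J]) measurable
  also have "ennreal (exp (- \<tau>)) * \<dots> \<le> ennreal (exp (- \<tau>)) * ennreal (exp a) ^ card J"
    by (intro mult_left_mono power_mono mgf) auto
  also have "\<dots> = ennreal (exp (real (card J) * a - \<tau>))"
    by (simp add: ennreal_power exp_diff exp_minus exp_of_nat_mult exp_of_nat2_mult divide_inverse mult.commute flip: ennreal_mult)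
  finally show ?thesis .
qed

text \<open>Exponential Markov inequality in both directions with \<open>l = 1 / (32 e t ^ 4)\<close>, the value minimising
  \<open>4 e l\<^sup>2 t ^ 4 - l / 4\<close>. The lower bound on \<open>t\<close> keeps \<open>l\<close> in the range where the moment generating function
  is controlled.\<close>

lemma bernstein_square:
  assumes P: "prob_space P" and I: "finite I" and J: "J \<subseteq> I" and w[measurable]: "w \<in> borel_measurable P"
    and t: "1/2 \<le> t"
    and sg: "(\<integral>\<^sup>+z. ennreal (exp ((w z)\<^sup>2 / t\<^sup>2)) \<partial>P) \<le> ennreal (exp 1)"
    and s: "(\<integral>z. (w z)\<^sup>2 \<partial>P) = s"
  shows "emeasure (\<Pi>\<^sub>M i\<in>I. P) {d \<in> space (\<Pi>\<^sub>M i\<in>I. P).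
      real (card J) / 4 < \<bar>(\<Sum>i\<in>J. (w (d i))\<^sup>2) - real (card J) * s\<bar>}
     \<le> ennreal (2 * exp (- real (card J) / (768 * t ^ 4)))"
proof -
  let ?M = "\<Pi>\<^sub>M i\<in>I. P" and ?m = "real (card J)"
  \<comment> \<open>Half of the linear gain \<open>l / 4\<close> pays for the quadratic term, so that \<open>l / 8\<close> remains.\<close>
  define l where "l = 1 / (32 * exp 1 * t ^ 4)"
  have t0: "0 < t" using t by simp
  have l0: "0 < l" using t0 by (simp add: l_def)
  have e3: "exp (1::real) \<le> 3" by (rule exp_le)
  have e1: "1 \<le> exp (1::real)" by simp
  have t2: "1/4 \<le> t\<^sup>2" using power_mono[OF t, of 2] by (simp add: power2_eq_square)
  have "1 \<le> 16 * exp 1 * t\<^sup>2" using mult_mono[OF e1 t2] t2 by simp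
  then have "2 * t\<^sup>2 * 1 \<le> 2 * t\<^sup>2 * (16 * exp 1 * t\<^sup>2)" by (intro mult_left_mono) auto
  then have "1 / (32 * exp 1 * t ^ 4) \<le> 1 / (2 * t\<^sup>2)"
    using t0 by (intro divide_left_mono) (auto simp: power2_eq_square power4_eq_xxxx algebra_simps)
  then have lle: "\<bar>l\<bar> \<le> 1 / (2 * t\<^sup>2)" "\<bar>- l\<bar> \<le> 1 / (2 * t\<^sup>2)" using l0 by (auto simp: l_def)
  have e8: "4 * exp 1 * l\<^sup>2 * t ^ 4 = l / 8"
    using t0 by (simp add: l_def power2_eq_square field_simps)
  have l8: "l / 8 \<ge> 1 / (768 * t ^ 4)"
  proof -
    have "l / 8 = 1 / (256 * exp 1 * t ^ 4)" by (simp add: l_def)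
    also have "\<dots> \<ge> 1 / (768 * t ^ 4)" using t0 e3 by (intro divide_left_mono) auto
    finally show ?thesis .
  qed
  have tail: "emeasure ?M {d \<in> space ?M. \<sigma> * l * (?m * s) + l * ?m / 4 \<le> (\<Sum>i\<in>J. \<sigma> * l * (w (d i))\<^sup>2)}
      \<le> ennreal (exp (- ?m / (768 * t ^ 4)))" if \<sigma>: "\<sigma> = 1 \<or> \<sigma> = -1" for \<sigma>
  proof -
    have sq: "\<sigma>\<^sup>2 = 1" using \<sigma> by auto
    have "\<bar>\<sigma> * l\<bar> \<le> 1 / (2 * t\<^sup>2)" using \<sigma> lle by auto
    from square_mgf_bound[OF P w t0 sg s this]
    have mgf: "(\<integral>\<^sup>+z. ennreal (exp (\<sigma> * l * (w z)\<^sup>2)) \<partial>P) \<le> ennreal (exp (\<sigma> * l * s + l / 8))"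
      using e8 by (simp add: power_mult_distrib sq)
    have "emeasure ?M {d \<in> space ?M. \<sigma> * l * (?m * s) + l * ?m / 4 \<le> (\<Sum>i\<in>J. \<sigma> * l * (w (d i))\<^sup>2)}
      \<le> ennreal (exp (?m * (\<sigma> * l * s + l / 8) - (\<sigma> * l * (?m * s) + l * ?m / 4)))"
      by (rule chernoff_bound[OF P I J _ mgf]) measurable
    also have "?m * (\<sigma> * l * s + l / 8) - (\<sigma> * l * (?m * s) + l * ?m / 4) = - (?m * (l / 8))"
      by (simp add: algebra_simps)
    also have "ennreal (exp \<dots>) \<le> ennreal (exp (- ?m / (768 * t ^ 4)))"
      using mult_left_mono[OF l8, of ?m] by (intro ennreal_leI) simp
    finally show ?thesis .
  qed
  let ?A = "\<lambda>\<sigma>. {d \<in> space ?M. \<sigma> * l * (?m * s) + l * ?m / 4 \<le> (\<Sum>i\<in>J. \<sigma> * l * (w (d i))\<^sup>2)}"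
  have wi[measurable]: "(\<lambda>d. w (d i)) \<in> borel_measurable ?M" if "i \<in> J" for i
    using J that by (intro measurable_at_coordinate[OF w]) auto
  have "?A \<sigma> \<in> sets ?M" for \<sigma> by measurable
  note meas = this[of 1] this[of "-1"]
  have "emeasure ?M {d \<in> space ?M. ?m / 4 < \<bar>(\<Sum>i\<in>J. (w (d i))\<^sup>2) - ?m * s\<bar>} \<le> emeasure ?M (?A 1 \<union> ?A (-1))"
  proof (rule emeasure_mono)
    show "?A 1 \<union> ?A (-1) \<in> sets ?M" using meas by blast
    show "{d \<in> space ?M. ?m / 4 < \<bar>(\<Sum>i\<in>J. (w (d i))\<^sup>2) - ?m * s\<bar>} \<subseteq> ?A 1 \<union> ?A (-1)"
    proof
      fix d assume d: "d \<in> {d \<in> space ?M. ?m / 4 < \<bar>(\<Sum>i\<in>J. (w (d i))\<^sup>2) - ?m * s\<bar>}"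
      let ?Q = "\<Sum>i\<in>J. (w (d i))\<^sup>2"
      have pull: "(\<Sum>i\<in>J. \<sigma> * l * (w (d i))\<^sup>2) = \<sigma> * l * ?Q" for \<sigma> by (simp add: sum_distrib_left)
      have dM: "d \<in> space ?M" and "?m / 4 < \<bar>?Q - ?m * s\<bar>" using d by auto
      then consider "?m * s + ?m / 4 \<le> ?Q" | "- (?m * s) + ?m / 4 \<le> - ?Q" by linarith
      then show "d \<in> ?A 1 \<union> ?A (-1)"
      proof cases
        case 1
        then have "l * (?m * s + ?m / 4) \<le> l * ?Q" using l0 by (intro mult_left_mono) auto
        then have "d \<in> ?A 1" using dM pull[of 1] by (simp add: distrib_left)
        then show ?thesis ..
      next
        case 2
        then have "l * (- (?m * s) + ?m / 4) \<le> l * (- ?Q)" using l0 by (intro mult_left_mono) auto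
        then have "(-1) * l * (?m * s) + l * ?m / 4 \<le> (\<Sum>i\<in>J. (-1) * l * (w (d i))\<^sup>2)"
          unfolding pull by (simp add: algebra_simps)
        then show ?thesis using dM by blast
      qed
    qed
  qed
  also have "\<dots> \<le> emeasure ?M (?A 1) + emeasure ?M (?A (-1))"
    using meas by (rule emeasure_subadditive)
  also have "\<dots> \<le> ennreal (exp (- ?m / (768 * t ^ 4))) + ennreal (exp (- ?m / (768 * t ^ 4)))"
    by (intro add_mono tail) auto
  also have "\<dots> = ennreal (2 * exp (- ?m / (768 * t ^ 4)))" by (simp flip: ennreal_plus)
  finally show ?thesis .
qed

lemma linear_fit_measurable:
  assumes "sets P = sets (obs_space p)"
  shows "linear_fit p v \<in> borel_measurable P"
proof -
  have "(\<lambda>z. fst z j) \<in> borel_measurable (obs_space p)" if "j < p" for j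
    unfolding obs_space_def using that
    by (intro measurable_compose[OF measurable_fst measurable_component_singleton]) auto
  then have "linear_fit p v \<in> borel_measurable (obs_space p)"
    unfolding linear_fit_def[abs_def] by (intro borel_measurable_sum borel_measurable_times) auto
  then show ?thesis using measurable_cong_sets[OF assms refl] by blast
qed

lemma coordinate_measurable:
  assumes "sets P = sets (obs_space p)" "j < p"
  shows "(\<lambda>z. fst z j) \<in> borel_measurable P"
proof -
  have "(\<lambda>z. fst z j) \<in> borel_measurable (obs_space p)"
    unfolding obs_space_def using assms(2)
    by (intro measurable_compose[OF measurable_fst measurable_component_singleton]) auto
  then show ?thesis using measurable_cong_sets[OF assms(1) refl] by blast
qed

lemma snd_measurable:
  assumes "sets P = sets (obs_space p)"
  shows "snd \<in> borel_measurable P"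
proof -
  have "snd \<in> borel_measurable (obs_space p)" unfolding obs_space_def by measurable
  then show ?thesis using measurable_cong_sets[OF assms refl] by blast
qed

text \<open>Residuals on \<open>T\<close> of an estimator \<open>b\<close> fitted on \<open>S\<close>. On the event \<open>G\<close>, which depends on the data in
  \<open>S\<close> alone, so does \<open>b\<close>. Fubini therefore lets \<open>b\<close> be treated as a constant vector while the observations in
  \<open>T\<close> are integrated, and the residuals become independent sub-Gaussian variables.\<close>

theorem held_out_residual_tail:
  fixes b :: "('i \<Rightarrow> obs) \<Rightarrow> nat \<Rightarrow> real" and G :: "('i \<Rightarrow> obs) \<Rightarrow> bool"
  assumes P: "prob_space P" and setsP: "sets P = sets (obs_space p)"
    and fin: "finite S" "finite T" and disj: "S \<inter> T = {}"
  defines "M \<equiv> \<Pi>\<^sub>M i\<in>S \<union> T. P"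
  assumes G[measurable]: "{d \<in> space M. G d} \<in> sets M"
    and b[measurable]: "\<And>j. j < p \<Longrightarrow> (\<lambda>d. b d j) \<in> borel_measurable M"
    and G_local: "\<And>d d'. d \<in> space M \<Longrightarrow> d' \<in> space M \<Longrightarrow> (\<And>i. i \<in> S \<Longrightarrow> d i = d' i) \<Longrightarrow> G d \<Longrightarrow> G d'"
    and b_local: "\<And>d d' j. d \<in> space M \<Longrightarrow> d' \<in> space M \<Longrightarrow> (\<And>i. i \<in> S \<Longrightarrow> d i = d' i) \<Longrightarrow> G d \<Longrightarrow>
        j < p \<Longrightarrow> b d j = b d' j"
    and sg: "\<And>d. d \<in> space M \<Longrightarrow> G d \<Longrightarrow>
       (\<integral>\<^sup>+z. ennreal (exp ((snd z - linear_fit p (b d) z)\<^sup>2 / \<tau>)) \<partial>P) \<le> ennreal (exp 1)"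
    and \<tau>: "0 < \<tau>"
  shows "{d \<in> space M. G d \<and> \<delta> < (\<Sum>i\<in>T. (snd (d i) - linear_fit p (b d) (d i))\<^sup>2)} \<in> sets M"
    "emeasure M {d \<in> space M. G d \<and> \<delta> < (\<Sum>i\<in>T. (snd (d i) - linear_fit p (b d) (d i))\<^sup>2)}
       \<le> ennreal (exp (real (card T) - \<delta> / \<tau>))"
proof -
  interpret P: prob_space P by (rule P)
  interpret product_sigma_finite "\<lambda>_. P" by standard
  let ?F = "{d \<in> space M. G d \<and> \<delta> < (\<Sum>i\<in>T. (snd (d i) - linear_fit p (b d) (d i))\<^sup>2)}"
  have x[measurable]: "(\<lambda>d. fst (d i) j) \<in> borel_measurable M" if "i \<in> T" "j < p" for i j
    unfolding M_def using that
    by (intro measurable_at_coordinate coordinate_measurable[OF setsP]) auto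
  have y[measurable]: "(\<lambda>d. snd (d i)) \<in> borel_measurable M" if "i \<in> T" for i
    unfolding M_def using that
    by (intro measurable_at_coordinate snd_measurable[OF setsP]) auto
  have lf[measurable]: "(\<lambda>d. linear_fit p (b d) (d i)) \<in> borel_measurable M" if "i \<in> T" for i
    unfolding linear_fit_def using that by measurable
  have "{d \<in> space M. \<delta> < (\<Sum>i\<in>T. (snd (d i) - linear_fit p (b d) (d i))\<^sup>2)} \<in> sets M" by measurable
  from sets.Int[OF G this] show F: "?F \<in> sets M"
    by (rule back_subst[where P = "\<lambda>X. X \<in> sets M"]) auto
  let ?S = "\<Pi>\<^sub>M i\<in>S. P" and ?T = "\<Pi>\<^sub>M i\<in>T. P"
  let ?c = "ennreal (exp (real (card T) - \<delta> / \<tau>))"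
  have "emeasure M ?F = (\<integral>\<^sup>+d. indicator ?F d \<partial>M)" using F by simp
  also have "\<dots> = (\<integral>\<^sup>+x. (\<integral>\<^sup>+y. indicator ?F (merge S T (x, y)) \<partial>?T) \<partial>?S)"
    unfolding M_def using F by (intro product_nn_integral_fold disj fin) (simp add: M_def)
  also have "\<dots> \<le> (\<integral>\<^sup>+x. ?c \<partial>?S)"
  proof (rule nn_integral_mono)
    \<comment> \<open>If no completion of \<open>x\<close> lies in \<open>G\<close>, the inner integral is 0; otherwise all do, with one common \<open>b\<close>.\<close>
    fix x assume x: "x \<in> space ?S"
    have mg: "merge S T (x, y) \<in> space M" if "y \<in> space ?T" for y
    proof -
      have "(x, y) \<in> space (?S \<Otimes>\<^sub>M ?T)" using x that by (simp add: space_pair_measure)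
      then show ?thesis unfolding M_def by (rule measurable_space[OF measurable_merge])
    qed
    have mS: "merge S T (x, y) i = x i" if "i \<in> S" for y i using that by (simp add: merge_def)
    have mT: "merge S T (x, y) i = y i" if "i \<in> T" for y i using that disj by (auto simp: merge_def)
    show "(\<integral>\<^sup>+y. indicator ?F (merge S T (x, y)) \<partial>?T) \<le> ?c"
    proof (cases "\<exists>y\<in>space ?T. G (merge S T (x, y))")
      case False
      then have "(\<integral>\<^sup>+y. indicator ?F (merge S T (x, y)) \<partial>?T) = (\<integral>\<^sup>+y. 0 \<partial>?T)"
        by (intro nn_integral_cong) (auto split: split_indicator)
      then show ?thesis by simp
    next
      case True
      then obtain y0 where y0: "y0 \<in> space ?T" "G (merge S T (x, y0))" by blast
      define v where "v = b (merge S T (x, y0))"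
      let ?f = "\<lambda>z. (snd z - linear_fit p v z)\<^sup>2 / \<tau>"
      have fm[measurable]: "?f \<in> borel_measurable P"
        using linear_fit_measurable[OF setsP, of v] snd_measurable[OF setsP] by measurable
      have bv: "linear_fit p (b (merge S T (x, y))) z = linear_fit p v z" if "y \<in> space ?T" for y z
        unfolding linear_fit_def v_def
        by (intro sum.cong refl arg_cong2[where f = "(*)"] b_local[symmetric])
          (use mg that y0 mS in auto)
      have "(\<integral>\<^sup>+y. indicator ?F (merge S T (x, y)) \<partial>?T)
         \<le> (\<integral>\<^sup>+y. indicator {y \<in> space ?T. \<delta> / \<tau> \<le> (\<Sum>i\<in>T. ?f (y i))} y \<partial>?T)"
        using \<tau> by (intro nn_integral_mono)
          (auto split: split_indicator simp: mT bv divide_right_mono simp flip: sum_divide_distrib)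
      also have "\<dots> = emeasure ?T {y \<in> space ?T. \<delta> / \<tau> \<le> (\<Sum>i\<in>T. ?f (y i))}"
      proof (rule nn_integral_indicator)
        have [measurable]: "(\<lambda>y. ?f (y i)) \<in> borel_measurable ?T" if "i \<in> T" for i
          using that by (intro measurable_at_coordinate[OF fm]) auto
        show "{y \<in> space ?T. \<delta> / \<tau> \<le> (\<Sum>i\<in>T. ?f (y i))} \<in> sets ?T" by measurable
      qed
      also have "\<dots> \<le> ennreal (exp (real (card T) * 1 - \<delta> / \<tau>))"
        by (rule chernoff_bound[OF P fin(2) subset_refl fm]) (use sg[OF mg[OF y0(1)] y0(2)] in \<open>simp add: v_def\<close>)
      finally show ?thesis by simp
    qed
  qed
  also have "\<dots> = ?c"
  proof -
    interpret PS: prob_space ?S by (intro prob_space_PiM P)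
    show ?thesis by (simp add: PS.emeasure_space_1)
  qed
  finally show "emeasure M ?F \<le> ?c" .
qed

section \<open>The fixed-sample bound\<close>

text \<open>The defining infimum need not be attained a priori, so the moment bound is read off at any \<open>t\<close> strictly
  above the norm.\<close>

lemma psi2_norm_less_imp_exp_moment:
  assumes less: "psi2_norm M Z < ennreal t"
  shows "(\<integral>\<^sup>+\<omega>. ennreal (exp ((Z \<omega>)\<^sup>2 / t\<^sup>2)) \<partial>M) \<le> ennreal (exp 1)"
proof -
  obtain t' where t': "0 < t'" "ennreal t' < ennreal t"
    "(\<integral>\<^sup>+\<omega>. ennreal (exp ((Z \<omega>)\<^sup>2 / t'\<^sup>2)) \<partial>M) \<le> ennreal (exp 1)"
    using less unfolding psi2_norm_def Inf_less_iff by blast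
  then have "t' < t" by (simp add: ennreal_less_iff)
  then have "t'\<^sup>2 \<le> t\<^sup>2" using t' by (intro power_mono) auto
  then have "(Z \<omega>)\<^sup>2 / t\<^sup>2 \<le> (Z \<omega>)\<^sup>2 / t'\<^sup>2" for \<omega>
    using t' \<open>t' < t\<close> by (intro divide_left_mono) auto
  then have "(\<integral>\<^sup>+\<omega>. ennreal (exp ((Z \<omega>)\<^sup>2 / t\<^sup>2)) \<partial>M) \<le> (\<integral>\<^sup>+\<omega>. ennreal (exp ((Z \<omega>)\<^sup>2 / t'\<^sup>2)) \<partial>M)"
    by (intro nn_integral_mono ennreal_leI) simp
  then show ?thesis using t'(3) by (rule order_trans)
qed

lemma psi2_norm_vec_less_imp_exp_moment:
  assumes M: "prob_space M" and Z: "\<And>\<omega>. Z \<omega> \<in> carrier_vec p"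
    and less: "psi2_norm_vec p M Z < ennreal t" and v: "v \<in> carrier_vec p" "vnorm v \<le> 1"
  shows "(\<integral>\<^sup>+\<omega>. ennreal (exp ((v \<bullet> Z \<omega>)\<^sup>2 / t\<^sup>2)) \<partial>M) \<le> ennreal (exp 1)"
proof (cases "v = 0\<^sub>v p")
  case True
  interpret prob_space M by (rule M)
  have "(\<integral>\<^sup>+\<omega>. ennreal (exp ((v \<bullet> Z \<omega>)\<^sup>2 / t\<^sup>2)) \<partial>M) = (\<integral>\<^sup>+\<omega>. 1 \<partial>M)"
    using True Z by (intro nn_integral_cong) simp
  also have "\<dots> = ennreal 1" by (simp add: emeasure_space_1)
  also have "\<dots> \<le> ennreal (exp 1)" by (rule ennreal_leI) simp
  finally show ?thesis .
next
  case False
  then have pos: "0 < v \<bullet> v" using scalar_prod_self_pos_iff[OF v(1)] by simp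
  define u where "u = (1 / vnorm v) \<cdot>\<^sub>v v"
  have nv: "0 < vnorm v" using pos by (simp add: vnorm_def)
  have u: "u \<in> carrier_vec p" using v by (simp add: u_def)
  have "vnorm u = 1" using v nv pos by (simp add: u_def vnorm_def real_sqrt_divide)
  then have "psi2_norm M (\<lambda>\<omega>. u \<bullet> Z \<omega>) \<le> psi2_norm_vec p M Z"
    unfolding psi2_norm_vec_def using u by (intro SUP_upper) auto
  then have "psi2_norm M (\<lambda>\<omega>. u \<bullet> Z \<omega>) < ennreal t" using less by (rule le_less_trans)
  then have m: "(\<integral>\<^sup>+\<omega>. ennreal (exp ((u \<bullet> Z \<omega>)\<^sup>2 / t\<^sup>2)) \<partial>M) \<le> ennreal (exp 1)"
    by (rule psi2_norm_less_imp_exp_moment)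
  have "(v \<bullet> Z \<omega>)\<^sup>2 / t\<^sup>2 \<le> (u \<bullet> Z \<omega>)\<^sup>2 / t\<^sup>2" for \<omega>
  proof -
    have "v \<bullet> Z \<omega> = vnorm v * (u \<bullet> Z \<omega>)" using nv v Z[of \<omega>] by (simp add: u_def)
    then have "(v \<bullet> Z \<omega>)\<^sup>2 = (vnorm v)\<^sup>2 * (u \<bullet> Z \<omega>)\<^sup>2" by (simp add: power_mult_distrib)
    also have "\<dots> \<le> 1 * (u \<bullet> Z \<omega>)\<^sup>2" using v nv by (intro mult_right_mono) (auto simp: abs_square_le_1)
    finally show ?thesis by (simp add: divide_right_mono)
  qed
  then have "(\<integral>\<^sup>+\<omega>. ennreal (exp ((v \<bullet> Z \<omega>)\<^sup>2 / t\<^sup>2)) \<partial>M) \<le> (\<integral>\<^sup>+\<omega>. ennreal (exp ((u \<bullet> Z \<omega>)\<^sup>2 / t\<^sup>2)) \<partial>M)"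
    by (intro nn_integral_mono ennreal_leI) simp
  then show ?thesis using m by (rule order_trans)
qed

definition apply_mat :: "nat \<Rightarrow> (nat \<Rightarrow> nat \<Rightarrow> real) \<Rightarrow> (nat \<Rightarrow> real) \<Rightarrow> nat \<Rightarrow> real" where
  "apply_mat p W v j = (\<Sum>l<p. W j l * v l)"

lemma apply_mat_scale: "apply_mat p W (\<lambda>j. c * v j) = (\<lambda>j. c * apply_mat p W v j)"
  by (intro ext) (simp add: apply_mat_def sum_distrib_left mult_ac)

lemma linear_fit_scale: "linear_fit p (\<lambda>j. c * v j) z = c * linear_fit p v z"
  by (simp add: linear_fit_def sum_distrib_left mult_ac)

lemma linear_fit_cong: "(\<And>j. j < p \<Longrightarrow> v j = v' j) \<Longrightarrow> linear_fit p v z = linear_fit p v' z"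
  by (simp add: linear_fit_def)

text \<open>The rows with indices in \<open>S\<close>, transformed by \<open>W\<^sup>T\<close>, have almost isotropic empirical second moments
  in the finitely many directions of \<open>N\<close>. Testing only net points makes this a measurable event that a union
  bound can handle.\<close>

definition near_isotropic ::
  "(nat \<Rightarrow> real) set \<Rightarrow> nat \<Rightarrow> (nat \<Rightarrow> nat \<Rightarrow> real) \<Rightarrow> 'i set \<Rightarrow> ('i \<Rightarrow> obs) \<Rightarrow> bool" where
  "near_isotropic N p W S d \<longleftrightarrow> (\<forall>u\<in>N. \<not> real (card S) / 4 <
     \<bar>(\<Sum>i\<in>S. (linear_fit p (apply_mat p W u) (d i))\<^sup>2) - real (card S) * (\<Sum>j<p. (u j)\<^sup>2)\<bar>)"

lemma near_isotropic_cong: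
  "(\<And>i. i \<in> S \<Longrightarrow> d i = d' i) \<Longrightarrow> near_isotropic N p W S d \<longleftrightarrow> near_isotropic N p W S d'"
  by (simp add: near_isotropic_def)

text \<open>From the net to all directions: the smallest singular value of the whitened rows is at least
  \<open>sqrt (card S / 2)\<close>.\<close>

theorem near_isotropic_lower_bound:
  assumes N1: "\<And>u. u \<in> N \<Longrightarrow> (\<Sum>j<p. (u j)\<^sup>2) \<le> 1"
    and N2: "\<And>v. (\<Sum>j<p. (v j)\<^sup>2) \<le> 1 \<Longrightarrow> \<exists>u\<in>N. (\<Sum>j<p. (v j - u j)\<^sup>2) \<le> 1/16"
    and ni: "near_isotropic N p W S d"
  shows "real (card S) / 2 * (\<Sum>j<p. (v j)\<^sup>2) \<le> (\<Sum>i\<in>S. (linear_fit p (apply_mat p W v) (d i))\<^sup>2)"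
proof -
  define a where "a i l = (\<Sum>j<p. fst (d i) j * W j l)" for i l
  have al: "(\<Sum>l<p. a i l * v l) = linear_fit p (apply_mat p W v) (d i)" for i v
  proof -
    have "(\<Sum>l<p. a i l * v l) = (\<Sum>l<p. \<Sum>j<p. fst (d i) j * W j l * v l)"
      by (simp add: a_def sum_distrib_right)
    also have "\<dots> = (\<Sum>j<p. \<Sum>l<p. fst (d i) j * W j l * v l)" by (rule sum.swap)
    finally show ?thesis by (simp add: linear_fit_def apply_mat_def sum_distrib_left mult.assoc)
  qed
  have "\<bar>quad_dev p S a (real (card S)) v\<bar> \<le> 2 * (real (card S) / 4) * (\<Sum>j<p. (v j)\<^sup>2)"
    by (rule quad_dev_net[OF N1 N2]) (use ni in \<open>auto simp: near_isotropic_def quad_dev_def al\<close>)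
  from abs_le_D2[OF this] show ?thesis unfolding quad_dev_def al by (simp add: algebra_simps)
qed

lemma near_isotropic_tail:
  assumes P: "prob_space P" and setsP: "sets P = sets (obs_space p)" and I: "finite I" and S: "S \<subseteq> I"
    and N: "finite N" "\<And>u. u \<in> N \<Longrightarrow> (\<Sum>j<p. (u j)\<^sup>2) \<le> 1" and t: "1/2 \<le> t"
    and sg: "\<And>v. (\<Sum>j<p. (v j)\<^sup>2) \<le> 1 \<Longrightarrow>
       (\<integral>\<^sup>+z. ennreal (exp ((linear_fit p (apply_mat p W v) z)\<^sup>2 / t\<^sup>2)) \<partial>P) \<le> ennreal (exp 1)"
    and iso: "\<And>v. (\<integral>z. (linear_fit p (apply_mat p W v) z)\<^sup>2 \<partial>P) = (\<Sum>j<p. (v j)\<^sup>2)"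
  shows "{d \<in> space (\<Pi>\<^sub>M i\<in>I. P). \<not> near_isotropic N p W S d} \<in> sets (\<Pi>\<^sub>M i\<in>I. P)"
    "emeasure (\<Pi>\<^sub>M i\<in>I. P) {d \<in> space (\<Pi>\<^sub>M i\<in>I. P). \<not> near_isotropic N p W S d}
      \<le> ennreal (real (card N) * (2 * exp (- real (card S) / (768 * t ^ 4))))"
proof -
  let ?M = "\<Pi>\<^sub>M i\<in>I. P"
  let ?A = "\<lambda>u. {d \<in> space ?M. real (card S) / 4 <
     \<bar>(\<Sum>i\<in>S. (linear_fit p (apply_mat p W u) (d i))\<^sup>2) - real (card S) * (\<Sum>j<p. (u j)\<^sup>2)\<bar>}"
  have [measurable]: "(\<lambda>d. linear_fit p v (d i)) \<in> borel_measurable ?M" if "i \<in> S" for i v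
    using S that by (intro measurable_at_coordinate linear_fit_measurable[OF setsP]) auto
  have A: "?A u \<in> sets ?M" for u by measurable
  have eq: "{d \<in> space ?M. \<not> near_isotropic N p W S d} = (\<Union>u\<in>N. ?A u)"
    by (auto simp: near_isotropic_def)
  show "{d \<in> space ?M. \<not> near_isotropic N p W S d} \<in> sets ?M"
    unfolding eq using A N(1) by blast
  have "emeasure ?M (\<Union>u\<in>N. ?A u) \<le> (\<Sum>u\<in>N. emeasure ?M (?A u))"
    using A N(1) by (intro emeasure_subadditive_finite) auto
  also have "\<dots> \<le> (\<Sum>u\<in>N. ennreal (2 * exp (- real (card S) / (768 * t ^ 4))))"
    by (intro sum_mono bernstein_square[OF P I S linear_fit_measurable[OF setsP] t sg iso] N(2))
  also have "\<dots> = ennreal (real (card N) * (2 * exp (- real (card S) / (768 * t ^ 4))))"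
    by (simp add: ennreal_mult ennreal_of_nat_eq_real_of_nat)
  finally show "emeasure ?M {d \<in> space ?M. \<not> near_isotropic N p W S d}
      \<le> ennreal (real (card N) * (2 * exp (- real (card S) / (768 * t ^ 4))))" unfolding eq .
qed

text \<open>Convexity of the exponential; gives exponential moments for the square of a difference of two
  sub-Gaussian variables that may depend on each other.\<close>

lemma exp_moment_average:
  assumes [measurable]: "f \<in> borel_measurable P" "g \<in> borel_measurable P"
    and le: "\<And>z. h z \<le> (f z + g z) / 2"
    and f: "(\<integral>\<^sup>+z. ennreal (exp (f z)) \<partial>P) \<le> ennreal c"
    and g: "(\<integral>\<^sup>+z. ennreal (exp (g z)) \<partial>P) \<le> ennreal c"
  shows "(\<integral>\<^sup>+z. ennreal (exp (h z)) \<partial>P) \<le> ennreal c"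
proof -
  have pt: "exp (h z) \<le> 1/2 * exp (f z) + 1/2 * exp (g z)" for z
  proof -
    have "exp (h z) \<le> exp (f z / 2) * exp (g z / 2)" using le[of z] by (simp flip: exp_add)
    also have "\<dots> \<le> ((exp (f z / 2))\<^sup>2 + (exp (g z / 2))\<^sup>2) / 2"
      using sum_squares_bound[of "exp (f z / 2)" "exp (g z / 2)"] by simp
    finally show ?thesis by (simp add: power2_eq_square flip: exp_add)
  qed
  have "(\<integral>\<^sup>+z. ennreal (exp (h z)) \<partial>P) \<le> (\<integral>\<^sup>+z. ennreal (1/2) * ennreal (exp (f z)) + ennreal (1/2) * ennreal (exp (g z)) \<partial>P)"
  proof (rule nn_integral_mono)
    fix z
    have "ennreal (exp (h z)) \<le> ennreal (1/2 * exp (f z) + 1/2 * exp (g z))" by (rule ennreal_leI[OF pt])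
    also have "\<dots> = ennreal (1/2 * exp (f z)) + ennreal (1/2 * exp (g z))" by (rule ennreal_plus) auto
    also have "ennreal (1/2 * exp (f z)) = ennreal (1/2) * ennreal (exp (f z))" by (rule ennreal_mult) auto
    also have "ennreal (1/2 * exp (g z)) = ennreal (1/2) * ennreal (exp (g z))" by (rule ennreal_mult) auto
    finally show "ennreal (exp (h z)) \<le> ennreal (1/2) * ennreal (exp (f z)) + ennreal (1/2) * ennreal (exp (g z))" .
  qed
  also have "\<dots> = ennreal (1/2) * (\<integral>\<^sup>+z. ennreal (exp (f z)) \<partial>P) + ennreal (1/2) * (\<integral>\<^sup>+z. ennreal (exp (g z)) \<partial>P)"
    by (subst nn_integral_add) (auto simp: nn_integral_cmult)
  also have "\<dots> \<le> ennreal (1/2) * ennreal c + ennreal (1/2) * ennreal c"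
    by (intro add_mono mult_left_mono f g) auto
  also have "\<dots> = (ennreal (1/2) + ennreal (1/2)) * ennreal c" by (simp add: distrib_right)
  also have "ennreal (1/2) + ennreal (1/2) = ennreal (1/2 + 1/2)" by (rule ennreal_plus[symmetric]) auto
  finally show ?thesis by simp
qed

lemma restrict_design_cong:
  assumes S: "S \<subseteq> {..<n}" and eq: "\<And>i. i \<in> S \<Longrightarrow> d i = d' i"
  shows "restrict_rows (design n p d) S = restrict_rows (design n p d') S"
    "restrict_vec (response n d) S = restrict_vec (response n d') S"
proof -
  have S': "{i. i < n \<and> i \<in> S} = S" using S by auto
  have pk: "pick S i \<in> S" "pick S i < n" if "i < card S" for i using pick_in_set[of i S] that S by auto
  show "restrict_rows (design n p d) S = restrict_rows (design n p d') S"
    by (rule eq_matI) (use pk eq in \<open>auto simp: restrict_rows_def submatrix_def design_def S' pick_UNIV covar_def\<close>)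
  show "restrict_vec (response n d) S = restrict_vec (response n d') S"
    by (rule eq_vecI) (use pk eq in \<open>auto simp: restrict_vec_def response_def S'\<close>)
qed

text \<open>The bound for a fixed sample size, with the covariates whitened by a matrix \<open>W\<close>. The three kinds of bad
  events are: some set \<open>S\<close> is not nearly isotropic (\<open>E1\<close>), the responses are too large in total (\<open>E2\<close>), and
  the residuals on the removed observations are too large (\<open>E3\<close>). Off \<open>E1\<close> and \<open>E2\<close> the whitened
  coefficients of the estimator on \<open>S\<close> are bounded by a multiple of \<open>ty\<close>, which makes the residuals in \<open>E3\<close>
  sub-Gaussian with a norm that does not grow with \<open>n\<close>.\<close>

theorem ols_removal_tail:
  fixes W :: "nat \<Rightarrow> nat \<Rightarrow> real" and \<beta>S :: "nat set \<Rightarrow> (nat \<Rightarrow> obs) \<Rightarrow> rvec"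
  assumes P: "prob_space P" and setsP: "sets P = sets (obs_space p)" and n: "0 < n"
    and t: "1/2 \<le> t" and ty: "0 < ty" and B: "0 < B" and eps: "0 < \<epsilon>" and k: "2 * k \<le> n"
    and sgx: "\<And>v. (\<Sum>j<p. (v j)\<^sup>2) \<le> 1 \<Longrightarrow>
       (\<integral>\<^sup>+z. ennreal (exp ((linear_fit p (apply_mat p W v) z)\<^sup>2 / t\<^sup>2)) \<partial>P) \<le> ennreal (exp 1)"
    and iso: "\<And>v. (\<integral>z. (linear_fit p (apply_mat p W v) z)\<^sup>2 \<partial>P) = (\<Sum>j<p. (v j)\<^sup>2)"
    and sgy: "(\<integral>\<^sup>+z. ennreal (exp ((snd z)\<^sup>2 / ty\<^sup>2)) \<partial>P) \<le> ennreal (exp 1)"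
    and surj: "\<And>v. \<exists>b. \<forall>j<p. v j = apply_mat p W b j"
    and bound: "\<And>b. (\<Sum>j<p. (apply_mat p W b j)\<^sup>2) \<le> B\<^sup>2 * (\<Sum>j<p. (b j)\<^sup>2)"
    and est: "is_ols_estimator (sample_space n P) p (design n p) (response n) \<beta>"
    and estS: "\<And>S. S \<subseteq> {..<n} \<Longrightarrow> is_ols_estimator (sample_space n P) p
        (\<lambda>d. restrict_rows (design n p d) S) (\<lambda>d. restrict_vec (response n d) S) (\<beta>S S)"
  defines "\<S> \<equiv> {S. S \<subseteq> {..<n} \<and> n \<le> card S + k}"
  shows "measure (sample_space n P)
      {d \<in> space (sample_space n P). \<bar>Max ((\<lambda>S. vnorm (\<beta> d - \<beta>S S d)) ` \<S>) - 0\<bar> > \<epsilon>}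
    \<le> real (card \<S>) * (2 * exp (18 * real p - real n / (1536 * t ^ 4))
        + exp (real k - \<epsilon>\<^sup>2 * real n / (8 * B\<^sup>2 * ty\<^sup>2 * (1 + 8 * t\<^sup>2)))) + exp (- real n)"
proof -
  define M where "M = sample_space n P"
  have M: "M = (\<Pi>\<^sub>M i\<in>{..<n}. P)" by (simp add: M_def sample_space_def)
  interpret M: prob_space M unfolding M by (intro prob_space_PiM P)
  have t0: "0 < t" using t by simp
  \<comment> \<open>\<open>(n / 2) |a|\<^sup>2 \<le> \<delta>\<close> for the whitened difference \<open>a\<close> yields \<open>B\<^sup>2 |a|\<^sup>2 \<le> \<epsilon>\<^sup>2\<close>.\<close>
  define \<delta> where "\<delta> = \<epsilon>\<^sup>2 * real n / (2 * B\<^sup>2)"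
  define \<tau> where "\<tau> = 4 * ty\<^sup>2 * (1 + 8 * t\<^sup>2)"
  have pos8: "0 < 1 + 8 * t\<^sup>2" using zero_le_power2[of t] by linarith
  have \<tau>: "0 < \<tau>" using ty pos8 by (simp add: \<tau>_def)
  obtain N :: "(nat \<Rightarrow> real) set" where N: "finite N" "real (card N) \<le> exp (18 * real p)"
    "\<And>u. u \<in> N \<Longrightarrow> (\<Sum>j<p. (u j)\<^sup>2) \<le> 1"
    "\<And>v. (\<Sum>j<p. (v j)\<^sup>2) \<le> 1 \<Longrightarrow> \<exists>u\<in>N. (\<Sum>j<p. (v j - u j)\<^sup>2) \<le> 1/16"
    using unit_ball_net_exists[of p] by blast
  let ?ni = "near_isotropic N p W :: nat set \<Rightarrow> _"
  have finS: "finite \<S>" unfolding \<S>_def by simp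
  have full: "{..<n} \<in> \<S>" by (simp add: \<S>_def)
  have SD: "S \<subseteq> {..<n}" "finite S" "real n / 2 \<le> real (card S)" if "S \<in> \<S>" for S
    using that k unfolding \<S>_def by (auto intro: finite_subset)
  define E1 where "E1 S = {d \<in> space M. \<not> ?ni S d}" for S
  define E2 where "E2 = {d \<in> space M. 2 * real n \<le> (\<Sum>i<n. (snd (d i))\<^sup>2 / ty\<^sup>2)}"
  define G where "G S d \<longleftrightarrow> ?ni S d \<and> (\<Sum>i\<in>S. (snd (d i))\<^sup>2 / ty\<^sup>2) \<le> 2 * real n" for S d
  define b where "b S d j = \<beta>S S d $ j" for S d j
  define E3 where "E3 S = {d \<in> space M. G S d \<and>
    \<delta> < (\<Sum>i\<in>{..<n} - S. (snd (d i) - linear_fit p (b S d) (d i))\<^sup>2)}" for S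
  have [measurable]: "snd \<in> borel_measurable P" "\<And>v. linear_fit p v \<in> borel_measurable P"
    using snd_measurable[OF setsP] linear_fit_measurable[OF setsP] by auto
  have ym[measurable]: "(\<lambda>d. snd (d i)) \<in> borel_measurable M" if "i < n" for i
    unfolding M using that by (intro measurable_at_coordinate snd_measurable[OF setsP]) auto
  have E1: "E1 S \<in> sets M" "emeasure M (E1 S) \<le> ennreal (2 * exp (18 * real p - real n / (1536 * t ^ 4)))"
    if S: "S \<in> \<S>" for S
  proof -
    note nt = near_isotropic_tail[OF P setsP finite_lessThan SD(1)[OF S] N(1,3) t sgx iso, folded M]
    show "E1 S \<in> sets M" using nt(1) by (simp add: E1_def)
    have "emeasure M (E1 S) \<le> ennreal (real (card N) * (2 * exp (- real (card S) / (768 * t ^ 4))))"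
      using nt(2) by (simp add: E1_def)
    also have "\<dots> \<le> ennreal (exp (18 * real p) * (2 * exp (- real n / (1536 * t ^ 4))))"
    proof (rule ennreal_leI, rule mult_mono[OF N(2)])
      have "real n / 2 / (768 * t ^ 4) \<le> real (card S) / (768 * t ^ 4)"
        using SD(3)[OF S] t0 by (intro divide_right_mono) auto
      then show "2 * exp (- real (card S) / (768 * t ^ 4)) \<le> 2 * exp (- real n / (1536 * t ^ 4))" by simp
    qed auto
    also have "exp (18 * real p) * (2 * exp (- real n / (1536 * t ^ 4))) = 2 * exp (18 * real p - real n / (1536 * t ^ 4))"
      using exp_add[of "18 * real p" "- real n / (1536 * t ^ 4)"] by simp
    finally show "emeasure M (E1 S) \<le> ennreal (2 * exp (18 * real p - real n / (1536 * t ^ 4)))" .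
  qed
  have E2: "E2 \<in> sets M" "emeasure M E2 \<le> ennreal (exp (- real n))"
  proof -
    show "E2 \<in> sets M" unfolding E2_def by measurable
    have "emeasure M E2 \<le> ennreal (exp (real (card {..<n}) * 1 - 2 * real n))"
      unfolding E2_def M by (rule chernoff_bound[OF P finite_lessThan subset_refl _ sgy]) measurable
    then show "emeasure M E2 \<le> ennreal (exp (- real n))" by simp
  qed
  have inj: "\<forall>j<p. v j = 0"
    if ni: "?ni S d" and S: "S \<in> \<S>" and z: "\<And>i. i \<in> S \<Longrightarrow> linear_fit p v (d i) = 0" for S d v
  proof -
    obtain a where a: "\<And>j. j < p \<Longrightarrow> v j = apply_mat p W a j" using surj[of v] by blast
    have "real (card S) / 2 * (\<Sum>j<p. (a j)\<^sup>2) \<le> (\<Sum>i\<in>S. (linear_fit p (apply_mat p W a) (d i))\<^sup>2)"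
      by (rule near_isotropic_lower_bound[OF N(3,4) ni])
    also have "\<dots> = 0" using z linear_fit_cong[of p "apply_mat p W a" v] a by simp
    finally have "real (card S) / 2 * (\<Sum>j<p. (a j)\<^sup>2) \<le> 0" .
    moreover have "0 < real (card S) / 2" using SD(3)[OF S] n by simp
    ultimately have "(\<Sum>j<p. (a j)\<^sup>2) \<le> 0" by (simp add: mult_le_0_iff)
    then have "(\<Sum>j<p. (a j)\<^sup>2) = 0" using sum_nonneg[of "{..<p}" "\<lambda>j. (a j)\<^sup>2"] by simp
    then have "(\<Sum>j<p. (apply_mat p W a j)\<^sup>2) \<le> 0" using bound[of a] by simp
    then have "(\<Sum>j<p. (apply_mat p W a j)\<^sup>2) = 0"
      using sum_nonneg[of "{..<p}" "\<lambda>j. (apply_mat p W a j)\<^sup>2"] by simp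
    then show ?thesis using a by (simp add: sum_nonneg_eq_0_iff)
  qed
  have ols_S: "\<beta>S S d = ols (restrict_rows (design n p d) S) (restrict_vec (response n d) S)"
    "\<And>u. (\<Sum>i\<in>S. linear_fit p u (d i) * linear_fit p (b S d) (d i)) = (\<Sum>i\<in>S. linear_fit p u (d i) * snd (d i))"
    if ni: "?ni S d" and S: "S \<in> \<S>" and d: "d \<in> space M" for S d
  proof -
    note orth = ols_restrict[OF SD(1)[OF S] inj[OF ni S]]
    show *: "\<beta>S S d = ols (restrict_rows (design n p d) S) (restrict_vec (response n d) S)"
      using estS[OF SD(1)[OF S]] orth(1) d unfolding is_ols_estimator_def M_def by blast
    show "(\<Sum>i\<in>S. linear_fit p u (d i) * linear_fit p (b S d) (d i)) = (\<Sum>i\<in>S. linear_fit p u (d i) * snd (d i))" for u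
      unfolding b_def[abs_def] * by (rule orth(2))
  qed
  have ols_full: "(\<Sum>i<n. linear_fit p u (d i) * linear_fit p (($) (\<beta> d)) (d i)) = (\<Sum>i<n. linear_fit p u (d i) * snd (d i))"
    if ni: "?ni {..<n} d" and d: "d \<in> space M" for d u
  proof -
    have i: "\<forall>j<p. v j = 0" if "\<And>i. i < n \<Longrightarrow> linear_fit p v (d i) = 0" for v
      using inj[OF ni full] that by auto
    note orth = ols_design[OF i]
    have *: "\<beta> d = ols (design n p d) (response n d)"
      using est orth(1) d unfolding is_ols_estimator_def M_def by blast
    show ?thesis unfolding * by (rule orth(2))
  qed
  have E3: "E3 S \<in> sets M" "emeasure M (E3 S) \<le> ennreal (exp (real k - \<epsilon>\<^sup>2 * real n / (8 * B\<^sup>2 * ty\<^sup>2 * (1 + 8 * t\<^sup>2))))"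
    if S: "S \<in> \<S>" for S
  proof -
    let ?T = "{..<n} - S"
    have un: "S \<union> ?T = {..<n}" using SD(1)[OF S] by auto
    have eq: "(\<Pi>\<^sub>M i\<in>S \<union> ?T. P) = M" unfolding un M ..
    have Gm: "{d \<in> space M. G S d} \<in> sets M"
    proof -
      have [measurable]: "(\<lambda>d. snd (d i)) \<in> borel_measurable M" if "i \<in> S" for i
        using ym that SD(1)[OF S] by auto
      have "{d \<in> space M. (\<Sum>i\<in>S. (snd (d i))\<^sup>2 / ty\<^sup>2) \<le> 2 * real n} \<in> sets M" by measurable
      from sets.Diff[OF this E1(1)[OF S]] show ?thesis
        by (rule back_subst[where P = "\<lambda>X. X \<in> sets M"]) (auto simp: E1_def G_def)
    qed
    have bm: "(\<lambda>d. b S d j) \<in> borel_measurable M" if "j < p" for j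
      using estS[OF SD(1)[OF S]] that unfolding is_ols_estimator_def M_def b_def by blast
    have Gl: "G S d'" if "d \<in> space M" "d' \<in> space M" "\<And>i. i \<in> S \<Longrightarrow> d i = d' i" "G S d" for d d'
      using that near_isotropic_cong[of S d d' N p W] by (simp add: G_def)
    have bl: "b S d j = b S d' j" if d: "d \<in> space M" "d' \<in> space M" "\<And>i. i \<in> S \<Longrightarrow> d i = d' i" "G S d" "j < p" for d d' j
    proof -
      have "G S d'" using Gl that by blast
      then show ?thesis unfolding b_def
        using ols_S(1)[OF _ S d(1)] ols_S(1)[OF _ S d(2)] restrict_design_cong[OF SD(1)[OF S] d(3)] d(4)
        by (simp add: G_def)
    qed
    have sg: "(\<integral>\<^sup>+z. ennreal (exp ((snd z - linear_fit p (b S d) z)\<^sup>2 / \<tau>)) \<partial>P) \<le> ennreal (exp 1)"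
      if d: "d \<in> space M" and Gd: "G S d" for d
    proof -
      have ni: "?ni S d" and ysum: "(\<Sum>i\<in>S. (snd (d i))\<^sup>2 / ty\<^sup>2) \<le> 2 * real n" using Gd by (auto simp: G_def)
      obtain a where a: "\<And>j. j < p \<Longrightarrow> b S d j = apply_mat p W a j" using surj[of "b S d"] by blast
      have la: "linear_fit p (b S d) z = linear_fit p (apply_mat p W a) z" for z
        by (rule linear_fit_cong) (rule a)
      have "real n / 4 * (\<Sum>j<p. (a j)\<^sup>2) \<le> real (card S) / 2 * (\<Sum>j<p. (a j)\<^sup>2)"
        using SD(3)[OF S] by (intro mult_right_mono sum_nonneg) auto
      also have "\<dots> \<le> (\<Sum>i\<in>S. (linear_fit p (apply_mat p W a) (d i))\<^sup>2)"
        by (rule near_isotropic_lower_bound[OF N(3,4) ni])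
      also have "\<dots> \<le> (\<Sum>i\<in>S. (snd (d i))\<^sup>2)"
        using ols_fit_bound[OF ols_S(2)[OF ni S d]] by (simp add: la)
      also have "\<dots> \<le> 2 * real n * ty\<^sup>2"
        using ysum ty by (simp add: pos_divide_le_eq flip: sum_divide_distrib)
      finally have asq: "(\<Sum>j<p. (a j)\<^sup>2) \<le> 8 * ty\<^sup>2" using n by (simp add: field_simps)
      \<comment> \<open>Rescales the whitened coefficients \<open>a\<close> into the unit ball, where \<open>sgx\<close> applies.\<close>
      define c where "c = sqrt 8 * ty"
      have c: "0 < c" "c\<^sup>2 = 8 * ty\<^sup>2" using ty by (auto simp: c_def power_mult_distrib)
      define v where "v = (\<lambda>j. (1/c) * a j)"
      have "(\<Sum>j<p. (v j)\<^sup>2) = (\<Sum>j<p. (a j)\<^sup>2) / c\<^sup>2"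
        by (simp add: v_def power_divide sum_divide_distrib)
      also have "\<dots> \<le> 1" using asq ty unfolding c(2) by simp
      finally have mv: "(\<integral>\<^sup>+z. ennreal (exp ((linear_fit p (apply_mat p W v) z)\<^sup>2 / t\<^sup>2)) \<partial>P) \<le> ennreal (exp 1)"
        by (rule sgx)
      have lv: "linear_fit p (b S d) z = c * linear_fit p (apply_mat p W v) z" for z
        unfolding la v_def apply_mat_scale linear_fit_scale using c by simp
      show ?thesis
      proof (rule exp_moment_average[OF _ _ _ sgy mv])
        \<comment> \<open>\<open>\<tau>\<close> is chosen so that \<open>2 y\<^sup>2 + 2 (c w)\<^sup>2\<close> is at most \<open>\<tau>\<close> times the average of the two normalised squares.\<close>
        fix z
        let ?y = "snd z" and ?w = "linear_fit p (apply_mat p W v) z"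
        have "(?y - c * ?w)\<^sup>2 \<le> 2 * ?y\<^sup>2 + 2 * (c * ?w)\<^sup>2"
          using zero_le_power2[of "?y + c * ?w"] by (simp add: power2_eq_square algebra_simps)
        also have "\<dots> = 2 * ?y\<^sup>2 + 16 * ty\<^sup>2 * ?w\<^sup>2" by (simp add: power_mult_distrib c(2))
        also have "\<dots> \<le> (1 + 8 * t\<^sup>2) * (2 * ?y\<^sup>2) + (1 + 8 * t\<^sup>2) / (8 * t\<^sup>2) * (16 * ty\<^sup>2 * ?w\<^sup>2)"
        proof (rule add_mono)
          show "2 * ?y\<^sup>2 \<le> (1 + 8 * t\<^sup>2) * (2 * ?y\<^sup>2)"
            using mult_right_mono[of 1 "1 + 8 * t\<^sup>2" "2 * ?y\<^sup>2"] by simp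
          have "1 \<le> (1 + 8 * t\<^sup>2) / (8 * t\<^sup>2)" using t0 by simp
          from mult_right_mono[OF this, of "16 * ty\<^sup>2 * ?w\<^sup>2"]
          show "16 * ty\<^sup>2 * ?w\<^sup>2 \<le> (1 + 8 * t\<^sup>2) / (8 * t\<^sup>2) * (16 * ty\<^sup>2 * ?w\<^sup>2)" by simp
        qed
        also have "\<dots> = \<tau> * ((?y\<^sup>2 / ty\<^sup>2 + ?w\<^sup>2 / t\<^sup>2) / 2)"
          unfolding \<tau>_def using t0 ty by (simp add: field_simps)
        finally show "(?y - linear_fit p (b S d) z)\<^sup>2 / \<tau> \<le> (?y\<^sup>2 / ty\<^sup>2 + ?w\<^sup>2 / t\<^sup>2) / 2"
          unfolding lv using \<tau> by (simp add: pos_divide_le_eq mult.commute)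
      qed measurable
    qed
    have TS: "finite ?T" "S \<inter> ?T = {}" by auto
    note tail = held_out_residual_tail[where S = S and T = ?T and p = p and P = P and G = "G S" and b = "b S"
        and \<tau> = \<tau> and \<delta> = \<delta>, unfolded eq, OF P setsP SD(2)[OF S] TS Gm bm Gl bl sg \<tau>]
    show "E3 S \<in> sets M" unfolding E3_def by (rule tail(1))
    have "emeasure M (E3 S) \<le> ennreal (exp (real (card ?T) - \<delta> / \<tau>))" 
      unfolding E3_def by (rule tail(2))
    also have "\<dots> \<le> ennreal (exp (real k - \<epsilon>\<^sup>2 * real n / (8 * B\<^sup>2 * ty\<^sup>2 * (1 + 8 * t\<^sup>2))))"
    proof -
      have "card ?T = n - card S" using SD(1,2)[OF S] by (simp add: card_Diff_subset)
      then have "card ?T \<le> k" using S unfolding \<S>_def by auto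
      moreover have "\<delta> / \<tau> = \<epsilon>\<^sup>2 * real n / (8 * B\<^sup>2 * ty\<^sup>2 * (1 + 8 * t\<^sup>2))"
        by (simp add: \<delta>_def \<tau>_def mult_ac)
      ultimately show ?thesis by (intro ennreal_leI) simp
    qed
    finally show "emeasure M (E3 S) \<le> ennreal (exp (real k - \<epsilon>\<^sup>2 * real n / (8 * B\<^sup>2 * ty\<^sup>2 * (1 + 8 * t\<^sup>2))))" .
  qed
  have close: "vnorm (\<beta> d - \<beta>S S d) \<le> \<epsilon>"
    if d: "d \<in> space M" and S: "S \<in> \<S>" and no: "d \<notin> E2" "d \<notin> E1 S" "d \<notin> E1 {..<n}" "d \<notin> E3 S" for d S
  proof -
    have ni: "?ni S d" "?ni {..<n} d" using d no by (auto simp: E1_def)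
    have "(\<Sum>i\<in>S. (snd (d i))\<^sup>2 / ty\<^sup>2) \<le> (\<Sum>i<n. (snd (d i))\<^sup>2 / ty\<^sup>2)"
      using SD(1)[OF S] by (intro sum_mono2) auto
    also have "\<dots> \<le> 2 * real n" using d no(1) by (simp add: E2_def)
    finally have "G S d" using ni by (simp add: G_def)
    then have res: "(\<Sum>i\<in>{..<n} - S. (snd (d i) - linear_fit p (b S d) (d i))\<^sup>2) \<le> \<delta>"
      using d no(4) by (simp add: E3_def)
    define D where "D = (\<lambda>j. \<beta> d $ j - b S d j)"
    obtain a where a: "\<And>j. j < p \<Longrightarrow> D j = apply_mat p W a j" using surj[of D] by blast
    have "real n / 2 * (\<Sum>j<p. (a j)\<^sup>2) \<le> (\<Sum>i<n. (linear_fit p (apply_mat p W a) (d i))\<^sup>2)"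
      using near_isotropic_lower_bound[OF N(3,4) ni(2), of a] by simp
    also have "\<dots> = (\<Sum>i<n. (linear_fit p D (d i))\<^sup>2)"
      using linear_fit_cong[of p "apply_mat p W a" D] a by simp
    also have "\<dots> \<le> (\<Sum>i\<in>{..<n} - S. (snd (d i) - linear_fit p (b S d) (d i))\<^sup>2)"
      unfolding D_def
      by (rule ols_difference_bound[OF finite_lessThan SD(1)[OF S] ols_full[OF ni(2) d] ols_S(2)[OF ni(1) S d]])
    also note res
    finally have "real n / 2 * (\<Sum>j<p. (a j)\<^sup>2) \<le> \<epsilon>\<^sup>2 * real n / (2 * B\<^sup>2)" by (simp add: \<delta>_def)
    then have "B\<^sup>2 * (\<Sum>j<p. (a j)\<^sup>2) \<le> \<epsilon>\<^sup>2" using n B by (simp add: field_simps)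
    moreover have "(\<Sum>j<p. (D j)\<^sup>2) \<le> B\<^sup>2 * (\<Sum>j<p. (a j)\<^sup>2)" using bound[of a] a by simp
    ultimately have D: "(\<Sum>j<p. (D j)\<^sup>2) \<le> \<epsilon>\<^sup>2" by linarith
    have c: "\<beta> d \<in> carrier_vec p" "\<beta>S S d \<in> carrier_vec p"
      using est estS[OF SD(1)[OF S]] d unfolding is_ols_estimator_def M_def by auto
    have "vnorm (\<beta> d - \<beta>S S d) = sqrt (\<Sum>j<p. (D j)\<^sup>2)"
      using c by (simp add: vnorm_def scalar_prod_def D_def b_def power2_eq_square atLeast0LessThan)
    also have "\<dots> \<le> sqrt (\<epsilon>\<^sup>2)" using D by (rule real_sqrt_le_mono)
    finally show ?thesis using eps by simp
  qed
  let ?Bad = "{d \<in> space M. \<bar>Max ((\<lambda>S. vnorm (\<beta> d - \<beta>S S d)) ` \<S>) - 0\<bar> > \<epsilon>}"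
  let ?U = "\<Union>S\<in>\<S>. E1 S \<union> E3 S"
  have sub: "?Bad \<subseteq> E2 \<union> ?U"
  proof
    fix d assume d: "d \<in> ?Bad"
    let ?V = "(\<lambda>S. vnorm (\<beta> d - \<beta>S S d)) ` \<S>"
    have "Max ?V \<in> ?V" using finS full by (intro Max_in) auto
    then obtain S where S: "S \<in> \<S>" "Max ?V = vnorm (\<beta> d - \<beta>S S d)" by auto
    have "0 \<le> vnorm (\<beta> d - \<beta>S S d)" by (rule vnorm_nonneg)
    then have "\<not> vnorm (\<beta> d - \<beta>S S d) \<le> \<epsilon>" using d S(2) by simp
    then show "d \<in> E2 \<union> ?U" using close[of d S] d S(1) full by blast
  qed
  have meas: "E2 \<in> sets M" "?U \<in> sets M" using E1(1) E2(1) E3(1) finS by auto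
  let ?x = "2 * exp (18 * real p - real n / (1536 * t ^ 4))"
  let ?y = "exp (real k - \<epsilon>\<^sup>2 * real n / (8 * B\<^sup>2 * ty\<^sup>2 * (1 + 8 * t\<^sup>2)))"
  have "emeasure M ?Bad \<le> emeasure M (E2 \<union> ?U)" using meas by (intro emeasure_mono sub) auto
  also have "\<dots> \<le> emeasure M E2 + emeasure M ?U" by (rule emeasure_subadditive[OF meas])
  also have "emeasure M ?U \<le> (\<Sum>S\<in>\<S>. emeasure M (E1 S \<union> E3 S))"
    using E1(1) E3(1) finS by (intro emeasure_subadditive_finite) auto
  also have "\<dots> \<le> (\<Sum>S\<in>\<S>. ennreal (?x + ?y))"
  proof (rule sum_mono)
    fix S assume S: "S \<in> \<S>"
    have "emeasure M (E1 S \<union> E3 S) \<le> emeasure M (E1 S) + emeasure M (E3 S)"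
      using E1(1)[OF S] E3(1)[OF S] by (rule emeasure_subadditive)
    also have "\<dots> \<le> ennreal ?x + ennreal ?y" by (intro add_mono E1(2) E3(2) S)
    also have "\<dots> = ennreal (?x + ?y)" by (rule ennreal_plus[symmetric]) auto
    finally show "emeasure M (E1 S \<union> E3 S) \<le> ennreal (?x + ?y)" .
  qed
  also have "(\<Sum>S\<in>\<S>. ennreal (?x + ?y)) = ennreal (\<Sum>S\<in>\<S>. ?x + ?y)" by (rule sum_ennreal) simp
  also have "emeasure M E2 + \<dots> \<le> ennreal (exp (- real n)) + ennreal (\<Sum>S\<in>\<S>. ?x + ?y)"
    by (intro add_mono E2(2)) auto
  also have "\<dots> = ennreal (exp (- real n) + (\<Sum>S\<in>\<S>. ?x + ?y))"
    by (rule ennreal_plus[symmetric]) (auto intro: sum_nonneg add_nonneg_nonneg)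
  also have "exp (- real n) + (\<Sum>S\<in>\<S>. ?x + ?y) = real (card \<S>) * (?x + ?y) + exp (- real n)" by simp
  finally have "emeasure M ?Bad \<le> ennreal (real (card \<S>) * (?x + ?y) + exp (- real n))" by (simp add: add_mono)
  then have "measure M ?Bad \<le> real (card \<S>) * (?x + ?y) + exp (- real n)"
    unfolding measure_def by (rule enn2real_leI[rotated]) auto
  then show ?thesis unfolding M_def .
qed

section \<open>Whitening and the limit\<close>

text \<open>Weight every subset by \<open>exp (\<theta> (k - card of its complement))\<close>, which is at least 1 on the sets that
  are counted, and sum over all subsets with the binomial theorem.\<close>

lemma card_large_subsets_le:
  assumes \<theta>: "0 \<le> \<theta>"
  shows "real (card {S. S \<subseteq> {..<n} \<and> n \<le> card S + k}) \<le> exp (real n * exp (- \<theta>) + \<theta> * real k)"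
proof -
  let ?F = "{S. S \<subseteq> {..<n} \<and> n \<le> card S + k}"
  have "real (card ?F) = (\<Sum>S\<in>?F. 1)" by simp
  also have "\<dots> \<le> (\<Sum>S\<in>?F. exp (\<theta> * real k) * exp (- \<theta>) ^ card ({..<n} - S))"
  proof (rule sum_mono)
    fix S assume S: "S \<in> ?F"
    then have "card ({..<n} - S) \<le> k" by (auto simp: card_Diff_subset finite_subset)
    then have "0 \<le> \<theta> * real k - \<theta> * real (card ({..<n} - S))"
      using \<theta> by (simp add: mult_left_mono)
    then have "1 \<le> exp (\<theta> * real k - \<theta> * real (card ({..<n} - S)))" by simp
    also have "\<dots> = exp (\<theta> * real k) * exp (- \<theta>) ^ card ({..<n} - S)"
      by (simp add: exp_add[symmetric] exp_of_nat2_mult[symmetric])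
    finally show "1 \<le> exp (\<theta> * real k) * exp (- \<theta>) ^ card ({..<n} - S)" .
  qed
  also have "\<dots> \<le> (\<Sum>S\<in>Pow {..<n}. exp (\<theta> * real k) * exp (- \<theta>) ^ card ({..<n} - S))"
    by (intro sum_mono2) auto
  also have "\<dots> = exp (\<theta> * real k) * (\<Prod>i<n. 1 + exp (- \<theta>))"
    by (subst prod_add) (auto simp: sum_distrib_left)
  also have "(\<Prod>i<n. 1 + exp (- \<theta>)) \<le> (\<Prod>i<n. exp (exp (- \<theta>)))"
    by (intro prod_mono) (auto simp: add_nonneg_nonneg)
  also have "exp (\<theta> * real k) * (\<Prod>i<n. exp (exp (- \<theta>))) = exp (real n * exp (- \<theta>) + \<theta> * real k)"
    by (simp add: exp_add exp_of_nat_mult)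
  finally show ?thesis by simp
qed

text \<open>As \<open>k / n \<rightarrow> 0\<close>, a union bound over all removals costs a factor that any exponential gain beats.\<close>

lemma card_large_subsets_subexponential:
  fixes k :: "nat \<Rightarrow> nat"
  assumes k: "(\<lambda>n. real (k n) / real n) \<longlonglongrightarrow> 0" and \<eta>: "0 < \<eta>"
  shows "\<forall>\<^sub>F n in sequentially. real (card {S. S \<subseteq> {..<n} \<and> n \<le> card S + k n}) \<le> exp (\<eta> * real n)"
proof -
  \<comment> \<open>Makes \<open>exp (- \<theta>)\<close> at most \<open>\<eta> / 2\<close> while keeping \<open>\<theta>\<close> nonnegative for large \<open>\<eta>\<close>.\<close>
  define \<theta> where "\<theta> = ln (1 + 2 / \<eta>)"
  have \<theta>: "0 \<le> \<theta>" using \<eta> by (simp add: \<theta>_def)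
  have "1 + 2 / \<eta> > 0" using \<eta> by (simp add: add_pos_pos)
  then have "exp (- \<theta>) = 1 / (1 + 2 / \<eta>)" by (simp add: \<theta>_def exp_minus divide_inverse)
  also have "\<dots> \<le> \<eta> / 2" using \<eta> by (simp add: field_simps)
  finally have e: "exp (- \<theta>) \<le> \<eta> / 2" .
  have "(\<lambda>n. \<theta> * (real (k n) / real n)) \<longlonglongrightarrow> \<theta> * 0" using k by (rule tendsto_mult_left)
  then have "\<forall>\<^sub>F n in sequentially. \<theta> * (real (k n) / real n) < \<eta> / 2"
    using \<eta> by (intro order_tendstoD(2)[of _ 0]) auto
  then show ?thesis using eventually_gt_at_top[of 0]
  proof eventually_elim
    case (elim n)
    then have "\<theta> * real (k n) \<le> \<eta> / 2 * real n" by (simp add: field_simps)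
    moreover have "real n * exp (- \<theta>) \<le> \<eta> / 2 * real n" using mult_left_mono[OF e, of "real n"] by (simp add: mult.commute)
    ultimately have "real n * exp (- \<theta>) + \<theta> * real (k n) \<le> \<eta> * real n" by linarith
    then show ?case using card_large_subsets_le[OF \<theta>, of n "k n"] by (meson exp_le_cancel_iff order_trans)
  qed
qed

text \<open>The entries of the covariance matrix are Bochner integrals; sub-Gaussianity is what makes them genuine
  second moments.\<close>

lemma covariance_quadratic_form:
  assumes m1: "model1 p P" and u: "u \<in> carrier_vec p"
  shows "(\<integral>z. (linear_fit p (($) u) z)\<^sup>2 \<partial>P) = u \<bullet> (cov_mat p P *\<^sub>v u)"
proof -
  have P: "prob_space P" and setsP: "sets P = sets (obs_space p)"
    and fin: "psi2_norm_vec p P (covar p) < \<infinity>" using m1 by (auto simp: model1_def)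
  obtain r where r: "psi2_norm_vec p P (covar p) = ennreal r" "0 \<le> r" using fin by (cases "psi2_norm_vec p P (covar p)") auto
  then have less: "psi2_norm_vec p P (covar p) < ennreal (r + 1)" by (simp add: ennreal_lessI)
  have cm: "(\<lambda>z. fst z j) \<in> borel_measurable P" if "j < p" for j by (rule coordinate_measurable[OF setsP that])
  have sq: "integrable P (\<lambda>z. (fst z j)\<^sup>2)" if j: "j < p" for j
  proof (rule subgaussian_integrable(3)[OF cm[OF j]])
    show "0 < r + 1" using r by simp
    have "vnorm (unit_vec p j) \<le> 1" using j by (simp add: vnorm_def)
    from psi2_norm_vec_less_imp_exp_moment[OF P _ less unit_vec_carrier this]
    show "(\<integral>\<^sup>+z. ennreal (exp ((fst z j)\<^sup>2 / (r + 1)\<^sup>2)) \<partial>P) \<le> ennreal (exp 1)"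
      using j by (simp add: covar_def)
  qed
  have int: "integrable P (\<lambda>z. fst z i * fst z j)" if ij: "i < p" "j < p" for i j
  proof (rule Bochner_Integration.integrable_bound)
    show "integrable P (\<lambda>z. (fst z i)\<^sup>2 + (fst z j)\<^sup>2)" using sq ij by simp
    show "(\<lambda>z. fst z i * fst z j) \<in> borel_measurable P" using cm ij by simp
    have "\<bar>x * y\<bar> \<le> x\<^sup>2 + y\<^sup>2" for x y :: real
    proof -
      have "2 * \<bar>x * y\<bar> \<le> x\<^sup>2 + y\<^sup>2" using sum_squares_bound[of "\<bar>x\<bar>" "\<bar>y\<bar>"] by (simp add: abs_mult)
      then show ?thesis using abs_ge_zero[of "x * y"] by linarith
    qed
    then show "AE z in P. norm (fst z i * fst z j) \<le> norm ((fst z i)\<^sup>2 + (fst z j)\<^sup>2)" by simp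
  qed
  have "(\<integral>z. (linear_fit p (($) u) z)\<^sup>2 \<partial>P) = (\<integral>z. (\<Sum>i<p. \<Sum>j<p. u $ i * u $ j * (fst z i * fst z j)) \<partial>P)"
    by (simp add: linear_fit_def power2_eq_square sum_product mult_ac)
  also have "\<dots> = (\<Sum>i<p. \<integral>z. (\<Sum>j<p. u $ i * u $ j * (fst z i * fst z j)) \<partial>P)"
    by (rule Bochner_Integration.integral_sum)
      (auto intro!: Bochner_Integration.integrable_sum integrable_mult_right int)
  also have "\<dots> = (\<Sum>i<p. \<Sum>j<p. \<integral>z. u $ i * u $ j * (fst z i * fst z j) \<partial>P)"
    by (intro sum.cong refl Bochner_Integration.integral_sum) (auto intro!: integrable_mult_right int)
  also have "\<dots> = (\<Sum>i<p. \<Sum>j<p. u $ i * u $ j * (\<integral>z. fst z i * fst z j \<partial>P))" by simp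
  also have "\<dots> = u \<bullet> (cov_mat p P *\<^sub>v u)"
    using u by (subst quadratic_form_double_sum[of _ p])
      (auto simp: cov_mat_def covar_def mult_ac intro!: sum.cong)
  finally show ?thesis .
qed

text \<open>With \<open>V = \<Sigma>\<^sup>-\<^sup>1\<^sup>/\<^sup>2\<close> everything rests on \<open>V \<Sigma> V = I\<close>: the transformed covariates are isotropic,
  \<open>V\<close> is surjective with preimage \<open>\<Sigma> V v\<close> of \<open>v\<close>, and the spectral norm of \<open>V\<close> converts whitened
  coefficients into original ones.\<close>

lemma whitening:
  assumes m1: "model1 p P"
  defines "V \<equiv> mat_inv_sqrt (cov_mat p P)"
  defines "W \<equiv> \<lambda>j l. V $$ (j, l)"
  shows "\<And>v z. linear_fit p (apply_mat p W v) z = Matrix.vec p v \<bullet> (V *\<^sub>v covar p z)"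
    and "\<And>v. (\<integral>z. (linear_fit p (apply_mat p W v) z)\<^sup>2 \<partial>P) = (\<Sum>j<p. (v j)\<^sup>2)"
    and "\<And>v. \<exists>b. \<forall>j<p. v j = apply_mat p W b j"
    and "\<And>b. (\<Sum>j<p. (apply_mat p W b j)\<^sup>2) \<le> (spectral_norm V)\<^sup>2 * (\<Sum>j<p. (b j)\<^sup>2)"
    and "\<And>z. V *\<^sub>v covar p z \<in> carrier_vec p"
proof -
  let ?C = "cov_mat p P"
  have C: "?C \<in> carrier_mat p p" by (simp add: cov_mat_def)
  have pd: "pos_def_mat ?C" using m1 by (simp add: model1_def)
  note V = mat_inv_sqrt[OF C pd, folded V_def]
  have cov: "covar p z \<in> carrier_vec p" for z by (simp add: covar_def)
  have Wv: "apply_mat p W v j = (V *\<^sub>v Matrix.vec p v) $ j" if "j < p" for v j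
    using that V(1) by (simp add: apply_mat_def W_def scalar_prod_def atLeast0LessThan)
  show "linear_fit p (apply_mat p W v) z = Matrix.vec p v \<bullet> (V *\<^sub>v covar p z)" for v z
  proof -
    have Vc: "V *\<^sub>v Matrix.vec p v \<in> carrier_vec p" using V(1) by simp
    have "linear_fit p (apply_mat p W v) z = (V *\<^sub>v Matrix.vec p v) \<bullet> covar p z"
      by (simp add: linear_fit_def Wv scalar_prod_def covar_def atLeast0LessThan mult.commute
          del: index_mult_mat_vec)
    also have "\<dots> = Matrix.vec p v \<bullet> (V *\<^sub>v covar p z)"
      by (rule symmetric_form_commute[OF V(1,2) vec_carrier cov])
    finally show ?thesis .
  qed
  show "(\<integral>z. (linear_fit p (apply_mat p W v) z)\<^sup>2 \<partial>P) = (\<Sum>j<p. (v j)\<^sup>2)" for v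
  proof -
    let ?v = "Matrix.vec p v"
    have v: "?v \<in> carrier_vec p" by simp
    have Vv: "V *\<^sub>v ?v \<in> carrier_vec p" using V(1) by simp
    have CVv: "?C *\<^sub>v (V *\<^sub>v ?v) \<in> carrier_vec p" using C Vv by simp
    have "(\<integral>z. (linear_fit p (apply_mat p W v) z)\<^sup>2 \<partial>P) = (\<integral>z. (linear_fit p (($) (V *\<^sub>v ?v)) z)\<^sup>2 \<partial>P)"
      using linear_fit_cong[of p "apply_mat p W v" "($) (V *\<^sub>v ?v)"] Wv by simp
    also have "\<dots> = (V *\<^sub>v ?v) \<bullet> (?C *\<^sub>v (V *\<^sub>v ?v))"
      by (rule covariance_quadratic_form[OF m1 Vv])
    also have "\<dots> = ?v \<bullet> (V *\<^sub>v (?C *\<^sub>v (V *\<^sub>v ?v)))"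
      by (rule symmetric_form_commute[OF V(1,2) v CVv])
    also have "V *\<^sub>v (?C *\<^sub>v (V *\<^sub>v ?v)) = (V * ?C * V) *\<^sub>v ?v"
      using V(1) C v Vv by (simp add: assoc_mult_mat_vec[of _ p p _ p] del: vec_carrier)
    also have "\<dots> = ?v" unfolding V(3) by simp
    also have "?v \<bullet> ?v = (\<Sum>j<p. (v j)\<^sup>2)" by (simp add: scalar_prod_def power2_eq_square atLeast0LessThan)
    finally show ?thesis .
  qed
  show "\<exists>b. \<forall>j<p. v j = apply_mat p W b j" for v
  proof (intro exI allI impI)
    let ?v = "Matrix.vec p v"
    let ?b = "?C *\<^sub>v (V *\<^sub>v ?v)"
    fix j assume j: "j < p"
    have b: "?b \<in> carrier_vec p" using C V(1) by simp
    have "Matrix.vec p (($) x) = x" if "x \<in> carrier_vec p" for x :: rvec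
      using that by (intro eq_vecI) auto
    from this[OF b] have "apply_mat p W (($) ?b) j = (V *\<^sub>v ?b) $ j" using Wv[OF j] by metis
    also have "V *\<^sub>v ?b = (V * ?C * V) *\<^sub>v ?v"
      using V(1) C by (simp add: assoc_mult_mat_vec[of _ p p _ p])
    also have "\<dots> = ?v" unfolding V(3) by simp
    finally show "v j = apply_mat p W (($) ?b) j" using j by simp
  qed
  show "(\<Sum>j<p. (apply_mat p W b j)\<^sup>2) \<le> (spectral_norm V)\<^sup>2 * (\<Sum>j<p. (b j)\<^sup>2)" for b
  proof -
    let ?b = "Matrix.vec p b"
    have Vb: "V *\<^sub>v ?b \<in> carrier_vec p" using V(1) by simp
    have "(\<Sum>j<p. (apply_mat p W b j)\<^sup>2) = (vnorm (V *\<^sub>v ?b))\<^sup>2"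
      unfolding vnorm_power2[OF Vb] by (simp add: Wv del: index_mult_mat_vec)
    also have "\<dots> \<le> (spectral_norm V * vnorm ?b)\<^sup>2"
      by (rule power_mono[OF spectral_norm_bound[OF V(1) vec_carrier] vnorm_nonneg])
    also have "\<dots> = (spectral_norm V)\<^sup>2 * (\<Sum>j<p. (b j)\<^sup>2)" by (simp add: power_mult_distrib vnorm_power2)
    finally show ?thesis .
  qed
  show "V *\<^sub>v covar p z \<in> carrier_vec p" for z using V(1) cov by simp
qed

text \<open>Here the hypothesis on \<open>K\<^sup>2 sqrt (p / n)\<close> is spent, where \<open>K\<close> is the \<open>\<psi>\<^sub>2\<close> norm of the whitened
  covariates: it makes \<open>p\<close> so small a multiple of \<open>n / K ^ 4\<close> that the size \<open>exp (18 p)\<close> of the net is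
  beaten by the bound on the probability of a deviation in one direction. As the moment bounds hold strictly above
  the norm only, \<open>K\<close> is first replaced by a larger \<open>t\<close> with \<open>t\<^sup>2 sqrt (p / n) \<le> 1 / 1000\<close> and \<open>t \<le> T\<close>.\<close>

theorem ols_removal_probability:
  fixes \<beta>S :: "nat set \<Rightarrow> (nat \<Rightarrow> obs) \<Rightarrow> rvec"
  assumes n: "0 < n" and m1: "model1 p P" and k: "2 * k \<le> n" and eps: "0 < \<epsilon>"
    and est: "is_ols_estimator (sample_space n P) p (design n p) (response n) \<beta>"
    and estS: "\<And>S. S \<subseteq> {..<n} \<Longrightarrow> is_ols_estimator (sample_space n P) p
        (\<lambda>d. restrict_rows (design n p d) S) (\<lambda>d. restrict_vec (response n d) S) (\<beta>S S)"
    and B: "0 < B" "spectral_norm (mat_inv_sqrt (cov_mat p P)) \<le> B"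
    and T: "1/2 \<le> T" "psi2_norm_vec p P (\<lambda>z. mat_inv_sqrt (cov_mat p P) *\<^sub>v covar p z) < ennreal T"
    and ty: "0 < ty" "psi2_norm P snd < ennreal ty"
    and ratio: "(psi2_norm_vec p P (\<lambda>z. mat_inv_sqrt (cov_mat p P) *\<^sub>v covar p z))\<^sup>2
        * ennreal (sqrt (real p / real n)) < ennreal (1 / 1000)"
  shows "measure (sample_space n P) {d \<in> space (sample_space n P).
      \<bar>Max ((\<lambda>S. vnorm (\<beta> d - \<beta>S S d)) ` {S. S \<subseteq> {..<n} \<and> n \<le> card S + k}) - 0\<bar> > \<epsilon>}
    \<le> real (card {S. S \<subseteq> {..<n} \<and> n \<le> card S + k}) * (2 * exp (- real n / (2000 * T ^ 4))
        + exp (real k - \<epsilon>\<^sup>2 * real n / (8 * B\<^sup>2 * ty\<^sup>2 * (1 + 8 * T\<^sup>2)))) + exp (- real n)"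
proof -
  define V where "V = mat_inv_sqrt (cov_mat p P)"
  define W where "W = (\<lambda>j l. V $$ (j, l))"
  note wh = whitening[OF m1, folded V_def, folded W_def]
  have P: "prob_space P" and setsP: "sets P = sets (obs_space p)" using m1 by (auto simp: model1_def)
  interpret P: prob_space P by (rule P)
  let ?K = "psi2_norm_vec p P (\<lambda>z. V *\<^sub>v covar p z)"
  have T2: "?K < ennreal T" using T(2) by (simp add: V_def)
  then obtain \<kappa> where \<kappa>: "?K = ennreal \<kappa>" "0 \<le> \<kappa>" by (cases ?K) auto
  have \<kappa>T: "\<kappa> < T" using T2 \<kappa> by (simp add: ennreal_less_iff)
  have sg: "(\<integral>\<^sup>+z. ennreal (exp ((linear_fit p (apply_mat p W v) z)\<^sup>2 / t\<^sup>2)) \<partial>P) \<le> ennreal (exp 1)"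
    if v: "(\<Sum>j<p. (v j)\<^sup>2) \<le> 1" and t: "\<kappa> < t" for v t
    unfolding wh(1)
  proof (rule psi2_norm_vec_less_imp_exp_moment[OF P wh(5)])
    show "?K < ennreal t" using \<kappa> t by (simp add: ennreal_less_iff)
    show "vnorm (Matrix.vec p v) \<le> 1"
      using v by (simp add: vnorm_def scalar_prod_def atLeast0LessThan flip: power2_eq_square)
  qed simp
  \<comment> \<open>For \<open>p = 0\<close> the norm is a supremum over the empty set and carries no information, so \<open>T\<close> itself is taken.\<close>
  have "\<exists>t. \<kappa> < t \<and> 1/2 \<le> t \<and> t \<le> T \<and> t\<^sup>2 * sqrt (real p / real n) \<le> 1 / 1000"
  proof (cases "p = 0")
    case True
    then show ?thesis using \<kappa>T T(1) by (intro exI[of _ T]) simp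
  next
    case False
    define s where "s = sqrt (real p / real n)"
    have s: "0 < s" using False n by (simp add: s_def)
    have "ennreal (\<kappa>\<^sup>2 * s) < ennreal (1 / 1000)"
      using ratio s \<kappa> by (simp add: V_def s_def ennreal_mult ennreal_power)
    then have "\<kappa>\<^sup>2 * s < 1 / 1000" using s by (simp add: ennreal_less_iff)
    then have "\<kappa>\<^sup>2 < 1 / 1000 / s" using s by (simp add: pos_less_divide_eq)
    then have "sqrt (\<kappa>\<^sup>2) < sqrt (1 / 1000 / s)" by (rule real_sqrt_less_mono)
    then have \<kappa>s: "\<kappa> < sqrt (1 / 1000 / s)" using \<kappa> by simp
    define t where "t = min T (sqrt (1 / 1000 / s))"
    have t: "\<kappa> < t" "t \<le> T" using \<kappa>T \<kappa>s by (auto simp: t_def)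
    have t0: "0 < t" using t \<kappa> by linarith
    have "t\<^sup>2 \<le> (sqrt (1 / 1000 / s))\<^sup>2" using t0 by (intro power_mono) (auto simp: t_def)
    then have "t\<^sup>2 * s \<le> 1 / 1000" using s by (simp add: pos_le_divide_eq)
    moreover have "1/2 \<le> t"
    proof -
      \<comment> \<open>A variable with unit second moment cannot have a small \<open>\<psi>\<^sub>2\<close> norm.\<close>
      define v where "v j = (if j = 0 then 1 else 0 :: real)" for j :: nat
      have v: "(\<Sum>j<p. (v j)\<^sup>2) = 1"
        using False by (subst sum.remove[of _ 0]) (auto simp: v_def intro!: sum.neutral)
      let ?w = "linear_fit p (apply_mat p W v)"
      have wm: "?w \<in> borel_measurable P" by (rule linear_fit_measurable[OF setsP])
      have "(\<integral>\<^sup>+z. ennreal (exp ((?w z)\<^sup>2 / t\<^sup>2)) \<partial>P) \<le> ennreal (exp 1)" using v t by (intro sg) auto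
      note si = subgaussian_integrable[OF wm t0 this]
      have "1 + 1 / t\<^sup>2 = (\<integral>z. 1 + (?w z)\<^sup>2 / t\<^sup>2 \<partial>P)"
        using si(3) wh(2)[of v] v by (simp add: P.prob_space)
      also have "\<dots> \<le> (\<integral>z. exp ((?w z)\<^sup>2 / t\<^sup>2) \<partial>P)"
        using si by (intro integral_mono) auto
      also have "\<dots> \<le> 3" using si(2) exp_le by linarith
      finally have "1 / t\<^sup>2 \<le> 2" by simp
      then have "(1/2)\<^sup>2 \<le> t\<^sup>2" using t0 by (simp add: field_simps power2_eq_square)
      then show ?thesis using t0 by (simp add: power2_le_iff_abs_le abs_le_square_iff[symmetric])
    qed
    ultimately show ?thesis using t by (auto simp: s_def)
  qed
  then obtain t where t: "\<kappa> < t" "1/2 \<le> t" "t \<le> T" "t\<^sup>2 * sqrt (real p / real n) \<le> 1 / 1000" by blast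
  have t0: "0 < t" using t by simp
  have nS: "0 \<le> spectral_norm V \<or> p = 0"
  proof (cases "p = 0")
    case False
    have "V \<in> carrier_mat p p"
      using mat_inv_sqrt(1)[of "cov_mat p P" p] m1 by (simp add: V_def cov_mat_def model1_def)
    then have "vnorm (V *\<^sub>v unit_vec p 0) \<le> spectral_norm V * vnorm (unit_vec p 0)"
      by (rule spectral_norm_bound) simp
    moreover have "vnorm (unit_vec p 0) = 1" using False by (simp add: vnorm_def)
    moreover have "0 \<le> vnorm (V *\<^sub>v unit_vec p 0)" by (rule vnorm_nonneg)
    ultimately show ?thesis by simp
  qed simp
  have bound: "(\<Sum>j<p. (apply_mat p W b j)\<^sup>2) \<le> B\<^sup>2 * (\<Sum>j<p. (b j)\<^sup>2)" for b
  proof (cases "p = 0")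
    case False
    then have "(spectral_norm V)\<^sup>2 \<le> B\<^sup>2" using nS B(2) by (intro power_mono) (auto simp: V_def)
    then have "(spectral_norm V)\<^sup>2 * (\<Sum>j<p. (b j)\<^sup>2) \<le> B\<^sup>2 * (\<Sum>j<p. (b j)\<^sup>2)"
      by (intro mult_right_mono sum_nonneg) auto
    then show ?thesis using wh(4)[of b] by linarith
  qed simp
  let ?c = "real (card {S. S \<subseteq> {..<n} \<and> n \<le> card S + k})"
  have main: "measure (sample_space n P) {d \<in> space (sample_space n P).
      \<bar>Max ((\<lambda>S. vnorm (\<beta> d - \<beta>S S d)) ` {S. S \<subseteq> {..<n} \<and> n \<le> card S + k}) - 0\<bar> > \<epsilon>}
    \<le> ?c * (2 * exp (18 * real p - real n / (1536 * t ^ 4))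
        + exp (real k - \<epsilon>\<^sup>2 * real n / (8 * B\<^sup>2 * ty\<^sup>2 * (1 + 8 * t\<^sup>2)))) + exp (- real n)"
    by (rule ols_removal_tail[OF P setsP n t(2) ty(1) B(1) eps k sg[OF _ t(1)] wh(2)
          psi2_norm_less_imp_exp_moment[OF ty(2)] wh(3) bound est estS])
  have tT4: "t ^ 4 \<le> T ^ 4" and tT2: "t\<^sup>2 \<le> T\<^sup>2" using t t0 by (auto intro!: power_mono)
  have "(t\<^sup>2 * sqrt (real p / real n))\<^sup>2 \<le> (1 / 1000)\<^sup>2" using t(4) by (intro power_mono) auto
  moreover have "(t\<^sup>2 * sqrt (real p / real n))\<^sup>2 = (t\<^sup>2)\<^sup>2 * (real p / real n)"
    by (simp only: power_mult_distrib real_sqrt_pow2[OF divide_nonneg_nonneg[OF of_nat_0_le_iff of_nat_0_le_iff]])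
  moreover have "(t\<^sup>2)\<^sup>2 = t ^ 4" by (simp flip: power_mult)
  ultimately have "t ^ 4 * (real p / real n) \<le> 1 / 1000000" by (simp add: power2_eq_square)
  then have "t ^ 4 * (real p / real n) * (real n / t ^ 4) \<le> 1 / 1000000 * (real n / t ^ 4)"
    using t0 by (intro mult_right_mono) auto
  then have p: "real p \<le> 1 / 1000000 * (real n / t ^ 4)" using n t0 by simp
  have r: "real n / T ^ 4 \<le> real n / t ^ 4"
    using tT4 t0 t(3) by (intro divide_left_mono mult_pos_pos zero_less_power) auto
  have q: "0 \<le> real n / t ^ 4" using t0 by simp
  have eqs: "real n / (1536 * t ^ 4) = 1 / 1536 * (real n / t ^ 4)"
    "- real n / (2000 * T ^ 4) = - (1 / 2000 * (real n / T ^ 4))" by simp_all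
  \<comment> \<open>The constant is small enough: \<open>18 / 10 ^ 6 + 1 / 2000 \<le> 1 / 1536\<close>.\<close>
  have x: "18 * real p - real n / (1536 * t ^ 4) \<le> - real n / (2000 * T ^ 4)"
    unfolding eqs using p q r by linarith
  have y: "real k - \<epsilon>\<^sup>2 * real n / (8 * B\<^sup>2 * ty\<^sup>2 * (1 + 8 * t\<^sup>2)) \<le> real k - \<epsilon>\<^sup>2 * real n / (8 * B\<^sup>2 * ty\<^sup>2 * (1 + 8 * T\<^sup>2))"
    using tT2 B(1) ty(1) 
    by (intro diff_left_mono divide_left_mono mult_left_mono mult_pos_pos) (auto intro: add_pos_nonneg)
  have "?c * (2 * exp (18 * real p - real n / (1536 * t ^ 4))
        + exp (real k - \<epsilon>\<^sup>2 * real n / (8 * B\<^sup>2 * ty\<^sup>2 * (1 + 8 * t\<^sup>2))))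
    \<le> ?c * (2 * exp (- real n / (2000 * T ^ 4))
        + exp (real k - \<epsilon>\<^sup>2 * real n / (8 * B\<^sup>2 * ty\<^sup>2 * (1 + 8 * T\<^sup>2))))"
    using x y by (intro mult_left_mono add_mono) auto
  then show ?thesis using main by linarith
qed

theorem theorem3p1:
  shows "\<exists>c::real. c > 0 \<and>
    (\<forall>(p :: nat \<Rightarrow> nat) (k :: nat \<Rightarrow> nat) (P :: nat \<Rightarrow> obs measure)
      (\<beta> :: nat \<Rightarrow> (nat \<Rightarrow> obs) \<Rightarrow> rvec) (\<beta>S :: nat \<Rightarrow> nat set \<Rightarrow> (nat \<Rightarrow> obs) \<Rightarrow> rvec).
      (\<forall>n\<ge>1. p n \<le> n \<and> model1 (p n) (P n)) \<longrightarrow>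
      (\<forall>n\<ge>1. is_ols_estimator (sample_space n (P n)) (p n)
                (design n (p n)) (response n) (\<beta> n)) \<longrightarrow>
      (\<forall>n\<ge>1. \<forall>S\<subseteq>{..<n}. is_ols_estimator (sample_space n (P n)) (p n)
                (\<lambda>d. restrict_rows (design n (p n) d) S)
                (\<lambda>d. restrict_vec (response n d) S) (\<beta>S n S)) \<longrightarrow>
      (\<exists>B::real. \<forall>\<^sub>F n in sequentially.
          spectral_norm (mat_inv_sqrt (cov_mat (p n) (P n))) \<le> B) \<longrightarrow>
      (\<exists>B::real. \<forall>\<^sub>F n in sequentially.
          psi2_norm_vec (p n) (P n)
            (\<lambda>z. mat_inv_sqrt (cov_mat (p n) (P n)) *\<^sub>v covar (p n) z) \<le> ennreal B) \<longrightarrow>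
      (\<exists>B::real. \<forall>\<^sub>F n in sequentially. psi2_norm (P n) snd \<le> ennreal B) \<longrightarrow>
      limsup (\<lambda>n. (psi2_norm_vec (p n) (P n)
            (\<lambda>z. mat_inv_sqrt (cov_mat (p n) (P n)) *\<^sub>v covar (p n) z))\<^sup>2
          * ennreal (sqrt (real (p n) / real n))) < ennreal c \<longrightarrow>
      (\<lambda>n. real (k n) / real n) \<longlonglongrightarrow> 0 \<longrightarrow>
      converges_in_probability (\<lambda>n. sample_space n (P n))
        (\<lambda>n d. Max ((\<lambda>S. vnorm (\<beta> n d - \<beta>S n S d)) ` {S. S \<subseteq> {..<n} \<and> n \<le> card S + k n}))
        0)"
proof (intro exI[of _ "1/1000 :: real"] conjI allI impI)
  fix p k :: "nat \<Rightarrow> nat" and P :: "nat \<Rightarrow> obs measure"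
    and \<beta> :: "nat \<Rightarrow> (nat \<Rightarrow> obs) \<Rightarrow> rvec" and \<beta>S :: "nat \<Rightarrow> nat set \<Rightarrow> (nat \<Rightarrow> obs) \<Rightarrow> rvec"
  let ?K = "\<lambda>n. psi2_norm_vec (p n) (P n) (\<lambda>z. mat_inv_sqrt (cov_mat (p n) (P n)) *\<^sub>v covar (p n) z)"
  assume m1: "\<forall>n\<ge>1. p n \<le> n \<and> model1 (p n) (P n)"
    and est: "\<forall>n\<ge>1. is_ols_estimator (sample_space n (P n)) (p n) (design n (p n)) (response n) (\<beta> n)"
    and estS: "\<forall>n\<ge>1. \<forall>S\<subseteq>{..<n}. is_ols_estimator (sample_space n (P n)) (p n)
                (\<lambda>d. restrict_rows (design n (p n) d) S) (\<lambda>d. restrict_vec (response n d) S) (\<beta>S n S)"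
    and "\<exists>B::real. \<forall>\<^sub>F n in sequentially. spectral_norm (mat_inv_sqrt (cov_mat (p n) (P n))) \<le> B"
    and "\<exists>B::real. \<forall>\<^sub>F n in sequentially. ?K n \<le> ennreal B"
    and "\<exists>B::real. \<forall>\<^sub>F n in sequentially. psi2_norm (P n) snd \<le> ennreal B"
    and ls: "limsup (\<lambda>n. (?K n)\<^sup>2 * ennreal (sqrt (real (p n) / real n))) < ennreal (1/1000)"
    and k: "(\<lambda>n. real (k n) / real n) \<longlonglongrightarrow> 0"
  then obtain B1 B2 B3 where
    evB: "\<forall>\<^sub>F n in sequentially. spectral_norm (mat_inv_sqrt (cov_mat (p n) (P n))) \<le> B1"
      "\<forall>\<^sub>F n in sequentially. ?K n \<le> ennreal B2"
      "\<forall>\<^sub>F n in sequentially. psi2_norm (P n) snd \<le> ennreal B3" by blast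
  define B T ty where "B = \<bar>B1\<bar> + 1" and "T = \<bar>B2\<bar> + 1" and "ty = \<bar>B3\<bar> + 1"
  have BTt: "0 < B" "1/2 \<le> T" "0 < ty" "0 < T" by (auto simp: B_def T_def ty_def)
  have lt: "ennreal B2 < ennreal T" "ennreal B3 < ennreal ty"
    by (rule ennreal_lessI; simp add: T_def ty_def)+
  have evR: "\<forall>\<^sub>F n in sequentially. (?K n)\<^sup>2 * ennreal (sqrt (real (p n) / real n)) < ennreal (1/1000)"
    using Limsup_lessD[OF ls] by simp
  show "converges_in_probability (\<lambda>n. sample_space n (P n))
        (\<lambda>n d. Max ((\<lambda>S. vnorm (\<beta> n d - \<beta>S n S d)) ` {S. S \<subseteq> {..<n} \<and> n \<le> card S + k n})) 0"
    unfolding converges_in_probability_def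
  proof (intro allI impI)
    fix \<epsilon> :: real assume eps: "0 < \<epsilon>"
    define D where "D = 8 * B\<^sup>2 * ty\<^sup>2 * (1 + 8 * T\<^sup>2)"
    have D: "0 < D" using BTt by (auto simp: D_def intro!: mult_pos_pos add_pos_nonneg)
    \<comment> \<open>A common exponential rate for both failure probabilities; the number of sets costs a quarter of it.\<close>
    define \<gamma> where "\<gamma> = min (1 / (2000 * T ^ 4)) (\<epsilon>\<^sup>2 / D)"
    have \<gamma>: "0 < \<gamma>" "\<gamma> \<le> 1 / (2000 * T ^ 4)" "\<gamma> \<le> \<epsilon>\<^sup>2 / D" using BTt D eps by (auto simp: \<gamma>_def)
    let ?m = "\<lambda>n. measure (sample_space n (P n)) {\<omega> \<in> space (sample_space n (P n)).
       \<bar>Max ((\<lambda>S. vnorm (\<beta> n \<omega> - \<beta>S n S \<omega>)) ` {S. S \<subseteq> {..<n} \<and> n \<le> card S + k n}) - 0\<bar> > \<epsilon>}"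
    have evk: "\<forall>\<^sub>F n in sequentially. real (k n) / real n < min (\<gamma> / 4) (1 / 2)"
      using k \<gamma>(1) by (intro order_tendstoD(2)) auto
    have evc: "\<forall>\<^sub>F n in sequentially. real (card {S. S \<subseteq> {..<n} \<and> n \<le> card S + k n}) \<le> exp (\<gamma> / 4 * real n)"
      using \<gamma>(1) by (intro card_large_subsets_subexponential[OF k]) simp
    have ev: "\<forall>\<^sub>F n in sequentially. ?m n \<le> 3 * exp (- (\<gamma> / 2)) ^ n + exp (- 1) ^ n"
      using evB evR evk evc eventually_gt_at_top[of 0]
    proof eventually_elim
      case (elim n)
      have n: "0 < n" "1 \<le> n" using elim by auto
      have kk: "real (k n) \<le> \<gamma> / 4 * real n" "2 * k n \<le> n"
        using elim(5) n by (auto simp: field_simps)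
      let ?c = "real (card {S. S \<subseteq> {..<n} \<and> n \<le> card S + k n})"
      have c: "?c \<le> exp (\<gamma> / 4 * real n)" using elim by simp
      have "?m n \<le> ?c * (2 * exp (- real n / (2000 * T ^ 4)) + exp (real (k n) - \<epsilon>\<^sup>2 * real n / D)) + exp (- real n)"
        unfolding D_def
      proof (rule ols_removal_probability[OF n(1) _ kk(2) eps])
        show "model1 (p n) (P n)" using m1 n by simp
        show "is_ols_estimator (sample_space n (P n)) (p n) (design n (p n)) (response n) (\<beta> n)"
          using est n by simp
        show "is_ols_estimator (sample_space n (P n)) (p n) (\<lambda>d. restrict_rows (design n (p n) d) S)
          (\<lambda>d. restrict_vec (response n d) S) (\<beta>S n S)" if "S \<subseteq> {..<n}" for S
          using estS n that by simp
        show "spectral_norm (mat_inv_sqrt (cov_mat (p n) (P n))) \<le> B" using elim(1) by (simp add: B_def)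
        show "?K n < ennreal T" using elim(2) lt(1) by (rule le_less_trans)
        show "psi2_norm (P n) snd < ennreal ty" using elim(3) lt(2) by (rule le_less_trans)
        show "(?K n)\<^sup>2 * ennreal (sqrt (real (p n) / real n)) < ennreal (1 / 1000)" by (rule elim(4))
      qed (use BTt in auto)
      also have "\<dots> \<le> exp (\<gamma> / 4 * real n) * (2 * exp (- (\<gamma> * real n)) + exp (- (3 * \<gamma> / 4 * real n))) + exp (- real n)"
      proof (rule add_mono[OF mult_mono[OF c add_mono] order_refl])
        show "2 * exp (- real n / (2000 * T ^ 4)) \<le> 2 * exp (- (\<gamma> * real n))"
          using mult_right_mono[OF \<gamma>(2), of "real n"] by simp
        show "exp (real (k n) - \<epsilon>\<^sup>2 * real n / D) \<le> exp (- (3 * \<gamma> / 4 * real n))"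
          using mult_right_mono[OF \<gamma>(3), of "real n"] kk(1) by simp
      qed auto
      also have "\<dots> \<le> 3 * exp (- (\<gamma> / 2) * real n) + exp (- real n)"
      proof -
        have "exp (\<gamma> / 4 * real n) * exp (- (\<gamma> * real n)) \<le> exp (- (\<gamma> / 2) * real n)"
          "exp (\<gamma> / 4 * real n) * exp (- (3 * \<gamma> / 4 * real n)) \<le> exp (- (\<gamma> / 2) * real n)"
          using \<gamma>(1) by (simp_all flip: exp_add)
        then show ?thesis by (simp add: distrib_left)
      qed
      also have "\<dots> = 3 * exp (- (\<gamma> / 2)) ^ n + exp (- 1) ^ n"
        using exp_of_nat2_mult[of "- (\<gamma> / 2)" n] exp_of_nat2_mult[of "-1" n] by simp
      finally show ?case .
    qed
    have "(\<lambda>n. 3 * exp (- (\<gamma> / 2)) ^ n + exp (- 1 :: real) ^ n) \<longlonglongrightarrow> 3 * 0 + 0"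
      using \<gamma>(1) by (intro tendsto_add tendsto_mult tendsto_const LIMSEQ_realpow_zero) auto
    then have lim: "(\<lambda>n. 3 * exp (- (\<gamma> / 2)) ^ n + exp (- 1 :: real) ^ n) \<longlonglongrightarrow> 0" by simp
    show "?m \<longlonglongrightarrow> 0"
      by (rule tendsto_sandwich[OF _ ev tendsto_const lim]) simp
  qed
qed simp

end
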